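(* Let $p$ be a prime and let $\mathbb{K}$ be a number field or a finite extension of $\mathbb{Q}_p$. Let $G$ be a linear algebraic group defined over $\mathbb{K}$. Let $\mathbb{L}$ be either an algebraically closed field with $\mathrm{Char}\,\mathbb{L}=0$, or the field of real numbers $\mathbb{R}$, or a finite extension of $\mathbb{Q}_l$ for some prime $l\neq p$, and let $U$ be a unipotent algebraic group over $\mathbb{L}$. Then for any abstract homomorphism $\phi: U(\mathbb{L})\to G(\mathbb{K})$ the subgroup $\mathrm{Zcl}\,\phi(U(\mathbb{L}))$ is abelian and unipotent.
   Context: Algebraic groups are linear algebraic groups. For an algebraic group $A$ defined over a field $\mathbb{L}$, $A(\mathbb{L})$ is its group of $\mathbb{L}$-rational points. An abstract homomorphism is a homomorphism of abstract groups (no continuity or algebraicity assumed). $\mathrm{Zcl}\,W$ denotes the Zariski closure of a subset $W$ in the ambient algebraic group (here $G$). *)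

theory Defs
  imports
    "HOL-Analysis.Analysis"
    "HOL-Algebra.Algebraic_Closure_Type"
    "HOL-Library.Poly_Mapping"
begin

no_notation fps_nth (infixl \<open>$\<close> 75)

section \<open>Fields\<close>

definition padic_abs :: "nat \<Rightarrow> rat \<Rightarrow> real" where
  "padic_abs p x =
     (if x = 0 then 0
      else (let (a, b) = quotient_of x
            in real p powi (int (multiplicity (int p) b) - int (multiplicity (int p) a))))"

definition padic_Cauchy :: "nat \<Rightarrow> (nat \<Rightarrow> rat) \<Rightarrow> bool" where
  "padic_Cauchy p s \<longleftrightarrow>
     (\<forall>e>0. \<exists>N. \<forall>m\<ge>N. \<forall>n\<ge>N. padic_abs p (s m - s n) < e)"

definition padic_Cauchy_ring :: "nat \<Rightarrow> (nat \<Rightarrow> rat) ring" where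
  "padic_Cauchy_ring p =
     \<lparr>carrier = {s. padic_Cauchy p s}, monoid.mult = (\<lambda>s t n. s n * t n), one = (\<lambda>n. 1),
      ring.zero = (\<lambda>n. 0), add = (\<lambda>s t n. s n + t n)\<rparr>"

definition padic_null :: "nat \<Rightarrow> (nat \<Rightarrow> rat) set" where
  "padic_null p = {s. padic_Cauchy p s \<and> (\<lambda>n. padic_abs p (s n)) \<longlonglongrightarrow> 0}"

text \<open>The field of \<open>p\<close>-adic numbers, as the completion of the rationals for \<^term>\<open>padic_abs p\<close>.\<close>

definition Q_padic :: "nat \<Rightarrow> (nat \<Rightarrow> rat) set ring" where
  "Q_padic p = padic_Cauchy_ring p Quot padic_null p"

definition finite_extension_of :: "('b, 'c) ring_scheme \<Rightarrow> 'a::field itself \<Rightarrow> bool" where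
  "finite_extension_of F _ \<longleftrightarrow>
     (\<exists>\<iota> \<in> ring_hom F (ring_of_type_algebra :: 'a ring).
        ring.finite_dimension (ring_of_type_algebra :: 'a ring) (\<iota> ` carrier F) UNIV)"

definition number_field :: "'a::field itself \<Rightarrow> bool" where
  "number_field _ \<longleftrightarrow> finite_extension_of (ring_of_type_algebra :: rat ring) TYPE('a)"

definition padic_local_field :: "nat \<Rightarrow> 'a::field itself \<Rightarrow> bool" where
  "padic_local_field p _ \<longleftrightarrow> finite_extension_of (Q_padic p) TYPE('a)"

definition algebraically_closed_field :: "'a::field itself \<Rightarrow> bool" where
  "algebraically_closed_field _ \<longleftrightarrow>
     (\<forall>f :: 'a poly. 0 < Polynomial.degree f \<longrightarrow> (\<exists>x. poly f x = 0))"

definition isomorphic_to_reals :: "'a::field itself \<Rightarrow> bool" where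
  "isomorphic_to_reals _ \<longleftrightarrow>
     (ring_of_type_algebra :: 'a ring) \<simeq> (ring_of_type_algebra :: real ring)"


section \<open>Linear algebraic groups\<close>

text \<open>A linear algebraic group is a Zariski closed subgroup of \<open>GL\<close> over an algebraically
  closed field, identified with its group of points there. A group defined over a field \<open>'k\<close> is
  such a subgroup over \<^typ>\<open>'k alg_closure\<close>, subject to \<open>defined_over_base\<close> below.\<close>

definition GL :: "('a::field^'n^'n) monoid" where
  "GL = \<lparr>carrier = {A. invertible A}, monoid.mult = (**), one = mat 1\<rparr>"

text \<open>Polynomials in the matrix entries: a monomial is a finitely supported exponent
  function on pairs of indices, a polynomial a finitely supported function on monomials.\<close>

type_synonym ('a, 'n) matrix_poly = "(('n \<times> 'n) \<Rightarrow>\<^sub>0 nat) \<Rightarrow>\<^sub>0 'a"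

definition eval_at :: "('a::field, 'n::finite) matrix_poly \<Rightarrow> 'a^'n^'n \<Rightarrow> 'a" where
  "eval_at f A =
     (\<Sum>m \<in> Poly_Mapping.keys f. Poly_Mapping.lookup f m *
        (\<Prod>v \<in> Poly_Mapping.keys m. A $ fst v $ snd v ^ Poly_Mapping.lookup m v))"

text \<open>The Zariski topology of \<^term>\<open>GL\<close> is the one induced from the affine space of all matrices.
  Allowing the inverse of the determinant as a further coordinate gives the same closed sets, as
  denominators can be cleared; the same holds for \<open>defined_over_base\<close> below.\<close>

definition zariski_closed :: "('a::alg_closed_field^'n::finite^'n) set \<Rightarrow> bool" where
  "zariski_closed S \<longleftrightarrow> (\<exists>P. S = {A \<in> carrier GL. \<forall>f\<in>P. eval_at f A = 0})"

definition Zcl ::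
  "('a::alg_closed_field^'n::finite^'n) set \<Rightarrow> ('a^'n^'n) set \<Rightarrow> ('a^'n^'n) set" where
  "Zcl G W = (\<lambda>S. zariski_closed S \<and> S \<subseteq> G) hull W"

definition algebraic_group :: "('a::alg_closed_field^'n::finite^'n) set \<Rightarrow> bool" where
  "algebraic_group G \<longleftrightarrow> subgroup G GL \<and> zariski_closed G"

definition vanishing_ideal ::
  "('a::alg_closed_field^'n::finite^'n) set \<Rightarrow> ('a, 'n) matrix_poly set" where
  "vanishing_ideal S = {f. \<forall>A\<in>S. eval_at f A = 0}"

text \<open>A set of matrices over the algebraic closure of \<open>'k\<close> is defined over \<open>'k\<close> if its
  vanishing ideal is generated by polynomials with coefficients in \<open>'k\<close>.\<close>

definition defined_over_base :: "('k::field alg_closure^'n::finite^'n) set \<Rightarrow> bool" where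
  "defined_over_base S \<longleftrightarrow>
     vanishing_ideal S =
       Idl\<^bsub>ring_of_type_algebra\<^esub>
         {f \<in> vanishing_ideal S. \<forall>m. Poly_Mapping.lookup f m \<in> range to_ac}"

definition rational_points ::
  "('k::field alg_closure^'n^'n) set \<Rightarrow> ('k alg_closure^'n^'n) set" where
  "rational_points G = {A \<in> G. \<forall>i j. A $ i $ j \<in> range to_ac}"

text \<open>The iteration below is the \<open>k\<close>-th power of \<open>A - mat 1\<close> for the matrix product; the power
  operation of the vector type is componentwise.\<close>

definition unipotent_matrix :: "'a::field^'n::finite^'n \<Rightarrow> bool" where
  "unipotent_matrix A \<longleftrightarrow> (\<exists>k. (((**) (A - mat 1)) ^^ k) (mat 1) = 0)"

definition unipotent_algebraic_group :: "('a::alg_closed_field^'n::finite^'n) set \<Rightarrow> bool" where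
  "unipotent_algebraic_group G \<longleftrightarrow> algebraic_group G \<and> (\<forall>A\<in>G. unipotent_matrix A)"

end

theory Submission
  imports Defs "HOL-Number_Theory.Residues"
begin

text \<open>Write \<open>L\<close> and \<open>K\<close> for the two ground fields, \<open>V\<close> for the group of \<open>L\<close>-rational points of \<open>U\<close>, and
  \<open>F\<close> for the rationals or the \<open>p\<close>-adic numbers, over which \<open>K\<close> is finite. Two properties of \<open>V\<close> are used.
  As \<open>V\<close> is Zariski closed and unipotent in characteristic 0, it contains with \<open>x\<close> all powers
  \<open>x\<^sup>t = \<Sum>i. (t choose i) (x - 1)\<^sup>i\<close> with \<open>t\<close> in \<open>L\<close> (\<open>rational_points_pw\<close>). By Kolchin's theorem
  (\<open>kolchin_filtration\<close>) it has a descending filtration \<open>V = V\<^sub>1 \<supseteq> V\<^sub>2 \<supseteq> \<dots>\<close> that ends with \<open>1\<close>, consists of subgroups closed under these powers,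
  and satisfies \<open>[V\<^sub>i, V\<^sub>j] \<subseteq> V\<^sub>i\<^sub>+\<^sub>j\<close>.
  
  The image of \<open>V\<close> consists of unipotent matrices because \<open>V\<close> is divisible: an invertible matrix over \<open>K\<close> that has an
  \<open>m\<close>-th root over \<open>K\<close> for every \<open>m > 0\<close> has only the eigenvalue 1 (\<open>divisible_matrix_unipotent\<close>). The
  eigenvalues of all these roots have bounded degree over \<open>F\<close>. Extend the \<open>p\<close>-adic valuation ring of \<open>F\<close> to a
  valuation ring of the algebraic closure. On elements of bounded degree the values form a discrete group, so
  infinite divisibility makes the eigenvalues units; and their residues are roots of unity of bounded order,
  so infinite divisibility makes them 1. Hence an eigenvalue \<open>\<lambda>\<close> is a \<open>p\<^sup>n\<close>-th power, for every \<open>n\<close>, of an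
  element congruent to 1, and such powers converge to 1 uniformly for elements of bounded degree.
  
  The image is commutative because of a statement on Heisenberg relations (\<open>heisenberg_trivial\<close>): if \<open>f\<close>, \<open>g\<close>, \<open>h\<close>
  are homomorphisms from the additive group of \<open>L\<close> to unipotent matrices over \<open>K\<close> with
  \<open>f t * g s = g s * f t * h (t * s)\<close>, then \<open>h\<close> is trivial. For the logarithms the relation reads
  \<open>[F t, G s] = H (t * s)\<close>. It lets every \<open>y\<close> in \<open>L\<close> act on the span of the functions \<open>s \<mapsto> H (t * s)\<close>, a space of
  bounded dimension, by \<open>H t \<mapsto> H (y * t)\<close>. If \<open>y\<^sup>Q = p\<^sup>m\<close>, an eigenvalue \<open>\<lambda>\<close> of \<open>y\<close> has bounded degree over \<open>F\<close> and
  \<open>\<lambda>\<^sup>Q = p\<^sup>m\<close>, which is impossible for large \<open>Q\<close> as the value of \<open>\<lambda>\<close> would be too small. Such \<open>y\<close> exist for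
  arbitrarily large \<open>Q\<close> (\<open>source_field_data\<close>); this is evident in an algebraically closed field and in the reals, and in
  an \<open>l\<close>-adic field with \<open>l \<noteq> p\<close> it holds because \<open>p\<^sup>l\<^sup>-\<^sup>1\<close> is congruent to 1 modulo \<open>l\<close>.
  
  Heisenberg relations arise by descending induction along the filtration (\<open>homomorphic_image_commutative\<close>). Let
  \<open>D\<^sub>k\<close> be the set of all \<open>z\<close> in \<open>V\<^sub>k\<close> all of whose powers \<open>z\<^sup>t\<close> are killed by \<open>\<phi>\<close>, and let \<open>x \<in> V\<^sub>i\<close>, \<open>y \<in> V\<^sub>j\<close> with \<open>i + j = k\<close>
  and commutator \<open>c\<close>. Modulo \<open>D\<^sub>k\<^sub>+\<^sub>1\<close>, which by induction contains the relevant commutators, \<open>c\<close> is central, so that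
  \<open>x\<^sup>t y\<^sup>s\<close> is congruent to \<open>y\<^sup>s x\<^sup>t c\<^sup>t\<^sup>s\<close> for natural numbers \<open>s\<close> and \<open>t\<close>. A density argument for polynomial families
  (\<open>polynomial_path_in_closed\<close>) extends this to all \<open>s\<close> and \<open>t\<close> in \<open>L\<close>. Applying \<open>\<phi>\<close> yields a Heisenberg relation
  with \<open>h t = \<phi> (c\<^sup>t)\<close>, so \<open>c\<close> lies in \<open>D\<^sub>k\<close>. For \<open>k = 2\<close> this says that \<open>\<phi>\<close> kills all commutators.
  
  Commutativity and unipotency are polynomial conditions, and inversion of unipotent matrices is a polynomial map;
  therefore all this passes to the Zariski closure (\<open>Zcl_commutative_unipotent\<close>).\<close>

section \<open>Square matrices as a ring\<close>

text \<open>The product of the type of vectors of vectors is componentwise. This copy carries the matrix product, which makes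
  ring notation and the ring lemmas available.\<close>

typedef (overloaded) ('a, 'n) sqmat = "UNIV :: ('a^'n::finite^'n) set"
  morphisms mat_of sqm ..

setup_lifting type_definition_sqmat

lift_definition ent :: "('a, 'n::finite) sqmat \<Rightarrow> 'n \<Rightarrow> 'n \<Rightarrow> 'a" is "\<lambda>A i j. A $ i $ j" .

lemma sqmat_eqI: "(\<And>i j. ent A i j = ent B i j) \<Longrightarrow> A = B"
  by transfer (simp add: vec_eq_iff)

instantiation sqmat :: (comm_ring_1, finite) ring_1
begin
lift_definition zero_sqmat :: "('a, 'b) sqmat" is "0" .
lift_definition one_sqmat :: "('a, 'b) sqmat" is "mat 1" .
lift_definition plus_sqmat :: "('a, 'b) sqmat \<Rightarrow> ('a, 'b) sqmat \<Rightarrow> ('a, 'b) sqmat" is "(+)" .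
lift_definition minus_sqmat :: "('a, 'b) sqmat \<Rightarrow> ('a, 'b) sqmat \<Rightarrow> ('a, 'b) sqmat" is "(-)" .
lift_definition uminus_sqmat :: "('a, 'b) sqmat \<Rightarrow> ('a, 'b) sqmat" is "uminus" .
lift_definition times_sqmat :: "('a, 'b) sqmat \<Rightarrow> ('a, 'b) sqmat \<Rightarrow> ('a, 'b) sqmat" is "(**)" .
instance
proof
  show "(0 :: ('a, 'b) sqmat) \<noteq> 1"
    by transfer (auto simp: vec_eq_iff mat_def)
  show "A * B * C = A * (B * C)" for A B C :: "('a, 'b) sqmat"
    by transfer (simp add: matrix_mul_assoc)
qed (transfer; simp add: vec_eq_iff matrix_matrix_mult_def mat_def if_distrib [of "\<lambda>x. x * _"]
      if_distrib [of "\<lambda>x. _ * x"] algebra_simps sum.distrib cong: if_cong)+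
end

lemma ent_simps [simp]:
  "ent 0 i j = (0 :: 'a::comm_ring_1)"
  "ent 1 i j = (if i = j then 1 else 0 :: 'a)"
  "ent (A + B) i j = ent A i j + (ent B i j :: 'a)"
  "ent (A - B) i j = ent A i j - (ent B i j :: 'a)"
  "ent (- A) i j = - (ent A i j :: 'a)"
  by (transfer; simp add: mat_def)+

lemma ent_mult: "ent (A * B) i j = (\<Sum>k\<in>UNIV. ent A i k * ent B k j :: 'a::comm_ring_1)"
  by transfer (simp add: matrix_matrix_mult_def)

lemma ent_sum: "ent (\<Sum>x\<in>S. f x) i j = (\<Sum>x\<in>S. ent (f x) i j :: 'a::comm_ring_1)"
  by (induction S rule: infinite_finite_induct) auto

lift_definition scl :: "'a::comm_ring_1 \<Rightarrow> ('a, 'n::finite) sqmat \<Rightarrow> ('a, 'n) sqmat"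
  is "\<lambda>c A. \<chi> i j. c * A $ i $ j" .

lemma ent_scl [simp]: "ent (scl c A) i j = c * ent A i j"
  by transfer simp

global_interpretation sqm: Modules.module scl
  by unfold_locales (rule sqmat_eqI; simp add: algebra_simps)+

lemma scl_mult_left [simp]: "scl c A * B = scl c (A * B)"
  and scl_mult_right [simp]: "A * scl c B = scl c (A * B)"
  by (rule sqmat_eqI; simp add: ent_mult sum_distrib_left algebra_simps)+

lemma scl_of_nat: "scl (of_nat n) A = of_nat n * A"
  by (induction n) (simp_all add: algebra_simps sqm.scale_left_distrib)

lemma scl_eq_0_iff: "scl (c :: 'a::field) A = 0 \<longleftrightarrow> c = 0 \<or> A = 0"
proof
  assume h: "scl c A = 0"
  show "c = 0 \<or> A = 0"
  proof (rule disjCI)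
    assume "A \<noteq> 0"
    then obtain i j where "ent A i j \<noteq> 0"
      using sqmat_eqI[of A 0] by auto
    with h show "c = 0"
      by (metis ent_scl ent_simps(1) mult_eq_0_iff)
  qed
qed auto

lift_definition emap :: "('a \<Rightarrow> 'b) \<Rightarrow> ('a, 'n::finite) sqmat \<Rightarrow> ('b, 'n) sqmat"
  is "\<lambda>f A. \<chi> i j. f (A $ i $ j)" .

lemma ent_emap [simp]: "ent (emap f A) i j = f (ent A i j)"
  by transfer simp

section \<open>Polynomial families of matrices\<close>

lemma of_nat_inject_CHAR_0:
  assumes "CHAR('a::ring_1) = 0"
  shows "(of_nat m = (of_nat n :: 'a)) \<longleftrightarrow> m = n"
proof -
  have *: "m = n" if "of_nat m = (of_nat n :: 'a)" "m \<le> n" for m n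
  proof -
    have "of_nat (n - m) = (0 :: 'a)"
      using that by (simp add: of_nat_diff)
    then have "CHAR('a) dvd n - m"
      by (simp only: of_nat_eq_0_iff_char_dvd)
    then show ?thesis
      using assms that by simp
  qed
  show ?thesis
    using *[of m n] *[of n m] by (metis nat_le_linear)
qed

lemma of_nat_eq_0_CHAR_0:
  assumes "CHAR('a::ring_1) = 0"
  shows "(of_nat m = (0 :: 'a)) \<longleftrightarrow> m = 0"
  using of_nat_inject_CHAR_0[OF assms, of m 0] by simp

lemma poly_eq_on_nat:
  fixes p q :: "'a::field poly"
  assumes "CHAR('a) = 0" "\<And>n. poly p (of_nat n) = poly q (of_nat n)"
  shows "p = q"
proof (rule ccontr)
  assume "p \<noteq> q"
  then have "finite {x. poly (p - q) x = 0}"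
    by (intro poly_roots_finite) auto
  moreover have "range (of_nat :: nat \<Rightarrow> 'a) \<subseteq> {x. poly (p - q) x = 0}"
    using assms(2) by auto
  moreover have "inj (of_nat :: nat \<Rightarrow> 'a)"
    using of_nat_inject_CHAR_0[OF assms(1)] by (auto simp: inj_def)
  ultimately show False
    using finite_subset infinite_UNIV_nat finite_imageD by metis
qed

text \<open>A matrix with polynomial entries is a polynomial family \<open>t \<mapsto> ev t M\<close>, with matrix coefficients \<open>cf k M\<close>. Identities
  between such families need only be checked for natural numbers \<open>t\<close>.\<close>

definition ev :: "'a \<Rightarrow> ('a::comm_ring_1 poly, 'n::finite) sqmat \<Rightarrow> ('a, 'n) sqmat" where
  "ev t = emap (\<lambda>p. poly p t)"

definition cf :: "nat \<Rightarrow> ('a::comm_ring_1 poly, 'n::finite) sqmat \<Rightarrow> ('a, 'n) sqmat" where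
  "cf k = emap (\<lambda>p. Polynomial.coeff p k)"

definition cst :: "('a::comm_ring_1, 'n::finite) sqmat \<Rightarrow> ('a poly, 'n) sqmat" where
  "cst = emap (\<lambda>c. [:c:])"

lemma ev_simps [simp]:
  "ev t 0 = 0" "ev t 1 = 1" "ev t (M + N) = ev t M + ev t N" "ev t (M - N) = ev t M - ev t N"
  "ev t (M * N) = ev t M * ev t N" "ev t (scl p M) = scl (poly p t) (ev t M)" "ev t (cst A) = A"
  "ev t (\<Sum>x\<in>S. f x) = (\<Sum>x\<in>S. ev t (f x))"
  by (rule sqmat_eqI; simp add: ev_def cst_def ent_mult ent_sum poly_sum)+

lemma cf_simps [simp]:
  "cf k 0 = 0" "cf k (M + N) = cf k M + cf k N" "cf k (M - N) = cf k M - cf k N"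
  "cf k (M * cst A) = cf k M * A" "cf k (cst A * M) = A * cf k M"
  by (rule sqmat_eqI; simp add: cf_def cst_def ent_mult coeff_sum mult.commute[of _ "[:_:]"] mult.commute)+

text \<open>The Leibniz rule for the derivative at 0.\<close>

lemma cf_1_mult: "cf 1 (M * N) = cf 1 M * ev 0 N + ev 0 M * cf 1 N"
  by (rule sqmat_eqI)
     (simp add: cf_def ev_def ent_mult coeff_sum coeff_mult poly_0_coeff_0 sum.distrib algebra_simps)

lemma poly_sqmat_eqI:
  fixes M N :: "('a::field poly, 'n::finite) sqmat"
  assumes "CHAR('a) = 0" "\<And>n. ev (of_nat n) M = ev (of_nat n) N"
  shows "M = N"
proof (rule sqmat_eqI)
  fix i j
  show "ent M i j = ent N i j"
  proof (rule poly_eq_on_nat[OF assms(1)])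
    fix n
    have "ent (ev (of_nat n) M) i j = ent (ev (of_nat n) N) i j"
      using assms(2) by simp
    then show "poly (ent M i j) (of_nat n) = poly (ent N i j) (of_nat n)"
      by (simp add: ev_def)
  qed
qed

lemma ev_expand:
  fixes M :: "('a::field poly, 'n::finite) sqmat"
  obtains d where "\<And>t. ev t M = (\<Sum>k\<le>d. scl (t ^ k) (cf k M))"
proof -
  define d where "d = Max (range (\<lambda>(i, j). Polynomial.degree (ent M i j)))"
  have "Polynomial.degree (ent M i j) \<le> d" for i j
    unfolding d_def by (intro Max_ge) auto
  then have "poly (ent M i j) t = (\<Sum>k\<le>d. Polynomial.coeff (ent M i j) k * t ^ k)" for i j t
    unfolding poly_altdef by (intro sum.mono_neutral_left) (auto simp: coeff_eq_0 not_le)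
  then have "ev t M = (\<Sum>k\<le>d. scl (t ^ k) (cf k M))" for t
    by (intro sqmat_eqI) (simp add: ev_def cf_def ent_sum mult.commute)
  with that show ?thesis by blast
qed

section \<open>Powers and logarithms of unipotent matrices\<close>

text \<open>The binomial coefficient \<open>t (t - 1) \<dots> (t - k + 1) / k!\<close> in a field whose characteristic is 0 by hypothesis rather than
  by its type class.\<close>

primrec binom :: "'a::field \<Rightarrow> nat \<Rightarrow> 'a" where
  "binom t 0 = 1"
| "binom t (Suc k) = binom t k * (t - of_nat k) / of_nat (Suc k)"

primrec binom_poly :: "nat \<Rightarrow> 'a::field poly" where
  "binom_poly 0 = 1"
| "binom_poly (Suc k) = Polynomial.smult (inverse (of_nat (Suc k))) (binom_poly k * [:- of_nat k, 1:])"

lemma poly_binom_poly: "poly (binom_poly k) t = binom t k"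
  by (induction k) (simp_all add: field_simps)

lemma binom_of_nat:
  assumes "CHAR('a::field) = 0"
  shows "binom (of_nat n :: 'a) k = of_nat (n choose k)"
proof (induction k)
  case (Suc k)
  have "(of_nat (n choose k) :: 'a) * (of_nat n - of_nat k) = of_nat (n choose Suc k) * of_nat (Suc k)"
  proof (cases "k \<le> n")
    case True
    have "(n choose k) * (n - k) = (n choose Suc k) * Suc k"
      using binomial_absorb_comp[of n k] by (metis binomial_absorption mult.commute binomial_eq_0 choose_mult_lemma times_binomial_minus1_eq binomial_symmetric Suc_times_binomial_eq)
    then show ?thesis
      using True by (metis of_nat_diff of_nat_mult)
  qed (simp add: binomial_eq_0)
  then show ?case
    using Suc of_nat_eq_0_CHAR_0[OF assms, of "Suc k"] by (simp add: field_simps del: of_nat_Suc)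
qed simp

text \<open>The power \<open>x\<^sup>t\<close> of a unipotent matrix, with an exponent from the field: the binomial series of \<open>(1 + (x - 1))\<^sup>t\<close>, cut off at an
  exponent \<open>N\<close> for which \<open>(x - 1)\<^sup>N = 0\<close>.\<close>

definition pw :: "nat \<Rightarrow> ('a::field, 'n::finite) sqmat \<Rightarrow> 'a \<Rightarrow> ('a, 'n) sqmat" where
  "pw N x t = (\<Sum>k<N. scl (binom t k) ((x - 1) ^ k))"

definition Pw :: "nat \<Rightarrow> ('a::field, 'n::finite) sqmat \<Rightarrow> ('a poly, 'n) sqmat" where
  "Pw N x = (\<Sum>k<N. scl (binom_poly k) (cst ((x - 1) ^ k)))"

lemma ev_Pw [simp]: "ev t (Pw N x) = pw N x t"
  by (simp add: Pw_def pw_def poly_binom_poly)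

lemma power_one_plus_nilpotent:
  fixes z :: "'a::ring_1"
  assumes "z ^ N = 0"
  shows "(1 + z) ^ n = (\<Sum>k<N. of_nat (n choose k) * z ^ k)"
proof -
  have "(1 + z) ^ n = (\<Sum>k\<le>n. of_nat (n choose k) * z ^ k)"
  proof (induction n)
    case (Suc n)
    have "(1 + z) ^ Suc n = (\<Sum>k\<le>n. of_nat (n choose k) * z ^ k) + (\<Sum>k\<le>n. of_nat (n choose k) * z ^ Suc k)"
      unfolding power_Suc Suc by (simp add: distrib_right sum_distrib_left mult_of_nat_commute mult.assoc sum.distrib)
    also have "(\<Sum>k\<le>n. of_nat (n choose k) * z ^ k) = (\<Sum>k\<le>Suc n. of_nat (n choose k) * z ^ k)"
      by (simp add: binomial_eq_0)
    also have "(\<Sum>k\<le>Suc n. of_nat (n choose k) * z ^ k) = 1 + (\<Sum>k\<le>n. of_nat (n choose Suc k) * z ^ Suc k)"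
      by (simp only: sum.atMost_Suc_shift) simp
    also have "1 + (\<Sum>k\<le>n. of_nat (n choose Suc k) * z ^ Suc k) + (\<Sum>k\<le>n. of_nat (n choose k) * z ^ Suc k)
        = 1 + (\<Sum>k\<le>n. of_nat (Suc n choose Suc k) * z ^ Suc k)"
      by (simp add: sum.distrib [symmetric] distrib_right add.commute)
    also have "\<dots> = (\<Sum>k\<le>Suc n. of_nat (Suc n choose k) * z ^ k)"
      by (simp only: sum.atMost_Suc_shift) simp
    finally show ?case .
  qed simp
  also have "\<dots> = (\<Sum>k\<in>{..n} \<union> {..<N}. of_nat (n choose k) * z ^ k)"
    by (intro sum.mono_neutral_left) (auto simp: binomial_eq_0 not_le)
  also have "\<dots> = (\<Sum>k<N. of_nat (n choose k) * z ^ k)"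
  proof (intro sum.mono_neutral_right)
    have "z ^ k = 0" if "\<not> k < N" for k
      using assms that by (metis le_add_diff_inverse mult_zero_left not_le power_add)
    then show "\<forall>i\<in>{..n} \<union> {..<N} - {..<N}. of_nat (n choose i) * z ^ i = 0"
      by auto
  qed auto
  finally show ?thesis .
qed

lemma pw_of_nat:
  fixes x :: "('a::field, 'n::finite) sqmat"
  assumes "CHAR('a) = 0" "(x - 1) ^ N = 0"
  shows "pw N x (of_nat n) = x ^ n"
  using power_one_plus_nilpotent[OF assms(2), of n]
  by (simp add: pw_def binom_of_nat[OF assms(1)] scl_of_nat)

lemma pw_0 [simp]:
  fixes x :: "('a::field, 'n::finite) sqmat"
  assumes "CHAR('a) = 0" "(x - 1) ^ N = 0"
  shows "pw N x 0 = 1"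
  using pw_of_nat[OF assms, of 0] by simp

lemma pw_1 [simp]:
  fixes x :: "('a::field, 'n::finite) sqmat"
  assumes "CHAR('a) = 0" "(x - 1) ^ N = 0"
  shows "pw N x 1 = x"
  using pw_of_nat[OF assms, of 1] by simp

definition pc :: "('a::field poly, 'n::finite) sqmat \<Rightarrow> 'a poly \<Rightarrow> ('a poly, 'n) sqmat" where
  "pc M q = emap (\<lambda>p. pcompose p q) M"

lemma ev_pc [simp]: "ev t (pc M q) = ev (poly q t) M"
  by (rule sqmat_eqI) (simp add: ev_def pc_def poly_pcompose)

text \<open>The rules for powers below are polynomial in the exponents; by this lemma they follow from the rules for natural exponents.\<close>

lemma ev_eqI:
  fixes M M' :: "('a::field poly, 'n::finite) sqmat"
  assumes "CHAR('a) = 0" "\<And>n. ev (of_nat n) M = ev (of_nat n) M'"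
  shows "ev t M = ev t M'"
  using poly_sqmat_eqI[OF assms] by simp

lemma pw_add:
  fixes x :: "('a::field, 'n::finite) sqmat"
  assumes c: "CHAR('a) = 0" and u: "(x - 1) ^ N = 0"
  shows "pw N x (s + t) = pw N x s * pw N x t"
proof -
  have 1: "pw N x (of_nat m + t) = x ^ m * pw N x t" for m t
    using ev_eqI[of "pc (Pw N x) [:of_nat m, 1:]" "cst (x ^ m) * Pw N x" t, OF c]
      pw_of_nat[OF c u] by (simp add: of_nat_add[symmetric] power_add del: of_nat_add)
  show ?thesis
    using ev_eqI[of "pc (Pw N x) [:t, 1:]" "Pw N x * cst (pw N x t)" s, OF c] 1[of _ t]
      pw_of_nat[OF c u] by (simp add: add.commute)
qed

lemma pw_mult_of_nat:
  fixes x :: "('a::field, 'n::finite) sqmat"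
  assumes c: "CHAR('a) = 0" and u: "(x - 1) ^ N = 0"
  shows "pw N x (of_nat n * t) = pw N x t ^ n"
  by (induction n) (use assms in \<open>simp_all add: distrib_right pw_add\<close>)

lemma pw_inverse:
  fixes x :: "('a::field, 'n::finite) sqmat"
  assumes c: "CHAR('a) = 0" and u: "(x - 1) ^ N = 0"
  shows "pw N x t * pw N x (- t) = 1" "pw N x (- t) * pw N x t = 1"
  using pw_add[OF assms, of t "-t"] pw_add[OF assms, of "-t" t] pw_0[OF assms] by simp_all

lemma pw_pw:
  fixes x :: "('a::field, 'n::finite) sqmat"
  assumes c: "CHAR('a) = 0" and u: "(x - 1) ^ N = 0" and v: "(pw N x s - 1) ^ N = 0"
  shows "pw N (pw N x s) t = pw N x (s * t)"
  using ev_eqI[of "Pw N (pw N x s)" "pc (Pw N x) [:0, s:]" t, OF c]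
  by (simp add: pw_of_nat[OF c v] pw_mult_of_nat[OF c u, symmetric] mult.commute)

lemma pw_mult:
  fixes x y :: "('a::field, 'n::finite) sqmat"
  assumes c: "CHAR('a) = 0" and u: "(x - 1) ^ N = 0" "(y - 1) ^ N = 0" "(x * y - 1) ^ N = 0" and xy: "x * y = y * x"
  shows "pw N (x * y) t = pw N x t * pw N y t"
proof -
  have "(x * y) ^ n = x ^ n * y ^ n" for n
  proof (induction n)
    case (Suc n)
    have "y * x ^ n = x ^ n * y"
      using power_commuting_commutes[OF xy] by simp
    then have "x * (y * x ^ n) * y ^ n = x * (x ^ n * y) * y ^ n"
      by simp
    then show ?case
      by (simp add: Suc mult.assoc)
  qed simp
  then show ?thesis
  using ev_eqI[of "Pw N (x * y)" "Pw N x * Pw N y" t, OF c]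
  by (simp add: pw_of_nat[OF c] u)
qed

lemma pw_conj:
  fixes x y :: "('a::field, 'n::finite) sqmat"
  assumes c: "CHAR('a) = 0" and u: "(x - 1) ^ N = 0" and y: "y' * y = 1" "y * y' = 1"
  shows "pw N (y' * x * y) t = y' * pw N x t * y" "(y' * x * y - 1) ^ N = 0"
proof -
  have p: "(y' * z * y) ^ k = y' * z ^ k * y" for z k
  proof (induction k)
    case (Suc k)
    have "(y' * z * y) ^ Suc k = y' * z * (y * y') * z ^ k * y"
      using Suc by (simp add: mult.assoc)
    then show ?case
      by (simp add: y mult.assoc)
  qed (simp add: y)
  have "y' * x * y - 1 = y' * (x - 1) * y"
    by (simp add: algebra_simps y)
  with p[of "x - 1"] have p': "(y' * x * y - 1) ^ k = y' * (x - 1) ^ k * y" for k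
    by simp
  show "pw N (y' * x * y) t = y' * pw N x t * y"
    unfolding pw_def p' by (simp add: sum_distrib_left sum_distrib_right)
  show "(y' * x * y - 1) ^ N = 0"
    using p'[of N] u by simp
qed

text \<open>The derivative of \<open>t \<mapsto> x\<^sup>t\<close> at 0, that is, the logarithm of \<open>x\<close>.\<close>

definition mlog :: "nat \<Rightarrow> ('a::field, 'n::finite) sqmat \<Rightarrow> ('a, 'n) sqmat" where
  "mlog N x = cf 1 (Pw N x)"

text \<open>Differentiate \<open>(x y)\<^sup>t = x\<^sup>t y\<^sup>t\<close> at \<open>t = 0\<close>.\<close>

lemma mlog_mult:
  fixes x y :: "('a::field, 'n::finite) sqmat"
  assumes c: "CHAR('a) = 0" and u: "(x - 1) ^ N = 0" "(y - 1) ^ N = 0" "(x * y - 1) ^ N = 0" and xy: "x * y = y * x"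
  shows "mlog N (x * y) = mlog N x + mlog N y"
proof -
  have "Pw N (x * y) = Pw N x * Pw N y"
    using poly_sqmat_eqI[of "Pw N (x * y)" "Pw N x * Pw N y", OF c] pw_mult[OF assms] by simp
  then show ?thesis
    using pw_0[OF c u(1)] pw_0[OF c u(2)] unfolding mlog_def by (simp add: cf_1_mult[simplified])
qed

lemma mlog_expand: "mlog N x = (\<Sum>k<N. scl (Polynomial.coeff (binom_poly k) 1) ((x - 1) ^ k))"
  unfolding mlog_def Pw_def cf_def cst_def
  by (rule sqmat_eqI) (simp add: ent_sum coeff_sum mult.commute)

text \<open>With \<open>z = x - 1\<close> the logarithm has the form \<open>z + z\<^sup>2 (\<dots>)\<close>. If \<open>z\<^sup>k\<close> is the last nonzero power, then \<open>z\<^sup>k\<^sup>-\<^sup>1\<close> times the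
  logarithm is \<open>z\<^sup>k\<close>.\<close>

lemma mlog_eq_0D:
  fixes x :: "('a::field, 'n::finite) sqmat"
  assumes u: "(x - 1) ^ N = 0" and l: "mlog N x = 0"
  shows "x = 1"
proof (rule ccontr)
  assume "x \<noteq> 1"
  define z where "z = x - 1"
  have z: "z \<noteq> 0" "z ^ N = 0"
    using \<open>x \<noteq> 1\<close> u by (auto simp: z_def)
  define k where "k = (LEAST k. z ^ k = 0)"
  have k0: "z ^ k = 0"
    unfolding k_def using z(2) by (rule LeastI)
  have k1: "z ^ j \<noteq> 0" if "j < k" for j
    using that not_less_Least unfolding k_def by blast
  have "k \<noteq> 0" "k \<noteq> Suc 0"
    using k0 z by (auto intro: ccontr)
  then obtain j where j: "k = Suc (Suc j)"
    by (metis not0_implies_Suc)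
  have kN: "k \<le> N"
    unfolding k_def using z(2) by (rule Least_le)
  have "0 = mlog N x * z ^ j"
    by (simp add: l)
  also have "\<dots> = (\<Sum>i<N. scl (Polynomial.coeff (binom_poly i) 1) (z ^ (i + j)))"
    by (simp add: mlog_expand z_def sum_distrib_right power_add)
  also have "\<dots> = (\<Sum>i\<in>{1}. scl (Polynomial.coeff (binom_poly i) 1) (z ^ (i + j)))"
  proof (intro sum.mono_neutral_right ballI)
    fix i assume i: "i \<in> {..<N} - {1}"
    show "scl (Polynomial.coeff (binom_poly i) 1) (z ^ (i + j)) = 0"
    proof (cases "i = 0")
      case False
      then have "i + j = k + (i - 2)"
        using i j by auto
      then show ?thesis
        by (simp add: power_add k0)
    qed simp
  qed (use kN j in auto)
  also have "\<dots> = z ^ Suc j"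
    by (simp add: mult.commute)
  finally show False
    using k1[of "Suc j"] j by simp
qed

section \<open>Linear dependence over a subfield\<close>

definition sub_ring :: "'a::field set \<Rightarrow> bool" where
  "sub_ring R \<longleftrightarrow> 1 \<in> R \<and> (\<forall>x\<in>R. \<forall>y\<in>R. x - y \<in> R \<and> x * y \<in> R)"

lemma sub_ringD:
  assumes "sub_ring R"
  shows "0 \<in> R" "1 \<in> R" "x \<in> R \<Longrightarrow> y \<in> R \<Longrightarrow> x - y \<in> R" "x \<in> R \<Longrightarrow> y \<in> R \<Longrightarrow> x * y \<in> R"
    "x \<in> R \<Longrightarrow> - x \<in> R" "x \<in> R \<Longrightarrow> y \<in> R \<Longrightarrow> x + y \<in> R"
    "x \<in> R \<Longrightarrow> x ^ n \<in> R" "of_nat n \<in> R" "(\<And>k. k \<in> S \<Longrightarrow> f k \<in> R) \<Longrightarrow> sum f S \<in> R"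
proof -
  have basic: "1 \<in> R" "\<And>x y. x \<in> R \<Longrightarrow> y \<in> R \<Longrightarrow> x - y \<in> R" "\<And>x y. x \<in> R \<Longrightarrow> y \<in> R \<Longrightarrow> x * y \<in> R"
    using assms by (simp_all add: sub_ring_def)
  have z: "0 \<in> R" using basic(2)[OF basic(1) basic(1)] by simp
  have neg: "- x \<in> R" if "x \<in> R" for x
    using basic(2)[OF z that] by simp
  have add: "x + y \<in> R" if "x \<in> R" "y \<in> R" for x y
    using basic(2)[OF that(1) neg[OF that(2)]] by simp
  show "0 \<in> R" "1 \<in> R" by (fact z basic)+
  show "x \<in> R \<Longrightarrow> y \<in> R \<Longrightarrow> x - y \<in> R" by (rule basic)
  show "x \<in> R \<Longrightarrow> y \<in> R \<Longrightarrow> x * y \<in> R" by (rule basic)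
  show "x \<in> R \<Longrightarrow> - x \<in> R" by (rule neg)
  show "x \<in> R \<Longrightarrow> y \<in> R \<Longrightarrow> x + y \<in> R" by (rule add)
  show "x \<in> R \<Longrightarrow> x ^ n \<in> R"
    by (induction n) (simp_all add: basic(1,3))
  show "of_nat n \<in> R"
    by (induction n) (simp_all add: z basic(1) add)
  show "(\<And>k. k \<in> S \<Longrightarrow> f k \<in> R) \<Longrightarrow> sum f S \<in> R"
    by (induction S rule: infinite_finite_induct) (simp_all add: z add)
qed

definition sub_field :: "'a::field set \<Rightarrow> bool" where
  "sub_field F \<longleftrightarrow> 0 \<in> F \<and> 1 \<in> F \<and> (\<forall>x\<in>F. \<forall>y\<in>F. x - y \<in> F \<and> x * y \<in> F) \<and> (\<forall>x\<in>F. inverse x \<in> F)"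

lemma sub_fieldD:
  assumes "sub_field F"
  shows "0 \<in> F" "1 \<in> F" "x \<in> F \<Longrightarrow> y \<in> F \<Longrightarrow> x - y \<in> F" "x \<in> F \<Longrightarrow> y \<in> F \<Longrightarrow> x * y \<in> F"
    "x \<in> F \<Longrightarrow> inverse x \<in> F" "x \<in> F \<Longrightarrow> - x \<in> F" "x \<in> F \<Longrightarrow> y \<in> F \<Longrightarrow> x + y \<in> F"
    "x \<in> F \<Longrightarrow> y \<in> F \<Longrightarrow> x / y \<in> F" "x \<in> F \<Longrightarrow> x ^ n \<in> F" "of_nat n \<in> F"
    "(\<And>k. k \<in> S \<Longrightarrow> f k \<in> F) \<Longrightarrow> sum f S \<in> F"
proof -
  have "sub_ring F" and inv: "\<And>x. x \<in> F \<Longrightarrow> inverse x \<in> F"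
    using assms by (simp_all add: sub_field_def sub_ring_def)
  note R = sub_ringD[OF this(1)]
  show "0 \<in> F" "1 \<in> F" by (fact R)+
  show "x \<in> F \<Longrightarrow> y \<in> F \<Longrightarrow> x - y \<in> F" by (rule R)
  show "x \<in> F \<Longrightarrow> y \<in> F \<Longrightarrow> x * y \<in> F" by (rule R)
  show "x \<in> F \<Longrightarrow> inverse x \<in> F" by (rule inv)
  show "x \<in> F \<Longrightarrow> - x \<in> F" by (rule R)
  show "x \<in> F \<Longrightarrow> y \<in> F \<Longrightarrow> x + y \<in> F" by (rule R)
  show "x \<in> F \<Longrightarrow> y \<in> F \<Longrightarrow> x / y \<in> F"
    unfolding divide_inverse by (intro R inv)
  show "x \<in> F \<Longrightarrow> x ^ n \<in> F" by (rule R)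
  show "of_nat n \<in> F" by (rule R)
  show "(\<And>k. k \<in> S \<Longrightarrow> f k \<in> F) \<Longrightarrow> sum f S \<in> F" by (rule R)
qed

lemma sub_field_UNIV: "sub_field UNIV"
  by (simp add: sub_field_def)

text \<open>Gaussian elimination: if some vector has a nonzero \<open>i\<close>-th coordinate, subtract multiples of it from the other vectors to
  clear this coordinate.\<close>

lemma linear_dependence_over_subfield:
  fixes W :: "'k \<Rightarrow> 'i \<Rightarrow> 'a::field"
  assumes F: "sub_field F" and "finite I" "finite K" "card I < card K"
    and "\<And>k i. k \<in> K \<Longrightarrow> i \<in> I \<Longrightarrow> W k i \<in> F"
  shows "\<exists>c. (\<forall>k. c k \<in> F) \<and> (\<exists>k\<in>K. c k \<noteq> 0) \<and> (\<forall>i\<in>I. (\<Sum>k\<in>K. c k * W k i) = 0)"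
  using assms(2-)
proof (induction I arbitrary: K W rule: finite_induct)
  case empty
  then have "K \<noteq> {}" by auto
  then show ?case
    using sub_fieldD(2)[OF F] by (intro exI[of _ "\<lambda>_. 1"]) auto
next
  case (insert i I)
  show ?case
  proof (cases "\<forall>k\<in>K. W k i = 0")
    case True
    have "card I < card K" using insert by simp
    from insert.IH[OF insert.prems(1) this, of W] insert.prems(3) True show ?thesis
      by auto
  next
    case False
    then obtain k0 where k0: "k0 \<in> K" "W k0 i \<noteq> 0" by auto
    define K' where "K' = K - {k0}"
    define Z where "Z k j = W k j - W k i / W k0 i * W k0 j" for k j
    have K': "finite K'" "card I < card K'"
      using insert k0 by (auto simp: K'_def)
    have "Z k j \<in> F" if "k \<in> K'" "j \<in> I" for k j
      unfolding Z_def using that k0 insert.prems(3)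
      by (intro sub_fieldD(3,4,8)[OF F]) (auto simp: K'_def)
    from insert.IH[OF K', of Z, OF this] obtain c where c: "\<forall>k. c k \<in> F" "\<exists>k\<in>K'. c k \<noteq> 0"
        "\<forall>j\<in>I. (\<Sum>k\<in>K'. c k * Z k j) = 0" by blast
    define d where "d k = (if k = k0 then - (\<Sum>k\<in>K'. c k * W k i / W k0 i) else c k)" for k
    have "- (\<Sum>k\<in>K'. c k * W k i / W k0 i) \<in> F"
      using c(1) k0 insert.prems(3)
      by (intro sub_fieldD(6,11,8,4)[OF F]) (auto simp: K'_def)
    then have dF: "\<forall>k. d k \<in> F"
      using c(1) by (simp add: d_def)
    have dn: "\<exists>k\<in>K. d k \<noteq> 0"
      using c(2) by (auto simp: d_def K'_def)
    have split: "(\<Sum>k\<in>K. d k * W k j) = d k0 * W k0 j + (\<Sum>k\<in>K'. c k * W k j)" for j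
    proof -
      have "(\<Sum>k\<in>K. d k * W k j) = d k0 * W k0 j + (\<Sum>k\<in>K'. d k * W k j)"
        unfolding K'_def using insert.prems(1) k0(1) by (rule sum.remove)
      also have "(\<Sum>k\<in>K'. d k * W k j) = (\<Sum>k\<in>K'. c k * W k j)"
        by (intro sum.cong) (auto simp: d_def K'_def)
      finally show ?thesis .
    qed
    have "(\<Sum>k\<in>K. d k * W k j) = 0" if "j \<in> insert i I" for j
    proof (cases "j = i")
      case True
      then show ?thesis
        unfolding split using k0(2) by (simp add: d_def sum_divide_distrib [symmetric])
    next
      case False
      then have "(\<Sum>k\<in>K'. c k * Z k j) = 0" using that c(3) by simp
      then show ?thesis
        unfolding split by (simp add: d_def Z_def sum_subtractf sum_distrib_left sum_distrib_right algebra_simps)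
    qed
    with dF dn show ?thesis by blast
  qed
qed

definition spanned_by :: "'a::field set \<Rightarrow> nat \<Rightarrow> 'a set \<Rightarrow> bool" where
  "spanned_by F e K \<longleftrightarrow> (\<exists>b. \<forall>x\<in>K. \<exists>f. (\<forall>l. f l \<in> F) \<and> x = (\<Sum>l<e. f l * b l))"

text \<open>The bound \<open>D\<close> is the number of coordinates over \<open>F\<close> of an \<open>n\<close> by \<open>n\<close> matrix with entries in \<open>K\<close>.\<close>

lemma matrices_dependent:
  fixes M :: "nat \<Rightarrow> ('a::field, 'n::finite) sqmat"
  assumes F: "sub_field F" and sp: "spanned_by F e K" and M: "\<And>k i j. ent (M k) i j \<in> K"
    and D: "D = card (UNIV :: ('n \<times> 'n) set) * e"
  shows "\<exists>c. (\<forall>k. c k \<in> F) \<and> (\<exists>k\<le>D. c k \<noteq> 0) \<and> (\<Sum>k\<le>D. scl (c k) (M k)) = 0"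
proof -
  obtain b where b: "\<forall>x\<in>K. \<exists>f. (\<forall>l. f l \<in> F) \<and> x = (\<Sum>l<e. f l * b l)"
    using sp unfolding spanned_by_def by blast
  have "\<forall>k i j. \<exists>f. (\<forall>l. f l \<in> F) \<and> ent (M k) i j = (\<Sum>l<e. f l * b l)"
    using b M by blast
  then obtain f where f: "\<And>k i j l. f k i j l \<in> F" "\<And>k i j. ent (M k) i j = (\<Sum>l<e. f k i j l * b l)"
    by metis
  define Y where "Y k = (\<lambda>((i, j), l). f k i j l)" for k
  have "\<exists>c. (\<forall>k. c k \<in> F) \<and> (\<exists>k\<in>{..D}. c k \<noteq> 0) \<and>
      (\<forall>x\<in>UNIV \<times> {..<e}. (\<Sum>k\<in>{..D}. c k * Y k x) = 0)"
    by (rule linear_dependence_over_subfield[OF F])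
       (auto simp: D card_cartesian_product Y_def f(1))
  then obtain c where c: "\<forall>k. c k \<in> F" "\<exists>k\<in>{..D}. c k \<noteq> 0"
    "\<forall>x\<in>UNIV \<times> {..<e}. (\<Sum>k\<in>{..D}. c k * Y k x) = 0" by blast
  have "(\<Sum>k\<le>D. scl (c k) (M k)) = 0"
  proof (rule sqmat_eqI)
    fix i j
    have "ent (\<Sum>k\<le>D. scl (c k) (M k)) i j = (\<Sum>k\<le>D. \<Sum>l<e. c k * f k i j l * b l)"
      by (simp add: ent_sum f(2) sum_distrib_left mult.assoc)
    also have "\<dots> = (\<Sum>l<e. (\<Sum>k\<le>D. c k * f k i j l) * b l)"
      by (subst sum.swap) (simp add: sum_distrib_right)
    also have "\<dots> = 0"
      using c(3) by (intro sum.neutral) (force simp: Y_def)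
    finally show "ent (\<Sum>k\<le>D. scl (c k) (M k)) i j = ent 0 i j" by simp
  qed
  with c(1,2) show ?thesis by auto
qed

section \<open>Eigenvalues of linear recurrences\<close>

text \<open>The value at \<open>x\<close> of the polynomial \<open>c\<close> in the shift operator. For \<open>x k = A\<^sup>k v\<close> this is \<open>c\<close> evaluated at the matrix \<open>A\<close> and
  applied to \<open>v\<close>, but sequences that do not come from a matrix are needed as well.\<close>

definition recur :: "'a::field poly \<Rightarrow> (nat \<Rightarrow> ('a, 'n::finite) sqmat) \<Rightarrow> nat \<Rightarrow> ('a, 'n) sqmat" where
  "recur c x j = (\<Sum>k\<le>Polynomial.degree c. scl (Polynomial.coeff c k) (x (j + k)))"

lemma recur_bound:
  assumes "Polynomial.degree c \<le> N"
  shows "recur c x j = (\<Sum>k\<le>N. scl (Polynomial.coeff c k) (x (j + k)))"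
  unfolding recur_def using assms by (intro sum.mono_neutral_left) (auto simp: coeff_eq_0 not_le)

lemma recur_pCons: "recur (pCons a c) x j = scl a (x j) + recur c x (Suc j)"
proof -
  have "recur (pCons a c) x j = (\<Sum>k\<le>Suc (Polynomial.degree c). scl (Polynomial.coeff (pCons a c) k) (x (j + k)))"
    by (intro recur_bound) (simp add: degree_pCons_le)
  also have "\<dots> = scl a (x j) + recur c x (Suc j)"
    by (simp only: sum.atMost_Suc_shift) (simp add: recur_def)
  finally show ?thesis .
qed

lemma recur_linear_factor:
  "recur ([:- l, 1:] * c) x j = recur c x (Suc j) - scl l (recur c x j)"
proof -
  define N where "N = max (Polynomial.degree c) (Polynomial.degree (pCons 0 c))"
  have e: "[:- l, 1:] * c = pCons 0 c - Polynomial.smult l c"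
    by simp
  have "recur ([:- l, 1:] * c) x j = (\<Sum>k\<le>N. scl (Polynomial.coeff (pCons 0 c - Polynomial.smult l c) k) (x (j + k)))"
    unfolding e
    by (rule recur_bound) (metis N_def degree_diff_le degree_smult_le max.cobounded1 max.cobounded2 order_trans)
  also have "\<dots> = (\<Sum>k\<le>N. scl (Polynomial.coeff (pCons 0 c) k) (x (j + k))) - scl l (\<Sum>k\<le>N. scl (Polynomial.coeff c k) (x (j + k)))"
    by (simp add: sqm.scale_left_diff_distrib sum_subtractf sqm.scale_sum_right)
  also have "\<dots> = recur (pCons 0 c) x j - scl l (recur c x j)"
    using recur_bound[of "pCons 0 c" N x j] recur_bound[of c N x j] by (simp add: N_def)
  finally show ?thesis by (simp add: recur_pCons)
qed

text \<open>Split \<open>c\<close> into linear factors and apply them one after the other. The last nonzero sequence before the result vanishes is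
  annihilated by some factor \<open>shift - l\<close>, hence is geometric with ratio \<open>l\<close>.\<close>

lemma recurrence_eigenvalue:
  fixes x :: "nat \<Rightarrow> ('a::alg_closed_field, 'n::finite) sqmat"
  assumes "c \<noteq> 0" "\<And>j. recur c x j = 0" "x i \<noteq> 0"
  shows "\<exists>l d. poly c l = 0 \<and> recur d x 0 \<noteq> 0 \<and> (\<forall>j. recur d x j = scl (l ^ j) (recur d x 0))"
  using assms
proof (induction "Polynomial.degree c" arbitrary: c)
  case 0
  then obtain a where a: "c = [:a:]"
    by (metis degree_eq_zeroE)
  with 0 have "a \<noteq> 0" by simp
  with 0 a show ?case
    using 0(3)[of i] by (simp add: recur_def scl_eq_0_iff)
next
  case (Suc n)
  then have "Polynomial.degree c > 0" by simp
  then obtain l where l: "poly c l = 0"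
    using alg_closed_imp_poly_has_root by blast
  then obtain c' where c': "c = [:- l, 1:] * c'"
    using poly_eq_0_iff_dvd by blast
  have s: "recur c' x (Suc j) = scl l (recur c' x j)" for j
    using Suc(4)[of j] unfolding c' recur_linear_factor by simp
  then have p: "recur c' x j = scl (l ^ j) (recur c' x 0)" for j
    by (induction j) simp_all
  show ?case
  proof (cases "recur c' x 0 = 0")
    case False
    then show ?thesis using l p by blast
  next
    case True
    have c0: "c' \<noteq> 0" using Suc(3) c' by auto
    have "n = Polynomial.degree c'"
    proof -
      have "Polynomial.degree c = Polynomial.degree [:- l, 1:] + Polynomial.degree c'"
        unfolding c' using c0 by (intro degree_mult_eq) auto
      then show ?thesis using Suc(2) by simp
    qed
    moreover have "recur c' x j = 0" for j
      using p[of j] True by simp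
    ultimately obtain m d where md: "poly c' m = 0" "recur d x 0 \<noteq> 0" "\<forall>j. recur d x j = scl (m ^ j) (recur d x 0)"
      using Suc(1)[OF _ c0 _ Suc(5)] by blast
    have "poly c m = 0"
      unfolding c' poly_mult md(1) by simp
    with md(2,3) show ?thesis by blast
  qed
qed

lemma recur_powers: "recur c (\<lambda>k. A ^ k * v) j = A ^ j * recur c (\<lambda>k. A ^ k * v) 0"
  unfolding recur_def by (simp add: sum_distrib_left power_add mult.assoc)

lemma matrix_eigenvalue:
  fixes A v :: "('a::alg_closed_field, 'n::finite) sqmat"
  assumes c: "c \<noteq> 0" "recur c (\<lambda>k. A ^ k * v) 0 = 0" "v \<noteq> 0"
  shows "\<exists>l d. poly c l = 0 \<and> recur d (\<lambda>k. A ^ k * v) 0 \<noteq> 0 \<and>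
           A * recur d (\<lambda>k. A ^ k * v) 0 = scl l (recur d (\<lambda>k. A ^ k * v) 0)"
proof -
  define x where "x = (\<lambda>k. A ^ k * v)"
  have rp: "recur d x j = A ^ j * recur d x 0" for d j
    unfolding x_def by (rule recur_powers)
  have "recur c x j = 0" for j
    using rp[of c j] c(2) by (simp add: x_def)
  moreover have "x 0 \<noteq> 0" using c(3) by (simp add: x_def)
  ultimately obtain l d where
    ld: "poly c l = 0" "recur d x 0 \<noteq> 0" "\<forall>j. recur d x j = scl (l ^ j) (recur d x 0)"
    using recurrence_eigenvalue[OF c(1)] by blast
  have "A * recur d x 0 = scl l (recur d x 0)"
    using rp[of d 1] ld(3)[rule_format, of 1] by simp
  then show ?thesis
    using ld(1,2) unfolding x_def by blast
qed

lemma eigenvector_power: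
  fixes A v :: "('a::field, 'n::finite) sqmat"
  assumes "A * v = scl l v"
  shows "A ^ k * v = scl (l ^ k) v"
  by (induction k) (simp_all add: assms mult.assoc mult.commute)

section \<open>Existence of valuation rings\<close>

definition adjoin :: "'a::field set \<Rightarrow> 'a \<Rightarrow> 'a set" where
  "adjoin R x = {poly q x |q. \<forall>k. Polynomial.coeff q k \<in> R}"

lemma sub_ring_adjoin:
  assumes "sub_ring R"
  shows "sub_ring (adjoin R x)" "R \<subseteq> adjoin R x" "x \<in> adjoin R x"
proof -
  note R = sub_ringD[OF assms]
  show "sub_ring (adjoin R x)"
    unfolding sub_ring_def adjoin_def
  proof safe
    show "\<exists>q. 1 = poly q x \<and> (\<forall>k. Polynomial.coeff q k \<in> R)"
      by (rule exI[of _ 1]) (use R(1,2) in \<open>auto simp: coeff_1\<close>)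
  next
    fix q r assume "\<forall>k. Polynomial.coeff q k \<in> R" "\<forall>k. Polynomial.coeff r k \<in> R"
    then show "\<exists>s. poly q x - poly r x = poly s x \<and> (\<forall>k. Polynomial.coeff s k \<in> R)"
         "\<exists>s. poly q x * poly r x = poly s x \<and> (\<forall>k. Polynomial.coeff s k \<in> R)"
      by (rule_tac x = "q - r" in exI, use R(3) in simp,
          rule_tac x = "q * r" in exI, auto simp: coeff_mult intro!: R(4,9))
  qed
  show "R \<subseteq> adjoin R x"
  proof
    fix r assume "r \<in> R"
    then show "r \<in> adjoin R x" unfolding adjoin_def
      by (intro CollectI exI[of _ "[:r:]"]) (auto simp: coeff_pCons R(1) split: nat.split)
  qed
  show "x \<in> adjoin R x"
    unfolding adjoin_def
    by (intro CollectI exI[of _ "[:0, 1:]"]) (auto simp: coeff_pCons R(1,2) split: nat.split)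
qed

text \<open>Clearing denominators in a polynomial expression in the inverse of \<open>s\<close>.\<close>

lemma poly_inverse_mult_power:
  fixes s :: "'a::field"
  assumes "s \<noteq> 0" "Polynomial.degree q \<le> n"
  shows "poly q (inverse s) * s ^ n = (\<Sum>k\<le>n. Polynomial.coeff q k * s ^ (n - k))"
proof -
  have "poly q (inverse s) = (\<Sum>k\<le>n. Polynomial.coeff q k * inverse s ^ k)"
    unfolding poly_altdef using assms(2) by (intro sum.mono_neutral_left) (auto simp: coeff_eq_0 not_le)
  then have "poly q (inverse s) * s ^ n = (\<Sum>k\<le>n. Polynomial.coeff q k * (inverse s ^ k * s ^ n))"
    by (simp add: sum_distrib_right mult.assoc)
  also have "\<dots> = (\<Sum>k\<le>n. Polynomial.coeff q k * s ^ (n - k))"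
    using assms(1) by (intro sum.cong) (auto simp: power_diff field_simps)
  finally show ?thesis .
qed

text \<open>Assume that neither \<open>x\<close> nor its inverse lies in \<open>R\<close>. By maximality \<open>1 / \<pi>\<close> lies in both \<open>R[x]\<close> and \<open>R[1/x]\<close>. Choose
  representations \<open>1 = \<pi> * q(x)\<close> and \<open>1 = \<pi> * r(1/x)\<close> of smallest degrees. As \<open>1 - \<pi> r\<^sub>0\<close> is a unit of \<open>R\<close>, the representation of
  smaller degree expresses the leading power in the other one by lower powers, which contradicts minimality.\<close>

lemma maximal_subring_is_valuation_ring:
  fixes R :: "'a::field set"
  assumes R: "sub_ring R" and pi: "\<pi> \<in> R" "inverse \<pi> \<notin> R"
    and max: "\<And>S. sub_ring S \<Longrightarrow> R \<subseteq> S \<Longrightarrow> inverse \<pi> \<notin> S \<Longrightarrow> S = R"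
    and x: "x \<noteq> 0"
  shows "x \<in> R \<or> inverse x \<in> R"
proof (rule ccontr)
  note RD = sub_ringD[OF R]
  have pi0: "\<pi> \<noteq> 0" using pi RD(1) by auto
  have npi: "\<pi> * r \<noteq> 1" if "r \<in> R" for r
    using that pi(2) pi0 by (metis inverse_unique)
  have ad: "inverse \<pi> \<in> adjoin R y" if "y \<notin> R" for y
    using max[OF sub_ring_adjoin(1,2)[OF R, of y]] sub_ring_adjoin(3)[OF R, of y] that by auto
  \<comment> \<open>If \<open>s = 1 - \<pi> r\<close> were not a unit, adjoining its inverse would produce \<open>1 / \<pi>\<close>. Clearing denominators
    shows that \<open>\<pi>\<close> divides a power of \<open>s\<close>; but such a power is congruent to 1 modulo \<open>\<pi>\<close>.\<close>
  have unit: "inverse (1 - \<pi> * r) \<in> R" if r: "r \<in> R" for r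
  proof (rule ccontr)
    define s where "s = 1 - \<pi> * r"
    assume "inverse (1 - \<pi> * r) \<notin> R"
    then have "inverse s \<notin> R" by (simp add: s_def)
    from ad[OF this] obtain q where q: "inverse \<pi> = poly q (inverse s)" "\<forall>k. Polynomial.coeff q k \<in> R"
      unfolding adjoin_def by auto
    have sR: "s \<in> R" unfolding s_def by (intro RD r pi)
    have s0: "s \<noteq> 0" unfolding s_def using npi[OF r] by auto
    define n where "n = Polynomial.degree q"
    define a where "a = (\<Sum>k\<le>n. Polynomial.coeff q k * s ^ (n - k))"
    have a: "a \<in> R" unfolding a_def by (intro RD sR) (use q in auto)
    have e: "s ^ n = \<pi> * a"
      using poly_inverse_mult_power[OF s0, of q n] q(1) pi0 unfolding a_def [symmetric] n_def [symmetric]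
      by (metis n_def order_refl mult.assoc right_inverse mult_1)
    have "\<exists>b\<in>R. s ^ n = 1 - \<pi> * b"
    proof (induction n)
      case 0 show ?case by (rule bexI[of _ 0]) (use RD(1) in auto)
    next
      case (Suc n)
      then obtain b where b: "b \<in> R" "s ^ n = 1 - \<pi> * b" by auto
      have "s ^ Suc n = 1 - \<pi> * (b + r - \<pi> * r * b)"
        unfolding power_Suc b(2) by (simp add: s_def algebra_simps)
      moreover have "b + r - \<pi> * r * b \<in> R" by (intro RD b r pi)
      ultimately show ?case by blast
    qed
    then obtain b where b: "b \<in> R" "s ^ n = 1 - \<pi> * b" by auto
    have "\<pi> * (a + b) = 1" using e b(2) by (simp add: algebra_simps)
    moreover have "a + b \<in> R" using a b(1) by (rule RD)
    ultimately show False using npi by blast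
  qed
  define Rep where "Rep y n \<longleftrightarrow> (\<exists>q. (\<forall>k. Polynomial.coeff q k \<in> R) \<and> Polynomial.degree q \<le> n \<and> \<pi> * poly q y = 1)" for y n
  have ex: "\<exists>n. Rep y n" if yR: "y \<notin> R" for y
  proof -
    obtain q where "inverse \<pi> = poly q y" "\<forall>k. Polynomial.coeff q k \<in> R"
      using ad[OF yR] unfolding adjoin_def by auto
    then show ?thesis using pi0 unfolding Rep_def
      by (intro exI[of _ "Polynomial.degree q"] exI[of _ q]) (auto simp: field_simps)
  qed
  have reduce: "Rep y (n - 1) \<and> n > 0" if y: "y \<noteq> 0" and r1: "Rep y n" and r2: "Rep (inverse y) m" and mn: "m \<le> n" for y n m
  proof -
    obtain q where q: "\<forall>k. Polynomial.coeff q k \<in> R" "Polynomial.degree q \<le> n" "\<pi> * poly q y = 1"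
      using r1 unfolding Rep_def by blast
    obtain r where r: "\<forall>k. Polynomial.coeff r k \<in> R" "Polynomial.degree r \<le> m" "\<pi> * poly r (inverse y) = 1"
      using r2 unfolding Rep_def by blast
    have n0: "n > 0"
    proof (rule ccontr)
      assume "\<not> n > 0"
      then obtain a where "q = [:a:]" using q(2) by (metis degree_eq_zeroE le_zero_eq not_gr_zero)
      then show False using q(1,3) npi[of a] by (metis coeff_pCons_0 mult_zero_right poly_pCons poly_0 add.right_neutral)
    qed
    define v where "v = inverse (1 - \<pi> * Polynomial.coeff r 0)"
    have v: "v \<in> R" "v * (1 - \<pi> * Polynomial.coeff r 0) = 1"
      unfolding v_def using unit[of "Polynomial.coeff r 0"] npi[of "Polynomial.coeff r 0"] r(1) by auto
    define g where "g = (\<Sum>k\<in>{1..n}. Polynomial.monom (Polynomial.coeff r k) (n - k))"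
    have gR: "Polynomial.coeff g k \<in> R" for k
      unfolding g_def coeff_sum by (intro RD(9)) (use r(1) RD(1) in auto)
    have gd: "Polynomial.degree g \<le> n - 1"
      unfolding g_def by (intro degree_sum_le) (auto intro: order_trans[OF degree_monom_le])
    have "poly r (inverse y) * y ^ n = (\<Sum>k\<le>n. Polynomial.coeff r k * y ^ (n - k))"
      using poly_inverse_mult_power[OF y, of r n] r(2) mn by simp
    also have "\<dots> = Polynomial.coeff r 0 * y ^ n + poly g y"
    proof -
      have "{..n} = insert 0 {1..n}" by auto
      then show ?thesis by (simp add: g_def poly_sum poly_monom)
    qed
    finally have "y ^ n = \<pi> * (Polynomial.coeff r 0 * y ^ n + poly g y)"
      using r(3) by (metis mult.assoc mult_1)
    then have "(1 - \<pi> * Polynomial.coeff r 0) * y ^ n = \<pi> * poly g y"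
      by (simp add: algebra_simps)
    then have yn: "y ^ n = v * \<pi> * poly g y"
      using v(2) by (metis mult.assoc mult_1)
    define a where "a = Polynomial.coeff q n"
    define q' where "q' = q - Polynomial.monom a n + Polynomial.smult (a * v * \<pi>) g"
    have "Polynomial.coeff q' k \<in> R" for k
      unfolding q'_def a_def using q(1) v(1) pi(1) gR RD(1)
      by (auto intro!: RD(3,4,6))
    moreover have "Polynomial.degree q' \<le> n - 1"
    proof (rule degree_le, intro allI impI)
      fix i assume "n - 1 < i"
      then have "i \<ge> n" by simp
      moreover have "Polynomial.coeff g i = 0" using gd \<open>n - 1 < i\<close> by (intro coeff_eq_0) simp
      ultimately show "Polynomial.coeff q' i = 0"
        using q(2) by (cases "i = n") (auto simp: q'_def a_def coeff_eq_0)
    qed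
    moreover have "poly q' y = poly q y"
      by (simp add: q'_def poly_monom yn mult.assoc)
    ultimately show ?thesis
      using q(3) n0 unfolding Rep_def by metis
  qed
  assume "\<not> (x \<in> R \<or> inverse x \<in> R)"
  then have e: "\<exists>n. Rep x n" "\<exists>m. Rep (inverse x) m" using ex by auto
  define N where "N = (LEAST n. Rep x n)"
  define M where "M = (LEAST m. Rep (inverse x) m)"
  have NM: "Rep x N" "Rep (inverse x) M"
    unfolding N_def M_def using e by (auto intro: LeastI_ex)
  have mini: "N \<le> n" if "Rep x n" for n unfolding N_def using that by (rule Least_le)
  have mini': "M \<le> n" if "Rep (inverse x) n" for n unfolding M_def using that by (rule Least_le)
  show False
  proof (cases "M \<le> N")
    case True
    then show False using reduce[OF x NM] mini[of "N - 1"] by auto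
  next
    case False
    then show False using reduce[of "inverse x" M N] x NM mini'[of "M - 1"] by auto
  qed
qed

text \<open>Zorn's lemma yields a subring that is maximal among those containing \<open>B\<close> but not \<open>1 / \<pi>\<close>.\<close>

lemma exists_valuation_ring:
  fixes B :: "'a::field set"
  assumes B: "sub_ring B" and pi: "\<pi> \<in> B" "inverse \<pi> \<notin> B"
  obtains R where "sub_ring R" "B \<subseteq> R" "inverse \<pi> \<notin> R" "\<And>x. x \<noteq> 0 \<Longrightarrow> x \<in> R \<or> inverse x \<in> R"
proof -
  define A where "A = {R. sub_ring R \<and> B \<subseteq> R \<and> inverse \<pi> \<notin> R}"
  have "\<exists>M\<in>A. \<forall>W\<in>A. M \<subseteq> W \<longrightarrow> W = M"
  proof (rule subset_Zorn_nonempty)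
    show "A \<noteq> {}" using assms by (auto simp: A_def)
    fix C assume C: "C \<noteq> {}" "subset.chain A C"
    have CA: "W \<in> A" if "W \<in> C" for W using C that by (auto simp: subset_chain_def)
    have "sub_ring (\<Union>C)"
      unfolding sub_ring_def
    proof safe
      show "1 \<in> \<Union>C" using C(1) CA sub_ringD(2) by (auto simp: A_def)
      fix x y W Y assume h: "x \<in> W" "W \<in> C" "y \<in> Y" "Y \<in> C"
      then have "W \<subseteq> Y \<or> Y \<subseteq> W" using C(2) by (auto simp: subset_chain_def)
      then obtain Z where Z: "Z \<in> C" "x \<in> Z" "y \<in> Z" using h by auto
      then have "sub_ring Z" using CA by (auto simp: A_def)
      then show "x - y \<in> \<Union>C" "x * y \<in> \<Union>C" using Z sub_ringD(3,4) by blast+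
    qed
    then show "\<Union>C \<in> A" using C(1) CA by (auto simp: A_def)
  qed
  then obtain M where M: "M \<in> A" "\<And>W. W \<in> A \<Longrightarrow> M \<subseteq> W \<Longrightarrow> W = M" by blast
  have MM: "sub_ring M" "B \<subseteq> M" "inverse \<pi> \<notin> M" using M(1) by (auto simp: A_def)
  show ?thesis
  proof (rule that[OF MM])
    fix x :: 'a assume "x \<noteq> 0"
    show "x \<in> M \<or> inverse x \<in> M"
    proof (rule maximal_subring_is_valuation_ring[OF MM(1) _ MM(3) _ \<open>x \<noteq> 0\<close>])
      show "\<pi> \<in> M" using MM(2) pi(1) by auto
      show "S = M" if "sub_ring S" "M \<subseteq> S" "inverse \<pi> \<notin> S" for S
        using M(2)[of S] that MM(2) by (auto simp: A_def)
    qed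
  qed
qed

section \<open>Elements of bounded degree over a discretely valued field\<close>

definition deg_le :: "'a::field set \<Rightarrow> nat \<Rightarrow> 'a \<Rightarrow> bool" where
  "deg_le F D x \<longleftrightarrow> (\<exists>c. (\<forall>k. c k \<in> F) \<and> (\<exists>k\<le>D. c k \<noteq> 0) \<and> (\<Sum>k\<le>D. c k * x ^ k) = 0)"

text \<open>The properties shared by the rationals and the \<open>p\<close>-adic numbers, as subfields of a larger field: \<open>B\<close> is a discrete
  valuation ring with fraction field \<open>F\<close>, uniformizer \<open>p\<close> and residue field of \<open>p\<close> elements.\<close>

locale padic_subfield =
  fixes F B :: "'a::field set" and p :: nat
  assumes F: "sub_field F" and B: "sub_ring B"
    and p_nonzero: "of_nat p \<noteq> (0 :: 'a)"
    and p_nonunit: "inverse (of_nat p) \<notin> B"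
    and decomp: "\<And>x. x \<in> F \<Longrightarrow> x \<noteq> 0 \<Longrightarrow>
          \<exists>u\<in>B. \<exists>j::int. u \<noteq> 0 \<and> inverse u \<in> B \<and> x = u * of_nat p powi j"
    and residue: "\<And>x. x \<in> B \<Longrightarrow> \<exists>n<p. \<exists>y\<in>B. x = of_nat n + of_nat p * y"

text \<open>An extension of the valuation of \<open>F\<close> to the ambient field, given by its valuation ring \<open>R\<close>.\<close>

locale padic_subfield_valuation = padic_subfield F B p for F B :: "'a::field set" and p +
  fixes R :: "'a set"
  assumes R: "sub_ring R" and BR: "B \<subseteq> R" and p_nonunit_R: "inverse (of_nat p) \<notin> R"
    and valuation: "\<And>x. x \<noteq> 0 \<Longrightarrow> x \<in> R \<or> inverse x \<in> R"
begin

abbreviation \<pi> :: 'a where "\<pi> \<equiv> of_nat p"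

definition unit :: "'a \<Rightarrow> bool" where "unit x \<longleftrightarrow> x \<noteq> 0 \<and> x \<in> R \<and> inverse x \<in> R"

text \<open>The maximal ideal of \<open>R\<close>.\<close>

definition M :: "'a set" where "M = {x \<in> R. x = 0 \<or> inverse x \<notin> R}"

lemmas RD = sub_ringD[OF R]

lemma pi_R: "\<pi> \<in> R" by (rule RD)

lemma unit_1: "unit 1" by (simp add: unit_def RD(2))
lemma unit_mult: "unit x \<Longrightarrow> unit y \<Longrightarrow> unit (x * y)" by (auto simp: unit_def intro: RD(4))
lemma unit_inverse: "unit x \<Longrightarrow> unit (inverse x)" by (auto simp: unit_def)
lemma unit_power: "unit x \<Longrightarrow> unit (x ^ n)" by (induction n) (auto intro: unit_mult unit_1)
lemma unit_B: "u \<in> B \<Longrightarrow> u \<noteq> 0 \<Longrightarrow> inverse u \<in> B \<Longrightarrow> unit u" using BR by (auto simp: unit_def)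

lemma unit_powerD: "x \<noteq> 0 \<Longrightarrow> n > 0 \<Longrightarrow> unit (x ^ n) \<Longrightarrow> unit x"
proof -
  assume h: "x \<noteq> 0" "n > 0" "unit (x ^ n)"
  have *: "y \<in> R" if "y \<noteq> 0" "y ^ n \<in> R" "inverse y \<in> R" for y
  proof -
    have "y = y ^ n * inverse y ^ (n - 1)"
      using that(1) h(2) by (cases n) (simp_all add: power_mult_distrib[symmetric] mult.assoc)
    then show ?thesis using RD(4)[OF that(2) RD(7)[OF that(3), of "n - 1"]] by simp
  qed
  show "unit x"
    using *[of x] *[of "inverse x"] h valuation[OF h(1)] by (auto simp: unit_def power_inverse)
qed

lemma M_iff: "x \<in> R \<Longrightarrow> x \<in> M \<longleftrightarrow> \<not> unit x" by (auto simp: M_def unit_def)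
lemma M_R: "x \<in> M \<Longrightarrow> x \<in> R" by (auto simp: M_def)
lemma M_0: "0 \<in> M" by (auto simp: M_def RD)
lemma M_1: "1 \<notin> M" by (auto simp: M_def RD)

lemma M_mult: assumes "x \<in> M" "r \<in> R" shows "r * x \<in> M"
proof (rule ccontr)
  assume "r * x \<notin> M"
  moreover have rx: "r * x \<in> R" using assms by (intro RD) (auto simp: M_def)
  ultimately have u: "unit (r * x)" using M_iff by blast
  then have "inverse x = r * inverse (r * x)" by (auto simp: unit_def field_simps)
  also have "\<dots> \<in> R" using u assms by (intro RD) (auto simp: unit_def)
  finally have "inverse x \<in> R" .
  then show False using assms u by (auto simp: M_def unit_def)
qed

lemma M_add: assumes "x \<in> M" "y \<in> M" shows "x + y \<in> M"
proof -
  have *: "x + y \<in> M" if "x \<in> M" "y \<in> M" "y \<noteq> 0" "x / y \<in> R" for x y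
  proof -
    have "x + y = (x / y + 1) * y" using that by (simp add: field_simps)
    also have "\<dots> \<in> M" using that by (intro M_mult RD)
    finally show ?thesis .
  qed
  show ?thesis
  proof (cases "x = 0 \<or> y = 0")
    case False
    then have "x / y \<in> R \<or> y / x \<in> R"
      using valuation[of "x / y"] by (auto simp: field_simps)
    then show ?thesis
      using *[of x y] *[of y x] False assms by (auto simp: add.commute)
  qed (use assms in auto)
qed

lemma M_uminus: "x \<in> M \<Longrightarrow> - x \<in> M"
  using M_mult[of x "-1"] RD(5)[OF RD(2)] by simp

lemma M_diff: "x \<in> M \<Longrightarrow> y \<in> M \<Longrightarrow> x - y \<in> M"
  using M_add[of x "- y"] M_uminus[of y] by simp

lemma M_sum: "(\<And>k. k \<in> S \<Longrightarrow> f k \<in> M) \<Longrightarrow> sum f S \<in> M"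
  by (induction S rule: infinite_finite_induct) (simp_all add: M_0 M_add)

lemma pi_M: "\<pi> \<in> M" using p_nonunit_R pi_R by (auto simp: M_def)

lemma not_unit_pi_power: assumes "n > 0" shows "\<not> unit (\<pi> ^ n)"
proof -
  have "\<pi> ^ n = \<pi> ^ (n - 1) * \<pi>" using assms by (cases n) auto
  also have "\<dots> \<in> M" by (intro M_mult pi_M RD pi_R)
  finally show ?thesis using M_iff M_R by blast
qed

text \<open>If the exponents were different, some positive power of \<open>\<pi>\<close> would be a unit.\<close>

lemma powi_unique:
  assumes "unit u" "unit v" "u * \<pi> powi i = v * \<pi> powi j"
  shows "i = j"
proof -
  have *: "\<not> i < j" if "unit u" "unit v" "u * \<pi> powi i = v * \<pi> powi j" for u v i j
  proof
    assume "i < j"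
    then have "\<pi> powi j = \<pi> powi i * \<pi> ^ nat (j - i)"
      using p_nonzero by (simp add: power_int_add[symmetric] flip: power_int_of_nat)
    then have "u = v * \<pi> ^ nat (j - i)"
      using that(3) p_nonzero by simp
    then have "\<pi> ^ nat (j - i) = inverse v * u"
      using that(2) by (simp add: unit_def field_simps)
    then show False
      using unit_mult[OF unit_inverse[OF that(2)] that(1)] not_unit_pi_power[of "nat (j - i)"] \<open>i < j\<close> by simp
  qed
  show ?thesis using *[OF assms] *[OF assms(2,1) assms(3)[symmetric]] by simp
qed

lemma decomp_unit: "x \<in> F \<Longrightarrow> x \<noteq> 0 \<Longrightarrow> \<exists>u j. unit u \<and> x = u * \<pi> powi j"
  using decomp[of x] unit_B by blast

lemma dominant_exists:
  assumes "finite S" "S \<noteq> {}" "\<And>k. k \<in> S \<Longrightarrow> t k \<noteq> 0"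
  shows "\<exists>k0\<in>S. \<forall>k\<in>S. t k / t k0 \<in> R"
  using assms
proof (induction S rule: finite_ne_induct)
  case (singleton x)
  then show ?case by (simp add: RD)
next
  case (insert x S)
  then obtain k0 where k0: "k0 \<in> S" "\<forall>k\<in>S. t k / t k0 \<in> R" by auto
  show ?case
  proof (cases "t x / t k0 \<in> R")
    case True
    then show ?thesis using k0 by auto
  next
    case False
    have nz: "t x \<noteq> 0" "t k0 \<noteq> 0" using insert k0 by auto
    with False valuation[of "t x / t k0"] have r: "t k0 / t x \<in> R" by (auto simp: field_simps)
    have "t k / t x \<in> R" if "k \<in> S" for k
      using RD(4)[OF k0(2)[rule_format, OF that] r] nz by simp
    then show ?thesis using nz by (auto simp: RD)
  qed
qed

text \<open>On elements of degree at most \<open>D\<close> the valuation takes values in multiples of \<open>1 / D!\<close>. In a relation \<open>\<Sum>k. c\<^sub>k x\<^sup>k = 0\<close> two terms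
  of largest size must agree up to a unit, as otherwise the largest term could not cancel; so a power of \<open>x\<close> with
  positive exponent at most \<open>D\<close> is a unit times an element of \<open>F\<close>.\<close>

lemma deg_le_power:
  assumes "deg_le F D x" "x \<noteq> 0"
  shows "\<exists>u j. unit u \<and> x ^ fact D = u * \<pi> powi j"
proof -
  obtain c where c: "\<forall>k. c k \<in> F" "\<exists>k\<le>D. c k \<noteq> 0" "(\<Sum>k\<le>D. c k * x ^ k) = 0"
    using assms(1) unfolding deg_le_def by blast
  define S where "S = {k. k \<le> D \<and> c k \<noteq> 0}"
  have fS: "finite S" "S \<noteq> {}" using c(2) by (auto simp: S_def)
  define t where "t k = c k * x ^ k" for k
  have t0: "t k \<noteq> 0" if "k \<in> S" for k using that assms(2) by (auto simp: t_def S_def)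
  have "\<exists>k0\<in>S. \<forall>k\<in>S. t k / t k0 \<in> R"
    by (rule dominant_exists[OF fS t0])
  then obtain k0 where k0: "k0 \<in> S" "\<forall>k\<in>S. t k / t k0 \<in> R"
    by (elim bexE) (rule that)
  have "(\<Sum>k\<in>S. t k) = (\<Sum>k\<le>D. t k)"
    by (intro sum.mono_neutral_left) (auto simp: S_def t_def)
  also have "\<dots> = 0"
    using c(3) by (simp only: t_def)
  finally have "(\<Sum>k\<in>S. t k) / t k0 = 0"
    by simp
  then have "(\<Sum>k\<in>S. t k / t k0) = 0"
    by (simp only: sum_divide_distrib)
  then have "1 + (\<Sum>k\<in>S - {k0}. t k / t k0) = 0"
    using sum.remove[OF fS(1) k0(1), of "\<lambda>k. t k / t k0"] t0[OF k0(1)] by simp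
  then have "(\<Sum>k\<in>S - {k0}. t k / t k0) = - 1"
    by (simp add: eq_neg_iff_add_eq_0 add.commute)
  then have "(\<Sum>k\<in>S - {k0}. t k / t k0) \<notin> M"
    using M_1 M_uminus[of "-1"] by auto
  then obtain k1 where k1: "k1 \<in> S" "k1 \<noteq> k0" "t k1 / t k0 \<notin> M"
    using M_sum[of "S - {k0}" "\<lambda>k. t k / t k0"] by blast
  define w where "w = t k1 / t k0"
  have w: "unit w" "t k1 = w * t k0"
    using k0(2) k1(1,3) t0[OF k0(1)] by (auto simp: w_def M_iff)
  obtain u0 j0 where u0: "unit u0" "c k0 = u0 * \<pi> powi j0"
    using decomp_unit[of "c k0"] c(1) k0(1) by (auto simp: S_def)
  obtain u1 j1 where u1: "unit u1" "c k1 = u1 * \<pi> powi j1"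
    using decomp_unit[of "c k1"] c(1) k1(1) by (auto simp: S_def)
  define v where "v = w * u0 * inverse u1"
  have v: "unit v" unfolding v_def by (intro unit_mult unit_inverse w u0 u1)
  have nz: "u1 \<noteq> 0" "u0 \<noteq> 0" "v \<noteq> 0" using u0 u1 v by (auto simp: unit_def)
  have e: "x ^ k1 = v * \<pi> powi (j0 - j1) * x ^ k0"
  proof -
    define P0 where "P0 = \<pi> powi j0"
    define P1 where "P1 = \<pi> powi j1"
    have P1: "P1 \<noteq> 0" using p_nonzero by (simp add: P1_def)
    have "u1 * P1 * x ^ k1 = w * (u0 * P0 * x ^ k0)"
      using w(2) unfolding t_def u0(2) u1(2) P0_def P1_def .
    also have "\<dots> = u1 * P1 * (w * u0 * inverse u1 * (P0 / P1) * x ^ k0)"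
      using nz(1) P1 by (simp add: field_simps)
    finally have "x ^ k1 = w * u0 * inverse u1 * (P0 / P1) * x ^ k0"
      using nz(1) P1 by (metis mult.assoc mult_left_cancel no_zero_divisors)
    then show ?thesis
      using p_nonzero by (simp add: v_def P0_def P1_def power_int_diff)
  qed
  have *: "\<exists>n>0. n \<le> D \<and> (\<exists>u j. unit u \<and> x ^ n = u * \<pi> powi j)"
  proof (cases "k0 < k1")
    case True
    then have "x ^ k1 = x ^ (k1 - k0) * x ^ k0" by (simp flip: power_add)
    then have "x ^ (k1 - k0) = v * \<pi> powi (j0 - j1)" using e assms(2) by simp
    then show ?thesis using v True k1(1) by (intro exI[of _ "k1 - k0"]) (auto simp: S_def)
  next
    case False
    then have l: "k1 < k0" using k1(2) by simp
    then have "x ^ k0 = x ^ (k0 - k1) * x ^ k1" by (simp flip: power_add)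
    then have "v * \<pi> powi (j0 - j1) * x ^ (k0 - k1) = 1" using e assms(2) by (simp add: field_simps)
    then have "x ^ (k0 - k1) = inverse v * \<pi> powi (j1 - j0)"
      using nz p_nonzero by (simp add: power_int_diff field_simps)
    then show ?thesis using unit_inverse[OF v] l k0(1) by (intro exI[of _ "k0 - k1"]) (auto simp: S_def)
  qed
  then obtain n u j where n: "n > 0" "n \<le> D" "unit u" "x ^ n = u * \<pi> powi j" by blast
  then have "n dvd fact D" by (simp add: dvd_fact)
  then obtain q where q: "fact D = n * q" by (auto simp: dvd_def)
  have "x ^ fact D = u ^ q * \<pi> powi (j * int q)"
    unfolding q power_mult n(4) by (simp add: power_mult_distrib power_int_mult)
  then show ?thesis using unit_power[OF n(3)] by blast
qed

text \<open>The value of \<open>x\<close> would be \<open>m / Q\<close>, which is less than \<open>1 / D!\<close>.\<close>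

lemma no_deg_le_root_of_p:
  assumes "deg_le F D x" "x ^ Q = \<pi> ^ m" "m > 0" "Q > m * fact D"
  shows False
proof -
  have "x \<noteq> 0" using assms p_nonzero by (metis power_eq_0_iff power_0_left gr_implies_not0)
  then obtain u j where u: "unit u" "x ^ fact D = u * \<pi> powi j"
    using deg_le_power assms(1) by blast
  have "\<pi> ^ (m * fact D) = (x ^ Q) ^ fact D" by (simp add: assms(2) power_mult)
  also have "\<dots> = (x ^ fact D) ^ Q" by (simp add: power_mult[symmetric] mult.commute)
  also have "\<dots> = u ^ Q * \<pi> powi (j * int Q)" by (simp add: u(2) power_mult_distrib power_int_mult)
  finally have "1 * \<pi> powi int (m * fact D) = u ^ Q * \<pi> powi (j * int Q)" by (simp only: power_int_of_nat mult_1)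
  from powi_unique[OF unit_1 unit_power[OF u(1)] this] have e: "int (m * fact D) = j * int Q" .
  have "j > 0"
  proof (rule ccontr)
    assume "\<not> j > 0"
    then have "j * int Q \<le> 0" by (simp add: mult_nonpos_nonneg)
    then show False using e assms(3) by (metis fact_gt_zero less_le_not_le mult_pos_pos of_nat_0_less_iff)
  qed
  then have "int Q \<le> j * int Q" by (cases "int Q = 0") auto
  then show False using e assms(4) by linarith
qed

lemma M_powers:
  assumes "x - 1 \<in> M" "x \<in> R" shows "x ^ n - 1 \<in> M"
proof -
  have "x ^ n - 1 = (\<Sum>i<n. x ^ i) * (x - 1)" by (simp add: power_diff_1_eq mult.commute)
  also have "\<dots> \<in> M" using assms by (intro M_mult RD)
  finally show ?thesis .
qed

text \<open>Scale the relation for \<open>x\<close> so that its coefficients lie in \<open>B\<close> and the last one that is a unit, at index \<open>k0\<close>, becomes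
  \<open>-1\<close>. Modulo the maximal ideal this expresses \<open>x\<^sup>k\<^sup>0\<close> by lower powers, so the residues of all powers of \<open>x\<close> are
  combinations of \<open>1, \<dots>, x\<^sup>k\<^sup>0\<^sup>-\<^sup>1\<close> with coefficients \<open>0, \<dots>, p - 1\<close>. There are at most \<open>p\<^sup>D\<close> of these, and two powers of \<open>x\<close> with exponents
  up to \<open>p\<^sup>D\<close> must agree.\<close>

lemma power_near_1:
  assumes "deg_le F D x" "unit x"
  shows "x ^ fact (p ^ D) - 1 \<in> M"
proof -
  obtain c where c: "\<forall>k. c k \<in> F" "\<exists>k\<le>D. c k \<noteq> 0" "(\<Sum>k\<le>D. c k * x ^ k) = 0"
    using assms(1) unfolding deg_le_def by blast
  have xR: "x \<in> R" using assms(2) by (simp add: unit_def)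
  have "\<forall>k. \<exists>u j. c k \<noteq> 0 \<longrightarrow> u \<in> B \<and> u \<noteq> 0 \<and> inverse u \<in> B \<and> c k = u * \<pi> powi j"
    using decomp c(1) by metis
  then obtain u j where uj: "\<And>k. c k \<noteq> 0 \<Longrightarrow> u k \<in> B" "\<And>k. c k \<noteq> 0 \<Longrightarrow> u k \<noteq> 0"
     "\<And>k. c k \<noteq> 0 \<Longrightarrow> inverse (u k) \<in> B" "\<And>k. c k \<noteq> 0 \<Longrightarrow> c k = u k * \<pi> powi (j k)"
    by metis
  define S where "S = {k. k \<le> D \<and> c k \<noteq> 0}"
  have fS: "finite S" "S \<noteq> {}" using c(2) by (auto simp: S_def)
  define jm where "jm = Min (j ` S)"
  have jm: "jm \<in> j ` S" "\<And>k. k \<in> S \<Longrightarrow> jm \<le> j k"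
    using fS by (auto simp: jm_def)
  define T where "T = {k \<in> S. j k = jm}"
  have fT: "finite T" "T \<noteq> {}" using fS jm(1) by (auto simp: T_def)
  define k0 where "k0 = Max T"
  have k0: "k0 \<in> T" "\<And>k. k \<in> T \<Longrightarrow> k \<le> k0" using fT by (auto simp: k0_def)
  have k0S: "k0 \<in> S" "j k0 = jm" using k0(1) by (auto simp: T_def)
  have ck0: "c k0 \<noteq> 0" "k0 \<le> D" using k0S by (auto simp: S_def)
  define b where "b k = - (c k / c k0)" for k
  have ratio: "c k / c k0 = u k * inverse (u k0) * \<pi> ^ nat (j k - jm)" if "k \<in> S" for k
  proof -
    have "\<pi> powi (j k) = \<pi> powi (j k0) * \<pi> ^ nat (j k - jm)"
      using jm(2)[OF that] k0S(2) p_nonzero by (simp add: power_int_add[symmetric] flip: power_int_of_nat)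
    moreover have "c k \<noteq> 0" using that by (simp add: S_def)
    ultimately show ?thesis
      using uj(4)[of k] uj(4)[OF ck0(1)] uj(2)[OF ck0(1)] p_nonzero by (simp add: field_simps)
  qed
  have bB: "b k \<in> B" if "k \<le> D" for k
  proof (cases "k \<in> S")
    case True
    then show ?thesis unfolding b_def ratio[OF True]
      using uj ck0 by (intro sub_ringD[OF B]) (auto simp: S_def)
  next
    case False
    then show ?thesis using that sub_ringD(1)[OF B] by (simp add: b_def S_def)
  qed
  have bM: "b k \<in> M" if "k \<le> D" "k0 < k" for k
  proof (cases "k \<in> S")
    case True
    have "k \<notin> T" using k0(2)[of k] that by auto
    then have "jm < j k" using True jm(2)[OF True] by (auto simp: T_def)
    then obtain i where "nat (j k - jm) = Suc i"
      by (metis Suc_pred diff_gt_0_iff_gt zero_less_nat_eq)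
    then have e: "b k = - (u k * inverse (u k0) * \<pi> ^ i) * \<pi>"
      unfolding b_def ratio[OF True] by simp
    have "u k \<in> R" "inverse (u k0) \<in> R"
      using uj(1)[of k] uj(3)[OF ck0(1)] True BR by (auto simp: S_def)
    then show ?thesis unfolding e by (intro M_mult pi_M RD(4,5,7) pi_R)
  next
    case False
    then show ?thesis using that M_0 by (simp add: b_def S_def)
  qed
  define m0 where "m0 = (\<Sum>k\<in>{k0<..D}. b k * x ^ k)"
  have m0: "m0 \<in> M" unfolding m0_def
    by (intro M_sum, subst mult.commute, intro M_mult bM RD(7) xR) auto
  have rel: "x ^ k0 = (\<Sum>k<k0. b k * x ^ k) + m0"
  proof -
    have s: "{..D} = insert k0 ({..<k0} \<union> {k0<..D})" using ck0(2) by auto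
    have "(\<Sum>k\<le>D. b k * x ^ k) = 0"
      using c(3) by (simp add: b_def sum_negf sum_divide_distrib[symmetric])
    moreover have "(\<Sum>k\<le>D. b k * x ^ k) = b k0 * x ^ k0 + ((\<Sum>k<k0. b k * x ^ k) + m0)"
      unfolding s m0_def by (subst sum.insert; (subst sum.union_disjoint)?) auto
    ultimately show ?thesis using ck0(1) by (simp add: b_def)
  qed
  have pw: "\<exists>a. (\<forall>k. a k \<in> B) \<and> x ^ n - (\<Sum>k<k0. a k * x ^ k) \<in> M" for n
  proof (induction n)
    case 0
    show ?case
    proof (cases "k0 = 0")
      case True
      then show ?thesis using rel m0 sub_ringD(1)[OF B] by (intro exI[of _ "\<lambda>_. 0"]) auto
    next
      case False
      have "(\<Sum>k<k0. (if k = 0 then 1 else 0) * x ^ k) = (\<Sum>k\<in>{0}. 1)"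
        using False by (cases k0) (simp_all add: sum.lessThan_Suc_shift del: sum.lessThan_Suc)
      then show ?thesis using sub_ringD(1,2)[OF B] M_0
        by (intro exI[of _ "\<lambda>k. if k = 0 then 1 else 0"]) auto
    qed
  next
    case (Suc n)
    then obtain a where a: "\<forall>k. a k \<in> B" "x ^ n - (\<Sum>k<k0. a k * x ^ k) \<in> M" by blast
    have xM: "x * (x ^ n - (\<Sum>k<k0. a k * x ^ k)) \<in> M" by (intro M_mult a xR)
    show ?case
    proof (cases k0)
      case 0
      then show ?thesis using xM sub_ringD(1)[OF B] by (intro exI[of _ "\<lambda>_. 0"]) auto
    next
      case (Suc i)
      define a' where "a' k = (if k = 0 then 0 else a (k - 1)) + a i * (if k \<le> D then b k else 0)" for k
      have a'B: "\<forall>k. a' k \<in> B"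
        using a(1) bB sub_ringD[OF B] by (auto simp: a'_def)
      have 1: "x * (\<Sum>k<k0. a k * x ^ k) = (\<Sum>k<i. a k * x ^ Suc k) + a i * x ^ k0"
        unfolding Suc by (simp add: sum_distrib_left algebra_simps)
      have 2: "(\<Sum>k<k0. (if k = 0 then 0 else a (k - 1)) * x ^ k) = (\<Sum>k<i. a k * x ^ Suc k)"
        unfolding Suc by (simp only: sum.lessThan_Suc_shift) simp
      have 3: "(\<Sum>k<k0. (if k \<le> D then b k else 0) * x ^ k) = (\<Sum>k<k0. b k * x ^ k)"
        using ck0(2) by (intro sum.cong) auto
      have "(\<Sum>k<k0. a' k * x ^ k) = (\<Sum>k<i. a k * x ^ Suc k) + a i * (\<Sum>k<k0. b k * x ^ k)"
        unfolding 2[symmetric] 3[symmetric] a'_def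
        by (simp add: distrib_right sum.distrib sum_distrib_left mult.assoc)
      then have e: "x ^ Suc n - (\<Sum>k<k0. a' k * x ^ k) = x * (x ^ n - (\<Sum>k<k0. a k * x ^ k)) + a i * m0"
        using 1 rel by (simp add: algebra_simps)
      have "a i * m0 \<in> M" using a(1) BR by (intro M_mult m0) auto
      then have "x ^ Suc n - (\<Sum>k<k0. a' k * x ^ k) \<in> M"
        unfolding e using xM by (intro M_add)
      then show ?thesis using a'B by blast
    qed
  qed
  have "\<exists>f \<in> {..<k0} \<rightarrow>\<^sub>E {..<p}. x ^ n - (\<Sum>k<k0. of_nat (f k) * x ^ k) \<in> M" for n
  proof -
    obtain a where a: "\<forall>k. a k \<in> B" "x ^ n - (\<Sum>k<k0. a k * x ^ k) \<in> M" using pw by blast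
    have "\<forall>k. \<exists>n<p. \<exists>y\<in>B. a k = of_nat n + \<pi> * y" using residue a(1) by blast
    then obtain f y where f: "\<And>k. f k < p" "\<And>k. y k \<in> B" "\<And>k. a k = of_nat (f k) + \<pi> * y k" by metis
    have "(\<Sum>k<k0. y k * x ^ k * \<pi>) \<in> M"
      by (intro M_sum M_mult pi_M RD(4,7) xR) (use f(2) BR in auto)
    moreover have "(\<Sum>k<k0. of_nat (restrict f {..<k0} k) * x ^ k) = (\<Sum>k<k0. a k * x ^ k) - (\<Sum>k<k0. y k * x ^ k * \<pi>)"
      unfolding sum_subtractf [symmetric] by (intro sum.cong) (simp_all add: f(3) algebra_simps)
    ultimately have "x ^ n - (\<Sum>k<k0. of_nat (restrict f {..<k0} k) * x ^ k) \<in> M"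
      using M_add[OF a(2), of "\<Sum>k<k0. y k * x ^ k * \<pi>"] by (simp only: diff_diff_eq2 diff_add_eq)
    then show ?thesis using f(1) by (intro bexI[of _ "restrict f {..<k0}"]) auto
  qed
  then obtain f where f: "\<And>n. f n \<in> {..<k0} \<rightarrow>\<^sub>E {..<p}"
      "\<And>n. x ^ n - (\<Sum>k<k0. of_nat (f n k) * x ^ k) \<in> M" by metis
  have "\<not> inj_on f {..p ^ k0}"
  proof
    assume "inj_on f {..p ^ k0}"
    then have "card {..p ^ k0} \<le> card ({..<k0} \<rightarrow>\<^sub>E {..<p})"
      using f(1) by (intro card_inj_on_le) (auto simp: finite_PiE)
    then show False by (simp add: card_PiE)
  qed
  then obtain i' k' where ik: "i' \<le> p ^ k0" "k' \<le> p ^ k0" "i' \<noteq> k'" "f i' = f k'"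
    by (auto simp: inj_on_def)
  define i where "i = min i' k'"
  define k where "k = max i' k'"
  have ik: "i < k" "k \<le> p ^ k0" "f i = f k"
    using ik by (auto simp: i_def k_def min_def max_def)
  have "x ^ k - x ^ i \<in> M"
    using M_diff[OF f(2)[of k] f(2)[of i]] ik(3) by simp
  moreover have "x ^ k - x ^ i = x ^ i * (x ^ (k - i) - 1)"
    using ik(1) by (simp add: right_diff_distrib flip: power_add)
  ultimately have "x ^ i * (x ^ (k - i) - 1) \<in> M" by simp
  moreover have "inverse (x ^ i) \<in> R" "x ^ i \<noteq> 0" using unit_power[OF assms(2)] by (auto simp: unit_def)
  ultimately have n1: "x ^ (k - i) - 1 \<in> M"
    using M_mult[of "x ^ i * (x ^ (k - i) - 1)" "inverse (x ^ i)"] by (simp add: mult.assoc[symmetric])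
  have p0: "p > 0" using p_nonzero by (cases p) auto
  have "p ^ k0 \<le> p ^ D" using ck0(2) p0 by (intro power_increasing) auto
  then have "(k - i) dvd fact (p ^ D)" using ik by (intro dvd_fact) auto
  then obtain q where q: "fact (p ^ D) = (k - i) * q" by (auto simp: dvd_def)
  show ?thesis unfolding q power_mult by (intro M_powers n1 RD xR)
qed

text \<open>The set \<open>T\<close> stands for the eigenvalues of all matrices of a given size over a given field. For the final step let \<open>y\<close> be a root of \<open>l\<close> that
  is congruent to 1, and put \<open>z\<^sub>i = y^(p\<^sup>i) - 1\<close>. Then \<open>z\<^sub>i\<^sub>+\<^sub>1 = z\<^sub>i * w\<close> where \<open>w\<close> is congruent to \<open>p\<close> modulo \<open>z\<^sub>i\<close>. As \<open>z\<^sub>i\<close> has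
  bounded degree, \<open>w\<close> has value at least \<open>1 / D!\<close>, so the value of \<open>z\<^sub>i\<close> grows by at least this amount in every step. Since \<open>l\<close> itself can
  be written as \<open>y^(p\<^sup>n)\<close> for every \<open>n\<close>, the value of \<open>l - 1\<close> exceeds every bound.\<close>

lemma divisible_eigenvalue_eq_1:
  assumes deg: "\<And>x. x \<in> T \<Longrightarrow> deg_le F D x" and T: "\<And>x n. x \<in> T \<Longrightarrow> x ^ n \<in> T" "\<And>x. x \<in> T \<Longrightarrow> x - 1 \<in> T"
    and l: "l \<in> T" "l \<noteq> 0" "\<And>m. m > 0 \<Longrightarrow> \<exists>x\<in>T. x ^ m = l"
  shows "l = 1"
proof (rule ccontr)
  assume "l \<noteq> 1"
  define P where "P = {x. \<exists>r\<in>R. x = \<pi> * r}"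
  have P_add: "x + y \<in> P" if "x \<in> P" "y \<in> P" for x y
  proof -
    obtain r s where "r \<in> R" "s \<in> R" "x = \<pi> * r" "y = \<pi> * s" using \<open>x \<in> P\<close> \<open>y \<in> P\<close> by (auto simp: P_def)
    then have "x + y = \<pi> * (r + s)" "r + s \<in> R" by (auto simp: distrib_left RD)
    then show ?thesis by (auto simp: P_def)
  qed
  have P_mult: "r * x \<in> P" if x: "x \<in> P" and r: "r \<in> R" for x r
  proof -
    obtain s where "s \<in> R" "x = \<pi> * s" using x by (auto simp: P_def)
    then have "r * x = \<pi> * (r * s)" "r * s \<in> R" using r by (auto simp: RD)
    then show ?thesis by (auto simp: P_def)
  qed
  obtain u j where u: "unit u" "l ^ fact D = u * \<pi> powi j"
    using deg_le_power deg l(1,2) by blast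
  \<comment> \<open>In units of \<open>1 / D!\<close> the value of \<open>l\<close> is an integer divisible by every positive \<open>n\<close>, hence 0.\<close>
  have roots_unit: "unit x" if x: "x \<in> T" "x ^ m = l" "m > 0" for x m
  proof -
    have x0: "x \<noteq> 0" using x l(2) by (auto simp: power_0_left)
    have val: "i * int n = j" if "y \<in> T" "y ^ n = l" "unit v" "y ^ fact D = v * \<pi> powi i" for y n v i
    proof -
      have "l ^ fact D = (y ^ fact D) ^ n"
        using that(2) by (metis power_mult mult.commute)
      also have "\<dots> = v ^ n * \<pi> powi (i * int n)"
        by (simp add: that(4) power_mult_distrib power_int_mult)
      finally have "u * \<pi> powi j = v ^ n * \<pi> powi (i * int n)" using u(2) by simp
      from powi_unique[OF u(1) unit_power[OF that(3)] this] show ?thesis by simp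
    qed
    have "j = 0"
    proof -
      define n where "n = nat \<bar>j\<bar> + 1"
      obtain y where y: "y \<in> T" "y ^ n = l" using l(3)[of n] by (auto simp: n_def)
      have "y \<noteq> 0" using y l(2) by (auto simp: power_0_left n_def)
      then obtain v i where v: "unit v" "y ^ fact D = v * \<pi> powi i" using deg_le_power deg y(1) by blast
      have e: "i * int n = j" using val[OF y v] .
      have "i = 0"
      proof (rule ccontr)
        assume "i \<noteq> 0"
        then have "\<bar>j\<bar> \<ge> int n" unfolding e[symmetric] abs_mult by (simp add: mult_le_cancel_right1 int_one_le_iff_zero_less)
        then show False by (simp add: n_def)
      qed
      then show ?thesis using e by simp
    qed
    obtain v i where v: "unit v" "x ^ fact D = v * \<pi> powi i" using deg_le_power deg x(1) x0 by blast
    have "i = 0" using val[OF x(1,2) v] \<open>j = 0\<close> x(3) by simp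
    then have "unit (x ^ fact D)" using v by simp
    then show ?thesis using x0 by (rule_tac unit_powerD) auto
  qed
  \<comment> \<open>The value of a nonzero nonunit of bounded degree is at least \<open>1 / D!\<close>.\<close>
  have TM: "x ^ fact D \<in> P" if x: "x \<in> T" "x \<in> M" for x
  proof (cases "x = 0")
    case True
    then show ?thesis using RD(1) by (auto simp: P_def power_0_left)
  next
    case False
    then obtain v i where v: "unit v" "x ^ fact D = v * \<pi> powi i" using deg_le_power deg x(1) by blast
    have "x ^ fact D \<in> M"
    proof -
      obtain f where "(fact D :: nat) = Suc f" by (metis fact_nonzero not0_implies_Suc)
      then show ?thesis using M_mult[OF x(2), of "x ^ f"] x(2) M_R RD(7) by (simp add: mult.commute)
    qed
    then have "\<not> unit (v * \<pi> powi i)" using M_iff M_R v(2) by metis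
    have "i > 0"
    proof (rule ccontr)
      assume i: "\<not> i > 0"
      have "\<pi> powi i = inverse (\<pi> ^ nat (- i))"
        using i by (simp add: power_int_def power_inverse)
      then have "inverse (x ^ fact D) = inverse v * \<pi> ^ nat (- i)"
        using v(2) by simp
      also have "\<dots> \<in> R" using v(1) by (intro RD(4,7) pi_R) (auto simp: unit_def)
      finally show False using \<open>x ^ fact D \<in> M\<close> False by (auto simp: M_def)
    qed
    then have "\<pi> powi i = \<pi> * \<pi> ^ (nat i - 1)"
      by (cases "nat i") (auto simp: power_int_def)
    then have "x ^ fact D = \<pi> * (v * \<pi> ^ (nat i - 1))" using v(2) by simp
    moreover have "v * \<pi> ^ (nat i - 1) \<in> R" using v(1) by (intro RD(4,7) pi_R) (auto simp: unit_def)
    ultimately show ?thesis by (auto simp: P_def)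
  qed
  have main: "\<exists>r\<in>R. (l - 1) ^ fact D = \<pi> ^ n * r" for n
  proof -
    define N where "N = fact (p ^ D) * p ^ n"
    have p0: "p > 0" using p_nonzero by (cases p) auto
    have "N > 0" by (simp add: N_def p0)
    then obtain x where x: "x \<in> T" "x ^ N = l" using l(3) by blast
    have ux: "unit x" using roots_unit[OF x \<open>N > 0\<close>] .
    define y where "y = x ^ fact (p ^ D)"
    have y: "y \<in> T" "y - 1 \<in> M" "y \<in> R" "y ^ (p ^ n) = l"
      using T(1)[OF x(1)] power_near_1[OF deg[OF x(1)] ux] ux x(2) RD(7)
      by (auto simp: y_def N_def unit_def power_mult)
    have zM: "y ^ k - 1 \<in> M" "y ^ k - 1 \<in> T" "y ^ k \<in> R" for k
      using M_powers[OF y(2,3)] T y(1,3) RD(7) by blast+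
    have "\<exists>r\<in>R. (y ^ (p ^ i) - 1) ^ fact D = \<pi> ^ i * r" for i
    proof (induction i)
      case 0
      then show ?case using zM(1)[of 1] M_R RD(7) by auto
    next
      case (Suc i)
      then obtain r where r: "r \<in> R" "(y ^ (p ^ i) - 1) ^ fact D = \<pi> ^ i * r" by blast
      define z where "z = y ^ (p ^ i) - 1"
      define w where "w = (\<Sum>k<p. (1 + z) ^ k)"
      have zR: "z \<in> R" "z \<in> M" "z \<in> T" using zM[of "p ^ i"] M_R by (auto simp: z_def)
      have e: "y ^ (p ^ Suc i) - 1 = z * w"
      proof -
        have "y ^ (p ^ Suc i) - 1 = (1 + z) ^ p - 1"
          by (simp add: z_def power_mult[symmetric] mult.commute)
        also have "\<dots> = z * w" by (simp add: power_diff_1_eq w_def)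
        finally show ?thesis .
      qed
      have wR: "w \<in> R" unfolding w_def by (intro RD(9,7,6,2) zR)
      have "\<exists>s\<in>R. w = \<pi> + z * s"
      proof -
        have "\<exists>s\<in>R. (1 + z) ^ k = 1 + z * s" for k
        proof (intro bexI)
          show "(1 + z) ^ k = 1 + z * (\<Sum>i<k. (1 + z) ^ i)"
            using power_diff_1_eq[of "1 + z" k] by (simp add: algebra_simps)
          show "(\<Sum>i<k. (1 + z) ^ i) \<in> R" by (intro RD(9,7,6,2) zR)
        qed
        then obtain s where s: "\<And>k. s k \<in> R" "\<And>k. (1 + z) ^ k = 1 + z * s k" by metis
        have "w = \<pi> + z * (\<Sum>k<p. s k)" by (simp add: w_def s(2) sum.distrib sum_distrib_left)
        moreover have "(\<Sum>k<p. s k) \<in> R" by (intro RD(9) s)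
        ultimately show ?thesis by blast
      qed
      then obtain s where s: "s \<in> R" "w = \<pi> + z * s" by blast
      have "w ^ fact D \<in> P"
      proof -
        have 1: "(\<pi> + a) ^ k - a ^ k \<in> P" if a: "a \<in> R" for a k
        proof (induction k)
          case 0
          show ?case using RD(1) by (auto simp: P_def)
        next
          case (Suc k)
          have "(\<pi> + a) ^ Suc k - a ^ Suc k = \<pi> * (\<pi> + a) ^ k + a * ((\<pi> + a) ^ k - a ^ k)"
            by (simp add: algebra_simps)
          moreover have "\<pi> * (\<pi> + a) ^ k \<in> P" using RD(7)[OF RD(6)[OF pi_R a]] by (auto simp: P_def)
          moreover have "a * ((\<pi> + a) ^ k - a ^ k) \<in> P" by (intro P_mult Suc a)
          ultimately show ?case using P_add by simp
        qed
        have "(z * s) ^ fact D \<in> P"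
          using P_mult[OF TM[OF zR(3,2)] RD(7)[OF s(1)], of "fact D"] by (simp add: power_mult_distrib mult.commute)
        from P_add[OF 1[OF RD(4)[OF zR(1) s(1)], of "fact D"] this] show ?thesis
          by (simp add: s(2))
      qed
      then obtain v where v: "v \<in> R" "w ^ fact D = \<pi> * v" by (auto simp: P_def)
      have "(y ^ (p ^ Suc i) - 1) ^ fact D = z ^ fact D * w ^ fact D"
        unfolding e by (rule power_mult_distrib)
      also have "\<dots> = \<pi> ^ Suc i * (r * v)"
        using r(2) v(2) by (simp add: z_def)
      finally show ?case using RD(4)[OF r(1) v(1)] by blast
    qed
    from this[of n] show ?thesis using y(4) by simp
  qed
  have "l - 1 \<in> T" "l - 1 \<noteq> 0" using T l(1) \<open>l \<noteq> 1\<close> by auto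
  then obtain v i where v: "unit v" "(l - 1) ^ fact D = v * \<pi> powi i" using deg_le_power deg by blast
  define n where "n = Suc (nat i)"
  obtain r where r: "r \<in> R" "(l - 1) ^ fact D = \<pi> ^ n * r" using main by blast
  have "\<pi> powi i * \<pi> ^ nat (int n - i) = \<pi> ^ n"
    using p_nonzero by (simp add: n_def power_int_add[symmetric] add.commute flip: power_int_of_nat)
  then have "\<pi> powi i * v = \<pi> powi i * (\<pi> ^ nat (int n - i) * r)"
    using v(2) r(2) by (metis mult.assoc mult.commute)
  then have "v = \<pi> ^ nat (int n - i) * r" using p_nonzero by simp
  moreover have "nat (int n - i) = Suc (nat (int n - i) - 1)" by (simp add: n_def)
  ultimately have "v = (\<pi> ^ (nat (int n - i) - 1) * r) * \<pi>" by (metis mult.assoc mult.commute power_Suc)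
  also have "\<dots> \<in> M" by (intro M_mult pi_M RD(4,7) r pi_R)
  finally show False using v(1) M_iff M_R by blast
qed

end

context padic_subfield
begin

lemma valuation_exists:
  obtains R where "padic_subfield_valuation F B p R"
proof -
  obtain R where "sub_ring R" "B \<subseteq> R" "inverse (of_nat p) \<notin> R" "\<And>x. x \<noteq> 0 \<Longrightarrow> x \<in> R \<or> inverse x \<in> R"
    using exists_valuation_ring[OF B sub_ringD(8)[OF B] p_nonunit] by blast
  then have "padic_subfield_valuation F B p R"
    by unfold_locales
  then show ?thesis by (rule that)
qed

end

section \<open>Divisible matrices and Heisenberg relations\<close>

lemma poly_with_coeffs:
  assumes "\<And>k. k > D \<Longrightarrow> c k = 0"
  defines "q \<equiv> (\<Sum>k\<le>D. Polynomial.monom (c k) k)"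
  shows "Polynomial.coeff q k = c k" "Polynomial.degree q \<le> D"
    "recur q x j = (\<Sum>k\<le>D. scl (c k) (x (j + k)))" "poly q t = (\<Sum>k\<le>D. c k * t ^ k)"
proof -
  have "Polynomial.coeff q k = (\<Sum>i\<le>D. if i = k then c i else 0)" for k
    unfolding q_def coeff_sum by simp
  then show *: "Polynomial.coeff q k = c k" for k
    using assms(1)[of k] by (simp add: not_le[symmetric])
  show d: "Polynomial.degree q \<le> D"
    by (rule degree_le) (use * assms(1) in auto)
  show "recur q x j = (\<Sum>k\<le>D. scl (c k) (x (j + k)))"
    using recur_bound[OF d] by (simp add: *)
  show "poly q t = (\<Sum>k\<le>D. c k * t ^ k)"
    by (simp add: q_def poly_sum poly_monom)
qed

definition entries_in :: "'a set \<Rightarrow> ('a, 'n::finite) sqmat set" where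
  "entries_in K = {A. \<forall>i j. ent A i j \<in> K}"

lemma entries_in_ops:
  fixes K :: "'a::field set"
  assumes K: "sub_field K"
  shows "1 \<in> entries_in K" "A \<in> entries_in K \<Longrightarrow> C \<in> entries_in K \<Longrightarrow> A * C \<in> entries_in K"
    "A \<in> entries_in K \<Longrightarrow> C \<in> entries_in K \<Longrightarrow> A - C \<in> entries_in K"
    "A \<in> entries_in K \<Longrightarrow> A ^ n \<in> entries_in K"
    "c \<in> K \<Longrightarrow> A \<in> entries_in K \<Longrightarrow> scl c A \<in> entries_in K"
    "(\<And>k. k \<in> S \<Longrightarrow> f k \<in> entries_in K) \<Longrightarrow> sum f S \<in> entries_in K"
proof -
  note KD = sub_fieldD[OF K]
  show 1: "1 \<in> entries_in K" using KD(1,2) by (auto simp: entries_in_def)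
  show m: "A * C \<in> entries_in K" if "A \<in> entries_in K" "C \<in> entries_in K" for A C
    using that unfolding entries_in_def mem_Collect_eq ent_mult by (intro allI KD(11,4)) auto
  show "A \<in> entries_in K \<Longrightarrow> C \<in> entries_in K \<Longrightarrow> A - C \<in> entries_in K"
    using KD(3) by (auto simp: entries_in_def)
  show "A \<in> entries_in K \<Longrightarrow> A ^ n \<in> entries_in K"
    by (induction n) (use 1 m in auto)
  show "c \<in> K \<Longrightarrow> A \<in> entries_in K \<Longrightarrow> scl c A \<in> entries_in K"
    using KD(4) by (auto simp: entries_in_def)
  show "sum f S \<in> entries_in K" if "\<And>k. k \<in> S \<Longrightarrow> f k \<in> entries_in K"
    using that unfolding entries_in_def mem_Collect_eq ent_sum by (intro allI KD(11)) auto
qed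

lemma eigenvalue_deg_le:
  fixes A :: "('a::field, 'n::finite) sqmat"
  assumes F: "sub_field F" and sp: "spanned_by F e K" and K: "sub_field K" and A: "A \<in> entries_in K"
    and v: "v \<noteq> 0" "A * v = scl l v"
  shows "deg_le F (card (UNIV :: ('n \<times> 'n) set) * e) l"
proof -
  define D where "D = card (UNIV :: ('n \<times> 'n) set) * e"
  have "ent (A ^ k) i j \<in> K" for k i j
    using entries_in_ops(4)[OF K A, of k] by (simp add: entries_in_def)
  from matrices_dependent[where M = "\<lambda>k. A ^ k", OF F sp this D_def] obtain c where c: "\<forall>k. c k \<in> F" "\<exists>k\<le>D. c k \<noteq> 0"
     "(\<Sum>k\<le>D. scl (c k) (A ^ k)) = 0" by blast
  have "(\<Sum>k\<le>D. scl (c k) (A ^ k)) * v = (\<Sum>k\<le>D. scl (c k) (A ^ k * v))"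
    by (simp add: sum_distrib_right)
  also have "\<dots> = scl (\<Sum>k\<le>D. c k * l ^ k) v"
    by (simp only: eigenvector_power[OF v(2)] sqm.scale_scale sqm.scale_sum_left)
  finally have "scl (\<Sum>k\<le>D. c k * l ^ k) v = (\<Sum>k\<le>D. scl (c k) (A ^ k)) * v" ..
  then have "(\<Sum>k\<le>D. c k * l ^ k) = 0"
    using c(3) v(1) by (simp add: scl_eq_0_iff)
  with c(1,2) show ?thesis unfolding deg_le_def D_def[symmetric] by blast
qed

text \<open>An eigenvalue \<open>l\<close> of \<open>A\<close> has, for every \<open>m\<close>, an \<open>m\<close>-th root that is an eigenvalue of an \<open>m\<close>-th root of \<open>A\<close>: the polynomial \<open>X\<^sup>m - l\<close> in
  that root annihilates an eigenvector of \<open>A\<close>. So \<open>divisible_eigenvalue_eq_1\<close> applies to \<open>l\<close>.\<close>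

lemma divisible_matrix_unipotent:
  fixes A :: "('a::alg_closed_field, 'n::finite) sqmat"
  assumes pf: "padic_subfield F B p" and sp: "spanned_by F e K" and K: "sub_field K"
    and roots: "\<And>m. m > 0 \<Longrightarrow> \<exists>C\<in>entries_in K. C ^ m = A" and inv: "A' * A = 1"
  shows "(A - 1) ^ (card (UNIV :: ('n \<times> 'n) set) * e) = 0"
proof (rule ccontr)
  define D where "D = card (UNIV :: ('n \<times> 'n) set) * e"
  assume nz: "(A - 1) ^ (card (UNIV :: ('n \<times> 'n) set) * e) \<noteq> 0"
  have A: "A \<in> entries_in K" using roots[of 1] by auto
  interpret padic_subfield F B p by (rule pf)
  obtain R where "padic_subfield_valuation F B p R" using valuation_exists .
  then interpret V: padic_subfield_valuation F B p R .
  have "ent (A ^ k) i j \<in> K" for k i j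
    using entries_in_ops(4)[OF K A, of k] by (simp add: entries_in_def)
  from matrices_dependent[where M = "\<lambda>k. A ^ k", OF F sp this D_def] obtain c' where c'F: "\<forall>k. c' k \<in> F" and c': "\<exists>k\<le>D. c' k \<noteq> 0"
     "(\<Sum>k\<le>D. scl (c' k) (A ^ k)) = 0" by blast
  define c where "c k = (if k \<le> D then c' k else 0)" for k
  define q where "q = (\<Sum>k\<le>D. Polynomial.monom (c k) k)"
  note qq = poly_with_coeffs[of D c, folded q_def]
  have c0: "\<And>k. k > D \<Longrightarrow> c k = 0" by (simp add: c_def)
  have q0: "q \<noteq> 0"
  proof
    obtain k where k: "k \<le> D" "c' k \<noteq> 0" using c'(1) by blast
    moreover assume "q = 0"
    ultimately show False using qq(1)[OF c0, of k] by (simp add: c_def)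
  qed
  have rq: "recur q (\<lambda>k. A ^ k * v) 0 = 0" for v
  proof -
    have "recur q (\<lambda>k. A ^ k * v) 0 = (\<Sum>k\<le>D. scl (c' k) (A ^ k)) * v"
      by (simp add: qq(3)[OF c0] c_def sum_distrib_right)
    then show ?thesis by (simp add: c'(2))
  qed
  \<comment> \<open>As \<open>(A - 1)\<^sup>a\<close> is not 0, the cofactor of \<open>(X - 1)\<^sup>a\<close> in the annihilating polynomial supplies an
    eigenvalue different from 1.\<close>
  define a where "a = Polynomial.order 1 q"
  obtain q1 where q1: "q = [:-1, 1:] ^ a * q1" "\<not> [:-1, 1:] dvd q1"
    using order_decomp[OF q0, of 1] unfolding a_def by blast
  have q10: "poly q1 1 \<noteq> 0" "q1 \<noteq> 0"
    using q1(2) by (auto simp: poly_eq_0_iff_dvd)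
  have "a \<le> D"
    using order_degree[OF q0, of 1] qq(2)[OF c0] by (simp add: a_def)
  then have nz': "(A - 1) ^ a \<noteq> 0"
    using nz unfolding D_def[symmetric] by (metis le_add_diff_inverse mult_zero_left power_add)
  have comp: "recur ([:-1, 1:] ^ n * r) (\<lambda>k. A ^ k * v) 0 = recur r (\<lambda>k. A ^ k * ((A - 1) ^ n * v)) 0" for n r v
  proof (induction n arbitrary: v)
    case (Suc n)
    have "recur ([:-1, 1:] ^ Suc n * r) (\<lambda>k. A ^ k * v) 0 = recur ([:-1, 1:] * ([:-1, 1:] ^ n * r)) (\<lambda>k. A ^ k * v) 0"
      by (simp only: power_Suc mult.assoc)
    also have "\<dots> = recur ([:-1, 1:] ^ n * r) (\<lambda>k. A ^ k * v) 1 - recur ([:-1, 1:] ^ n * r) (\<lambda>k. A ^ k * v) 0"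
      by (subst recur_linear_factor) simp
    also have "\<dots> = recur ([:-1, 1:] ^ n * r) (\<lambda>k. A ^ k * ((A - 1) * v)) 0"
      unfolding recur_def
      by (simp add: algebra_simps sum_subtractf sqm.scale_right_diff_distrib power_commutes flip: mult.assoc)
    also have "\<dots> = recur r (\<lambda>k. A ^ k * ((A - 1) ^ Suc n * v)) 0"
      unfolding Suc by (simp only: power_Suc2 mult.assoc)
    finally show ?case .
  qed simp
  have "recur q1 (\<lambda>k. A ^ k * (A - 1) ^ a) 0 = 0"
    using comp[of a q1 1] rq[of 1] q1(1) by simp
  from matrix_eigenvalue[OF q10(2) this nz'] obtain l v where
    lv: "poly q1 l = 0" "v \<noteq> 0" "A * v = scl l v" by blast
  have l1: "l \<noteq> 1" using lv(1) q10(1) by auto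
  define T where "T = {x. \<exists>C\<in>entries_in K. \<exists>w::('a, 'n) sqmat. w \<noteq> 0 \<and> C * w = scl x w}"
  have "l = 1"
  proof (rule V.divisible_eigenvalue_eq_1)
    show "deg_le F D x" if "x \<in> T" for x
      using that eigenvalue_deg_le[OF F sp K] unfolding T_def D_def by blast
    show "x ^ n \<in> T" if x: "x \<in> T" for x n
    proof -
      obtain C w where C: "C \<in> entries_in K" "(w::('a, 'n) sqmat) \<noteq> 0" "C * w = scl x w" using x by (auto simp: T_def)
      then have "C ^ n * w = scl (x ^ n) w" by (intro eigenvector_power)
      then show ?thesis using C entries_in_ops(4)[OF K C(1)] by (auto simp: T_def)
    qed
    show "x - 1 \<in> T" if x: "x \<in> T" for x
    proof -
      obtain C w where C: "C \<in> entries_in K" "(w::('a, 'n) sqmat) \<noteq> 0" "C * w = scl x w" using x by (auto simp: T_def)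
      then have "(C - 1) * w = scl (x - 1) w" by (simp add: left_diff_distrib sqm.scale_left_diff_distrib)
      then show ?thesis using C entries_in_ops(3)[OF K C(1) entries_in_ops(1)[OF K]] by (auto simp: T_def)
    qed
    show "l \<in> T" using lv A by (auto simp: T_def)
    show "l \<noteq> 0"
    proof
      assume "l = 0"
      then have "A' * (A * v) = 0" using lv(3) by simp
      then show False using inv lv(2) by (simp flip: mult.assoc)
    qed
    show "\<exists>x\<in>T. x ^ m = l" if m: "m > 0" for m
    proof -
      obtain C where C: "C \<in> entries_in K" "C ^ m = A" using roots[OF m] by blast
      define g where "g = Polynomial.monom 1 m - [:l:]"
      have dg: "Polynomial.degree g \<le> m"
        unfolding g_def by (rule degree_le) (use m in \<open>auto simp: coeff_eq_0 coeff_pCons split: nat.split\<close>)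
      have eq_mod: "Polynomial.coeff g k = (if k = m then 1 else if k = 0 then - l else 0)" for k
        using m by (auto simp: g_def coeff_pCons split: nat.split)
      have g0: "g \<noteq> 0" using eq_mod[of m] by auto
      have "recur g (\<lambda>k. C ^ k * v) 0 = (\<Sum>k\<le>m. scl (Polynomial.coeff g k) (C ^ k * v))"
        using recur_bound[OF dg, of "\<lambda>k. C ^ k * v" 0] by simp
      also have "\<dots> = (\<Sum>k\<in>{0, m}. scl (Polynomial.coeff g k) (C ^ k * v))"
        by (rule sum.mono_neutral_right) (auto simp: eq_mod)
      also have "\<dots> = 0" using m by (simp add: eq_mod C(2) lv(3))
      finally obtain x d where x: "poly g x = 0" "recur d (\<lambda>k. C ^ k * v) 0 \<noteq> 0"
          "C * recur d (\<lambda>k. C ^ k * v) 0 = scl x (recur d (\<lambda>k. C ^ k * v) 0)"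
        using matrix_eigenvalue[OF g0 _ lv(2)] by blast
      have "x ^ m = l" using x(1) by (simp add: g_def poly_monom)
      then show ?thesis using x(2,3) C(1) unfolding T_def by blast
    qed
  qed
  with l1 show False by simp
qed

text \<open>The proof passes to logarithms and lets \<open>y \<in> L\<close> with \<open>y\<^sup>Q = p\<^sup>m\<close> act on \<open>H\<close> by multiplication of the argument. A linear relation
  over \<open>F\<close> between the matrices \<open>F (y\<^sup>k)\<close> becomes, after bracketing with \<open>G s\<close>, a linear recurrence for \<open>k \<mapsto> H (y\<^sup>k s)\<close>, for all \<open>s\<close>
  at once. An eigenvalue of this recurrence is an element \<open>l\<close> of bounded degree with \<open>l\<^sup>Q = p\<^sup>m\<close>. In the proof the logarithms are called \<open>ff\<close>, \<open>gg\<close>, \<open>hh\<close>, because \<open>F\<close> is a field there.\<close>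

lemma heisenberg_trivial:
  fixes f g h :: "'l::field \<Rightarrow> ('a::alg_closed_field, 'n::finite) sqmat" and N :: nat
  assumes c0: "CHAR('a) = 0" and pf: "padic_subfield F B p" and sp: "spanned_by F e K" and K: "sub_field K"
    and L: "sub_field L"
    and roots: "m > 0" "\<And>b. \<exists>Q>b. \<exists>y\<in>L. y ^ Q = of_nat p ^ m"
    and uf: "\<And>t. t \<in> L \<Longrightarrow> (f t - 1) ^ N = 0" and ug: "\<And>t. t \<in> L \<Longrightarrow> (g t - 1) ^ N = 0"
    and uh: "\<And>t. t \<in> L \<Longrightarrow> (h t - 1) ^ N = 0"
    and fK: "\<And>t. t \<in> L \<Longrightarrow> f t \<in> entries_in K"
    and af: "\<And>s t. s \<in> L \<Longrightarrow> t \<in> L \<Longrightarrow> f (s + t) = f s * f t"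
    and ag: "\<And>s t. s \<in> L \<Longrightarrow> t \<in> L \<Longrightarrow> g (s + t) = g s * g t"
    and ah: "\<And>s t. s \<in> L \<Longrightarrow> t \<in> L \<Longrightarrow> h (s + t) = h s * h t"
    and fgh: "\<And>s t. s \<in> L \<Longrightarrow> t \<in> L \<Longrightarrow> f t * g s = g s * f t * h (t * s)"
    and s: "s \<in> L"
  shows "h s = 1"
proof (rule ccontr)
  assume hs: "h s \<noteq> 1"
  note LD = sub_fieldD[OF L]
  interpret padic_subfield F B p by (rule pf)
  obtain R where "padic_subfield_valuation F B p R" using valuation_exists .
  then interpret V: padic_subfield_valuation F B p R .
  have lgadd: "mlog N (a (s + t)) = mlog N (a s) + mlog N (a t)"
    if "\<And>t. t \<in> L \<Longrightarrow> (a t - 1) ^ N = 0" "\<And>s t. s \<in> L \<Longrightarrow> t \<in> L \<Longrightarrow> a (s + t) = a s * a t" "s \<in> L" "t \<in> L"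
    for a :: "'l \<Rightarrow> ('a, 'n) sqmat" and s t
  proof -
    have "a s * a t = a t * a s" using that(2)[OF that(3,4)] that(2)[OF that(4,3)] by (simp add: add.commute)
    then show ?thesis
      using mlog_mult[OF c0 that(1)[OF that(3)] that(1)[OF that(4)]] that(1)[OF LD(7)[OF that(3,4)]] that(2)[OF that(3,4)] by simp
  qed
  have pown: "a (of_nat n * t) = a t ^ n" if "\<And>t. t \<in> L \<Longrightarrow> (a t - 1) ^ N = 0" "\<And>s t. s \<in> L \<Longrightarrow> t \<in> L \<Longrightarrow> a (s + t) = a s * a t" "t \<in> L" "a 0 = 1"
    for a :: "'l \<Rightarrow> ('a, 'n) sqmat" and t n
    by (induction n) (use that LD(4)[OF LD(10) that(3)] in \<open>simp_all add: distrib_right\<close>)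
  have zero1: "a 0 = 1" if "\<And>t. t \<in> L \<Longrightarrow> (a t - 1) ^ N = 0" "\<And>s t. s \<in> L \<Longrightarrow> t \<in> L \<Longrightarrow> a (s + t) = a s * a t"
    for a :: "'l \<Rightarrow> ('a, 'n) sqmat"
  proof -
    have "a 0 = a 0 * a 0" using that(2)[OF LD(1,1)] by simp
    then have i: "(a 0 - 1) * (a 0 - 1) = - (a 0 - 1)" by (simp add: algebra_simps)
    have z: "(a 0 - 1) ^ Suc k = a 0 - 1 \<or> (a 0 - 1) ^ Suc k = - (a 0 - 1)" for k
    proof (induction k)
      case (Suc k)
      have "(a 0 - 1) ^ Suc (Suc k) = (a 0 - 1) * (a 0 - 1) ^ Suc k" by (rule power_Suc)
      then show ?case using Suc by (metis i minus_minus mult_minus_right)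
    qed simp
    have "(a 0 - 1) ^ Suc N = 0" using that(1)[OF LD(1)] by simp
    then show ?thesis using z[of N] by auto
  qed
  define ff where "ff t = mlog N (f t)" for t
  define gg where "gg t = mlog N (g t)" for t
  define hh where "hh t = mlog N (h t)" for t
  have fadd: "ff (s + t) = ff s + ff t" if "s \<in> L" "t \<in> L" for s t
    unfolding ff_def using that by (intro lgadd uf af)
  have hadd: "hh (s + t) = hh s + hh t" if "s \<in> L" "t \<in> L" for s t
    unfolding hh_def using that by (intro lgadd uh ah)
  have hh0: "hh 0 = 0" using hadd[OF LD(1,1)] by simp
  have hnat: "hh (of_nat n * t) = of_nat n * hh t" if "t \<in> L" for n t
    by (induction n) (use that hh0 hadd LD(4,10) in \<open>simp_all add: distrib_right\<close>)
  have bracket: "ff t * gg s = gg s * ff t + hh (t * s)" if t: "t \<in> L" and s: "s \<in> L" for t s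
  proof -
    have ts: "t * s \<in> L" using t s by (rule LD)
    have 1: "ff t * g r = g r * ff t + g r * hh (t * r)" if r: "r \<in> L" for r
    proof -
      have tr: "t * r \<in> L" using t r by (rule LD)
      have "Pw N (f t) * cst (g r) = cst (g r) * (Pw N (f t) * Pw N (h (t * r)))"
      proof (rule poly_sqmat_eqI[OF c0])
        fix n
        have nt: "of_nat n * t \<in> L" using LD(4)[OF LD(10) t] .
        have "f (of_nat n * t) * g r = g r * f (of_nat n * t) * h (of_nat n * t * r)"
          using fgh[OF r nt] .
        then have "f t ^ n * g r = g r * f t ^ n * h (t * r) ^ n"
          using pown[of f t n, OF uf af t zero1[of f, OF uf af]] pown[of h "t * r" n, OF uh ah tr zero1[of h, OF uh ah]]
          by (simp add: mult.assoc)
        then show "ev (of_nat n) (Pw N (f t) * cst (g r)) = ev (of_nat n) (cst (g r) * (Pw N (f t) * Pw N (h (t * r))))"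
          by (simp add: pw_of_nat[OF c0] uf[OF t] uh[OF tr] mult.assoc)
      qed
      then have "cf 1 (Pw N (f t) * cst (g r)) = cf 1 (cst (g r) * (Pw N (f t) * Pw N (h (t * r))))" by simp
      then show ?thesis
        unfolding cf_simps cf_1_mult
        by (simp add: ff_def hh_def mlog_def pw_0[OF c0 uf[OF t]] pw_0[OF c0 uh[OF tr]] distrib_left)
    qed
    have "cst (ff t) * Pw N (g s) = Pw N (g s) * cst (ff t) + Pw N (g s) * scl [:0, 1:] (cst (hh (t * s)))"
    proof (rule poly_sqmat_eqI[OF c0])
      fix n
      have ns: "of_nat n * s \<in> L" using LD(4)[OF LD(10) s] .
      have "ff t * g (of_nat n * s) = g (of_nat n * s) * ff t + g (of_nat n * s) * hh (of_nat n * (t * s))"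
        using 1[OF ns] by (simp add: algebra_simps)
      then show "ev (of_nat n) (cst (ff t) * Pw N (g s)) = ev (of_nat n) (Pw N (g s) * cst (ff t) + Pw N (g s) * scl [:0, 1:] (cst (hh (t * s))))"
        using pown[of g s n, OF ug ag s zero1[of g, OF ug ag]] hnat[OF ts]
        by (simp add: pw_of_nat[OF c0] ug[OF s] scl_of_nat mult_of_nat_commute mult.assoc)
    qed
    then have "cf 1 (cst (ff t) * Pw N (g s)) = cf 1 (Pw N (g s) * cst (ff t) + Pw N (g s) * scl [:0, 1:] (cst (hh (t * s))))" by simp
    moreover have "cf 1 (scl [:0, 1:] (cst A)) = A" "ev 0 (scl [:0, 1:] (cst A)) = 0" for A :: "('a, 'n) sqmat"
      by (rule sqmat_eqI; simp add: cf_def cst_def ev_def coeff_pCons)+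
    ultimately show ?thesis
      unfolding cf_simps cf_1_mult
      by (simp add: gg_def mlog_def pw_0[OF c0 ug[OF s]])
  qed
  define D where "D = card (UNIV :: ('n \<times> 'n) set) * e"
  obtain Q y where Q: "Q > m * fact D" "y \<in> L" "y ^ Q = of_nat p ^ m" using roots(2) by blast
  have yk: "y ^ k \<in> L" for k using Q(2) by (rule LD)
  have "ent (ff (y ^ k)) i j \<in> K" for k i j
  proof -
    have "Polynomial.coeff (binom_poly i) j \<in> K" for i j
    proof (induction i arbitrary: j)
      case 0
      then show ?case using sub_fieldD(1,2)[OF K] by (simp add: coeff_1)
    next
      case (Suc i)
      then have "Polynomial.coeff (binom_poly i * [:- of_nat i, 1:]) j \<in> K"
        unfolding coeff_mult
        by (intro sub_fieldD(11,4)[OF K]) (auto simp: coeff_pCons split: nat.split intro: sub_fieldD[OF K])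
      then show ?case unfolding binom_poly.simps coeff_smult by (intro sub_fieldD(4,5,10)[OF K])
    qed
    then have "ff (y ^ k) \<in> entries_in K"
      unfolding ff_def mlog_expand
      by (intro entries_in_ops(6,5,4,3,1)[OF K] fK yk)
    then show ?thesis by (simp add: entries_in_def)
  qed
  from matrices_dependent[where M = "\<lambda>k. ff (y ^ k)", OF F sp this D_def] obtain c' where c': "\<forall>k. c' k \<in> F" "\<exists>k\<le>D. c' k \<noteq> 0"
     "(\<Sum>k\<le>D. scl (c' k) (ff (y ^ k))) = 0" by blast
  have rel: "(\<Sum>k\<le>D. scl (c' k) (hh (y ^ k * t))) = 0" if t: "t \<in> L" for t
  proof -
    have "(\<Sum>k\<le>D. scl (c' k) (hh (y ^ k * t))) = (\<Sum>k\<le>D. scl (c' k) (ff (y ^ k) * gg t - gg t * ff (y ^ k)))"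
      using bracket[OF yk t] by simp
    also have "\<dots> = (\<Sum>k\<le>D. scl (c' k) (ff (y ^ k))) * gg t - gg t * (\<Sum>k\<le>D. scl (c' k) (ff (y ^ k)))"
      by (simp add: sum_distrib_left sum_distrib_right sum_subtractf sqm.scale_right_diff_distrib)
    finally show ?thesis by (simp add: c'(3))
  qed
  define c where "c k = (if k \<le> D then c' k else 0)" for k
  define q where "q = (\<Sum>k\<le>D. Polynomial.monom (c k) k)"
  note qq = poly_with_coeffs[of D c, folded q_def]
  have cD: "\<And>k. k > D \<Longrightarrow> c k = 0" by (simp add: c_def)
  have q0: "q \<noteq> 0"
  proof
    obtain k where k: "k \<le> D" "c' k \<noteq> 0" using c'(2) by blast
    moreover assume "q = 0"
    ultimately show False using qq(1)[OF cD, of k] by (simp add: c_def)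
  qed
  define x where "x k = hh (y ^ k * s)" for k
  have xr: "recur q x j = 0" for j
    using rel[OF LD(4)[OF yk[of j] s]] by (simp add: qq(3)[OF cD] c_def x_def power_add mult_ac)
  have x0: "x 0 \<noteq> 0"
    using mlog_eq_0D[OF uh[OF s]] hs by (auto simp: x_def hh_def)
  from recurrence_eigenvalue[OF q0 xr x0] obtain l d where
    ld: "poly q l = 0" "recur d x 0 \<noteq> 0" "\<forall>j. recur d x j = scl (l ^ j) (recur d x 0)" by blast
  have "x (Q + k) = scl (of_nat p ^ m) (x k)" for k
  proof -
    have "x (Q + k) = hh (of_nat (p ^ m) * (y ^ k * s))"
      by (simp add: x_def power_add Q(3) mult.assoc)
    also have "\<dots> = scl (of_nat (p ^ m)) (hh (y ^ k * s))"
      unfolding hnat[OF LD(4)[OF yk s]] scl_of_nat ..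
    finally show ?thesis by (simp add: x_def)
  qed
  then have "recur d x Q = scl (of_nat p ^ m) (recur d x 0)"
    by (simp add: recur_def sqm.scale_sum_right mult.commute)
  then have "scl (l ^ Q - of_nat p ^ m) (recur d x 0) = 0"
    using ld(3)[rule_format, of Q] by (simp add: sqm.scale_left_diff_distrib)
  then have "l ^ Q = of_nat p ^ m"
    using ld(2) by (simp add: scl_eq_0_iff)
  moreover have "deg_le F D l"
  proof -
    have "(\<Sum>k\<le>D. c k * l ^ k) = 0" using ld(1) qq(4)[OF cD, of l] by simp
    moreover have "\<forall>k. c k \<in> F" using c'(1) sub_fieldD(1)[OF F] by (simp add: c_def)
    moreover have "\<exists>k\<le>D. c k \<noteq> 0" using c'(2) by (auto simp: c_def)
    ultimately show ?thesis unfolding deg_le_def by blast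
  qed
  ultimately show False
    using V.no_deg_le_root_of_p[of D l Q m] roots(1) Q(1) by blast
qed

section \<open>Traces of nilpotent and idempotent matrices\<close>

lift_definition act :: "('a::comm_ring_1, 'n::finite) sqmat \<Rightarrow> 'a^'n \<Rightarrow> 'a^'n" is "(*v)" .

lemma act_simps [simp]:
  fixes A :: "('a::field, 'n::finite) sqmat"
  shows "act 0 v = 0" "act 1 v = v" "act A 0 = 0" "act (A + C) v = act A v + act C v" "act (A - C) v = act A v - act C v"
    "act (A * C) v = act A (act C v)" "act A (v + w) = act A v + act A w" "act A (v - w) = act A v - act A w"
    "act (scl c A) v = c *s act A v" "act A (c *s v) = c *s act A v"
proof -
  show "act 0 v = 0" "act 1 v = v" "act A 0 = 0"
    by (transfer; simp)+
  show "act (A + C) v = act A v + act C v" "act (A - C) v = act A v - act C v"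
    by (transfer; simp add: matrix_vector_mult_def vec_eq_iff sum.distrib sum_subtractf algebra_simps)+
  show "act (A * C) v = act A (act C v)"
    by transfer (simp add: matrix_vector_mul_assoc)
  show "act A (v + w) = act A v + act A w" "act A (v - w) = act A v - act A w"
    by (transfer; simp add: matrix_vector_mult_def vec_eq_iff sum.distrib sum_subtractf algebra_simps)+
  show "act (scl c A) v = c *s act A v" "act A (c *s v) = c *s act A v"
    by (transfer; simp add: matrix_vector_mult_def vec_eq_iff sum_distrib_left algebra_simps)+
qed

lemma act_sum [simp]: "act A (sum f S) = (\<Sum>x\<in>S. act A (f x :: 'a::field^'n::finite))"
  by (induction S rule: infinite_finite_induct) auto

lemma act_eqI: "(\<And>v. act A v = act C v) \<Longrightarrow> A = (C :: ('a::field, 'n::finite) sqmat)"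
  by transfer (simp add: matrix_eq)

lemma subspace_act_image: "vec.subspace S \<Longrightarrow> vec.subspace (act A ` S)" for A :: "('a::field, 'n::finite) sqmat"
proof (rule vec.subspaceI)
  assume S: "vec.subspace S"
  show "0 \<in> act A ` S"
    using vec.subspace_0[OF S] by (force intro: image_eqI[of _ _ 0])
  show "x + y \<in> act A ` S" if "x \<in> act A ` S" "y \<in> act A ` S" for x y
    using that vec.subspace_add[OF S] by (auto simp flip: act_simps(7))
  show "c *s x \<in> act A ` S" if "x \<in> act A ` S" for x c
    using that vec.subspace_scale[OF S] by (auto simp flip: act_simps(10))
qed

definition tr :: "('a::comm_ring_1, 'n::finite) sqmat \<Rightarrow> 'a" where
  "tr A = (\<Sum>i\<in>UNIV. ent A i i)"

lemma tr_simps [simp]: "tr 0 = 0" "tr (A + C) = tr A + tr C" "tr (A - C) = tr A - tr C" "tr (scl c A) = c * tr A"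
  by (simp_all add: tr_def sum.distrib sum_subtractf sum_distrib_left)

lemma tr_commute: "tr (A * C) = tr (C * A)"
  unfolding tr_def ent_mult by (subst sum.swap) (simp add: mult.commute)

text \<open>The trace can be computed on any subspace that contains the range: with the coordinate functions \<open>r b\<close> of the vectors
  \<open>b\<close> in \<open>Bs\<close>, the \<open>i\<close>-th diagonal entry is \<open>\<Sum>b. r b e\<^sub>i * b\<^sub>i\<close>, and summing over \<open>i\<close> first gives \<open>\<Sum>b. r b b\<close>.\<close>

lemma tr_via_basis:
  fixes A :: "('a::field, 'n::finite) sqmat"
  assumes Bs: "vec.independent Bs" and rng: "\<And>v. act A v \<in> vec.span Bs"
  shows "tr A = (\<Sum>b\<in>Bs. vec.representation Bs (act A b) b)"
proof -
  have fin: "finite Bs" using Bs by (rule vec.finiteI_independent)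
  define r where "r b v = vec.representation Bs (act A v) b" for b v
  have e: "ent A i j = act A (axis j 1) $ i" for i j
    by transfer (simp add: matrix_vector_mult_def axis_def if_distrib cong: if_cong)
  have exp: "act A v = (\<Sum>b\<in>Bs. r b v *s b)" for v
    unfolding r_def using vec.sum_representation_eq[OF Bs rng fin, of v] by simp
  have lin: "r b (\<Sum>i\<in>UNIV. c i *s axis i 1) = (\<Sum>i\<in>UNIV. c i * r b (axis i 1))" for b and c :: "'n \<Rightarrow> 'a"
  proof -
    have "vec.representation Bs (\<Sum>i\<in>S. c i *s act A (axis i 1)) b = (\<Sum>i\<in>S. c i * r b (axis i 1))" for S :: "'n set"
    proof (induction S rule: infinite_finite_induct)
      case (insert x F)
      have "vec.representation Bs (c x *s act A (axis x 1) + (\<Sum>i\<in>F. c i *s act A (axis i 1))) =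
        (\<lambda>b. vec.representation Bs (c x *s act A (axis x 1)) b + vec.representation Bs (\<Sum>i\<in>F. c i *s act A (axis i 1)) b)"
        by (intro vec.representation_add Bs vec.span_scale rng vec.span_sum)
      then show ?case using insert by (simp add: vec.representation_scale[OF Bs rng] r_def)
    qed (simp_all add: vec.representation_zero)
    then show ?thesis unfolding r_def by simp
  qed
  have "tr A = (\<Sum>i\<in>UNIV. \<Sum>b\<in>Bs. r b (axis i 1) * b $ i)"
    unfolding tr_def e by (simp add: exp[of "axis _ _"])
  also have "\<dots> = (\<Sum>b\<in>Bs. \<Sum>i\<in>UNIV. b $ i * r b (axis i 1))"
    by (subst sum.swap) (simp add: mult.commute)
  also have "\<dots> = (\<Sum>b\<in>Bs. r b b)"
    unfolding lin[symmetric] basis_expansion ..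
  finally show ?thesis by (simp add: r_def)
qed

text \<open>The trace is the rank: use a basis of the range, on which \<open>E\<close> is the identity.\<close>

lemma tr_idempotent_nonzero:
  fixes E :: "('a::field, 'n::finite) sqmat"
  assumes c0: "CHAR('a) = 0" and E: "E * E = E" "E \<noteq> 0"
  shows "tr E \<noteq> 0"
proof -
  define S where "S = act E ` UNIV"
  have sub: "vec.subspace S" unfolding S_def by (intro subspace_act_image vec.subspace_UNIV)
  obtain Bs where Bs: "Bs \<subseteq> S" "vec.independent Bs" "S \<subseteq> vec.span Bs"
    by (rule vec.basis_exists[of S])
  have fin: "finite Bs" using Bs(2) by (rule vec.finiteI_independent)
  have Eb: "act E b = b" if "b \<in> Bs" for b
  proof -
    have "b \<in> act E ` UNIV" using Bs(1) that by (auto simp: S_def)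
    then obtain v where v: "b = act E v" by (rule imageE)
    show ?thesis unfolding v act_simps(6)[symmetric] E(1) ..
  qed
  have "tr E = (\<Sum>b\<in>Bs. vec.representation Bs (act E b) b)"
    using Bs by (intro tr_via_basis) (auto simp: S_def)
  also have "\<dots> = (\<Sum>b\<in>Bs. 1)"
    by (intro sum.cong refl) (simp add: Eb vec.representation_basis[OF Bs(2)])
  finally have t: "tr E = of_nat (card Bs)" by simp
  have "Bs \<noteq> {}"
  proof
    assume "Bs = {}"
    then have "act E v = 0" for v using Bs(3) by (auto simp: S_def)
    then have "E = 0" by (intro act_eqI) simp
    then show False using E(2) by simp
  qed
  then show ?thesis
    using fin c0 by (simp add: t of_nat_eq_0_CHAR_0)
qed

text \<open>Extend bases along the chain of ranges of \<open>A\<^sup>N, A\<^sup>N\<^sup>-\<^sup>1, \<dots>, 1\<close>. In the resulting basis \<open>A b\<close> involves only basis vectors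
  from an earlier step than \<open>b\<close>, so all diagonal coefficients vanish.\<close>

lemma tr_nilpotent:
  fixes A :: "('a::field, 'n::finite) sqmat"
  assumes "A ^ N = 0"
  shows "tr A = 0"
proof -
  have "\<exists>Bs. vec.independent Bs \<and> vec.span Bs = act (A ^ (N - k)) ` UNIV \<and> (\<forall>b\<in>Bs. act A b \<in> vec.span (Bs - {b}))" if "k \<le> N" for k
    using that
  proof (induction k)
    case 0
    have "act (A ^ (N - 0)) ` UNIV = {0}" using assms by auto
    then show ?case by (intro exI[of _ "{}"]) (simp add: vec.independent_empty)
  next
    case (Suc k)
    define S where "S = act (A ^ (N - Suc k)) ` UNIV"
    have sub: "vec.subspace S" unfolding S_def by (intro subspace_act_image vec.subspace_UNIV)
    obtain Bs where Bs: "vec.independent Bs" "vec.span Bs = act (A ^ (N - k)) ` UNIV"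
       "\<forall>b\<in>Bs. act A b \<in> vec.span (Bs - {b})" using Suc by auto
    have Nk: "A ^ (N - k) = A ^ (N - Suc k) * A" "A ^ (N - k) = A * A ^ (N - Suc k)"
      using Suc.prems Suc_diff_Suc[of k N] by (metis Suc_le_eq power_Suc power_Suc2)+
    have "Bs \<subseteq> S"
    proof
      fix b assume "b \<in> Bs"
      then have "b \<in> vec.span Bs" by (rule vec.span_base)
      then obtain v where "b = act (A ^ (N - k)) v" unfolding Bs(2) by auto
      then show "b \<in> S" unfolding S_def Nk(1) by auto
    qed
    then obtain C where C: "Bs \<subseteq> C" "C \<subseteq> S" "vec.independent C" "S \<subseteq> vec.span C"
      using vec.maximal_independent_subset_extend[OF _ Bs(1)] by blast
    have "vec.span C = S" using C(2,4) sub by (metis vec.span_mono vec.span_eq_iff subset_antisym)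
    moreover have "act A b \<in> vec.span (C - {b})" if "b \<in> C" for b
    proof (cases "b \<in> Bs")
      case True
      then show ?thesis using Bs(3) C(1) vec.span_mono[of "Bs - {b}" "C - {b}"] by blast
    next
      case False
      have "b \<in> act (A ^ (N - Suc k)) ` UNIV" using that C(2) by (auto simp: S_def)
      then obtain v where "b = act (A ^ (N - Suc k)) v" by (rule imageE)
      then have "act A b = act (A ^ (N - k)) v" unfolding Nk(2) by simp
      then have "act A b \<in> vec.span Bs" unfolding Bs(2) by auto
      then show ?thesis using False C(1) vec.span_mono[of Bs "C - {b}"] by blast
    qed
    ultimately show ?case using C(3) unfolding S_def by blast
  qed
  from this[of N] obtain Bs where Bs: "vec.independent Bs" "vec.span Bs = UNIV"
     "\<And>b. b \<in> Bs \<Longrightarrow> act A b \<in> vec.span (Bs - {b})"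
    by auto
  have "vec.representation Bs (act A b) b = 0" if b: "b \<in> Bs" for b
  proof -
    have "vec.representation Bs (act A b) = vec.representation (Bs - {b}) (act A b)"
      by (intro vec.representation_extend Bs b) auto
    then show ?thesis using vec.representation_ne_zero by auto
  qed
  then show ?thesis
    using tr_via_basis[OF Bs(1), of A] by (simp add: Bs(2))
qed

lemma power_stable_mult:
  fixes b s :: "'a::ring_1"
  assumes "b * s = s * b" "b ^ a = b ^ Suc a * s"
  shows "b ^ a = b ^ (a + k) * s ^ k"
proof (induction k)
  case (Suc k)
  have "a + Suc k = k + Suc a" by simp
  then have "b ^ (a + Suc k) * s ^ Suc k = b ^ k * (b ^ Suc a * s) * s ^ k"
    by (simp only: power_add power_Suc mult.assoc)
  also have "\<dots> = b ^ (a + k) * s ^ k"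
    unfolding assms(2)[symmetric] by (simp only: power_add[symmetric] add.commute)
  finally show ?case using Suc by simp
qed simp

text \<open>A linear relation between the powers of \<open>b\<close>, divided by its lowest coefficient, has the form \<open>b\<^sup>a = b\<^sup>a\<^sup>+\<^sup>1 s\<close> with a polynomial \<open>s\<close>
  in \<open>b\<close>. Then \<open>b\<^sup>j = b\<^sup>j (b s)\<^sup>j\<close> for \<open>j = a + 1\<close>, which makes \<open>(b s)\<^sup>j\<close> idempotent, and nonzero as \<open>b\<close> is not nilpotent.\<close>

lemma idempotent_multiple:
  fixes b :: "('a::field, 'n::finite) sqmat"
  assumes nil: "\<And>k. b ^ k \<noteq> 0"
  obtains s a k c where "s = (\<Sum>k\<le>a. scl (c k) (b ^ k))" "(b * s) ^ Suc k * (b * s) ^ Suc k = (b * s) ^ Suc k" "(b * s) ^ Suc k \<noteq> 0" "b * s = s * b"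
proof -
  define D where "D = card (UNIV :: ('n \<times> 'n) set)"
  have "spanned_by UNIV 1 (UNIV :: 'a set)"
    unfolding spanned_by_def
  proof (rule exI[of _ "\<lambda>_::nat. 1::'a"], rule ballI)
    fix x :: 'a
    show "\<exists>f. (\<forall>l. f l \<in> UNIV) \<and> x = (\<Sum>l<1::nat. f l * 1)"
      by (rule exI[of _ "\<lambda>_::nat. x"]) simp
  qed
  from matrices_dependent[where M = "\<lambda>k. b ^ k" and D = D, OF sub_field_UNIV this] obtain c where
    c: "\<exists>k\<le>D. c k \<noteq> 0" "(\<Sum>k\<le>D. scl (c k) (b ^ k)) = 0"
    unfolding D_def by auto
  define a where "a = (LEAST k. c k \<noteq> 0)"
  have ca: "c a \<noteq> 0" unfolding a_def
  proof -
    obtain k where "c k \<noteq> 0" using c(1) by blast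
    then show "c (LEAST k. c k \<noteq> 0) \<noteq> 0" by (rule LeastI)
  qed
  have cl: "c k = 0" if "k < a" for k using not_less_Least[of k "\<lambda>k. c k \<noteq> 0"] that unfolding a_def by blast
  have aD: "a \<le> D" using c(1) cl by (metis le_trans not_le)
  define s where "s = (\<Sum>k\<le>D. scl (if k + Suc a \<le> D then - c (k + Suc a) / c a else 0) (b ^ k))"
  have bs: "b * s = s * b"
    by (simp add: s_def sum_distrib_left sum_distrib_right power_commutes)
  have "0 = (\<Sum>k\<in>{a..D}. scl (c k) (b ^ k))"
    unfolding c(2)[symmetric] by (intro sum.mono_neutral_right) (auto simp: cl)
  also have "\<dots> = scl (c a) (b ^ a) + (\<Sum>k\<in>{Suc a..D}. scl (c k) (b ^ k))"
    using aD by (simp add: sum.atLeast_Suc_atMost)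
  also have "(\<Sum>k\<in>{Suc a..D}. scl (c k) (b ^ k)) = (\<Sum>k\<in>{k. k + Suc a \<le> D}. scl (c (k + Suc a)) (b ^ (k + Suc a)))"
    by (rule sum.reindex_bij_witness[of _ "\<lambda>k. k + Suc a" "\<lambda>k. k - Suc a"]) auto
  also have "\<dots> = - scl (c a) (b ^ Suc a * s)"
  proof -
    have "scl (c a) (b ^ Suc a * s) = (\<Sum>k\<le>D. scl (c a * (if k + Suc a \<le> D then - c (k + Suc a) / c a else 0)) (b ^ (k + Suc a)))"
      by (simp add: s_def sum_distrib_left sqm.scale_sum_right add.commute flip: power_add power_Suc)
    also have "\<dots> = (\<Sum>k\<in>{k. k + Suc a \<le> D}. - scl (c (k + Suc a)) (b ^ (k + Suc a)))"
      using ca by (intro sum.mono_neutral_cong_right) auto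
    finally show ?thesis by (simp add: sum_negf)
  qed
  finally have "scl (c a) (b ^ a - b ^ Suc a * s) = 0" by (simp add: sqm.scale_right_diff_distrib)
  then have st: "b ^ a = b ^ Suc a * s" using ca by (simp only: scl_eq_0_iff) simp
  have p: "(b * s) ^ k = b ^ k * s ^ k" for k
  proof (induction k)
    case (Suc k)
    have "s * b ^ k = b ^ k * s"
      using power_commuting_commutes[OF bs] by simp
    then have "b * (s * b ^ k) * s ^ k = b * (b ^ k * s) * s ^ k"
      by simp
    then show ?case
      unfolding power_Suc Suc by (simp only: mult.assoc)
  qed simp
  have sb: "s ^ i * b ^ j = b ^ j * s ^ i" for i j
  proof -
    have "b ^ j * s = s * b ^ j" by (rule power_commuting_commutes[OF bs])
    then have "s * b ^ j = b ^ j * s" by simp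
    from power_commuting_commutes[OF this] show ?thesis .
  qed
  define e where "e = (b * s) ^ Suc a"
  have be: "b ^ Suc a * e = b ^ Suc a"
  proof -
    have "b ^ Suc a = b ^ Suc (Suc a) * s" using st by (metis mult.assoc power_Suc)
    from power_stable_mult[OF bs this, of "Suc a"] show ?thesis
      unfolding e_def p power_add mult.assoc by simp
  qed
  have "e * e = s ^ Suc a * (b ^ Suc a * e)"
    unfolding e_def p by (subst (1) sb[symmetric]) (simp only: mult.assoc)
  also have "\<dots> = e"
    unfolding be by (simp only: e_def p sb)
  finally have "e * e = e" .
  moreover have "e \<noteq> 0" using be nil[of "Suc a"] by auto
  ultimately show ?thesis by (intro that[OF s_def _ _ bs, of a]) (simp_all only: e_def not_False_eq_True)
qed

section \<open>Kolchin's theorem\<close>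

text \<open>The radical of the trace form of the algebra \<open>A\<close>.\<close>

definition trace_radical :: "('a::field, 'n::finite) sqmat set \<Rightarrow> ('a, 'n) sqmat set" where
  "trace_radical A = {b \<in> A. \<forall>a\<in>A. tr (a * b) = 0}"

lemma span_mult_closed:
  fixes V :: "('a::field, 'n::finite) sqmat set"
  assumes V: "\<And>x y. x \<in> V \<Longrightarrow> y \<in> V \<Longrightarrow> x * y \<in> V" and a: "a \<in> sqm.span V" and b: "b \<in> sqm.span V"
  shows "a * b \<in> sqm.span V"
proof -
  have 1: "x * b \<in> sqm.span V" if x: "x \<in> V" for x
    using b
  proof (induction rule: sqm.span_induct_alt)
    case base
    show ?case by (simp add: sqm.span_zero)
  next
    case (step c y z)
    then have "scl c (x * y) + x * z \<in> sqm.span V"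
      using V[OF x step(1)] by (intro sqm.span_add sqm.span_scale[OF sqm.span_base])
    then show ?case by (simp add: distrib_left)
  qed
  show ?thesis
    using a
  proof (induction rule: sqm.span_induct_alt)
    case base
    show ?case by (simp add: sqm.span_zero)
  next
    case (step c y z)
    then have "scl c (y * b) + z * b \<in> sqm.span V"
      using 1 by (intro sqm.span_add sqm.span_scale) auto
    then show ?case by (simp add: distrib_right)
  qed
qed

lemma tr_unipotent:
  fixes x :: "('a::field, 'n::finite) sqmat"
  assumes "(x - 1) ^ k = 0"
  shows "tr x = tr (1 :: ('a, 'n) sqmat)"
  using tr_nilpotent[OF assms] by simp

locale unipotent_semigroup =
  fixes V :: "('a::field, 'n::finite) sqmat set"
  assumes c0: "CHAR('a) = 0" and V1: "1 \<in> V" and Vm: "\<And>x y. x \<in> V \<Longrightarrow> y \<in> V \<Longrightarrow> x * y \<in> V"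
    and Vu: "\<And>x. x \<in> V \<Longrightarrow> \<exists>k. (x - 1) ^ k = 0"
begin

abbreviation alg where "alg \<equiv> sqm.span V"
abbreviation rad where "rad \<equiv> trace_radical alg"

lemma alg_mult: "a \<in> alg \<Longrightarrow> b \<in> alg \<Longrightarrow> a * b \<in> alg"
  by (rule span_mult_closed[OF Vm])

lemma alg_1: "1 \<in> alg" by (intro sqm.span_base V1)

text \<open>For \<open>y \<in> V\<close> both \<open>y x\<close> and \<open>y\<close> are unipotent, hence have the same trace.\<close>

lemma rad_V: assumes x: "x \<in> V" shows "x - 1 \<in> rad"
  unfolding trace_radical_def
proof (intro CollectI conjI ballI)
  show "x - 1 \<in> alg" using x V1 by (intro sqm.span_diff sqm.span_base)
  fix a assume "a \<in> alg"
  then show "tr (a * (x - 1)) = 0"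
  proof (induction rule: sqm.span_induct_alt)
    case base
    show ?case by simp
  next
    case (step c y z)
    have "tr (y * x) = tr y"
      using tr_unipotent Vu[OF Vm[OF step(1) x]] Vu[OF step(1)] by metis
    then show ?case using step(2) by (simp add: algebra_simps)
  qed
qed

lemma rad_left: assumes "a \<in> alg" "b \<in> rad" shows "a * b \<in> rad"
  using assms alg_mult unfolding trace_radical_def by (auto simp flip: mult.assoc)

lemma rad_right: assumes "a \<in> alg" "b \<in> rad" shows "b * a \<in> rad"
proof -
  have "tr (c * (b * a)) = 0" if c: "c \<in> alg" for c
  proof -
    have "tr (c * (b * a)) = tr (a * c * b)" using tr_commute[of "c * b" a] by (simp add: mult.assoc)
    also have "\<dots> = 0" using alg_mult[OF assms(1) c] assms(2) by (simp add: trace_radical_def)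
    finally show ?thesis .
  qed
  then show ?thesis using assms alg_mult unfolding trace_radical_def by auto
qed

lemma rad_subspace: "sqm.subspace rad"
  unfolding sqm.subspace_def trace_radical_def
  by (auto intro: sqm.span_zero sqm.span_add sqm.span_scale simp: distrib_left)

lemma rad_alg: "b \<in> rad \<Longrightarrow> b \<in> alg" by (simp add: trace_radical_def)

text \<open>Otherwise the radical would contain a nonzero idempotent, whose trace is not 0.\<close>

lemma rad_nil: assumes b: "b \<in> rad" shows "\<exists>k. b ^ k = 0"
proof (rule ccontr)
  assume "\<nexists>k. b ^ k = 0"
  then have nil: "\<And>k. b ^ k \<noteq> 0" by blast
  obtain s a k c where s: "s = (\<Sum>k\<le>a. scl (c k) (b ^ k))" "(b * s) ^ Suc k * (b * s) ^ Suc k = (b * s) ^ Suc k"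
      "(b * s) ^ Suc k \<noteq> 0" "b * s = s * b"
    using idempotent_multiple[OF nil] .
  have "b ^ k \<in> alg" for k by (induction k) (auto intro: alg_1 alg_mult rad_alg b)
  then have "s \<in> alg" unfolding s(1) by (intro sqm.span_sum sqm.span_scale)
  then have bs: "b * s \<in> rad" using b by (rule rad_right)
  have "(b * s) ^ Suc k \<in> rad" for k
    by (induction k) (auto intro: bs rad_left[OF rad_alg[OF bs]])
  then have "tr (1 * (b * s) ^ Suc k) = 0" using alg_1 unfolding trace_radical_def by blast
  then show False using tr_idempotent_nonzero[OF c0 s(2,3)] by simp
qed

text \<open>Choose \<open>v\<close> outside \<open>W\<close> for which the subspace \<open>rad v + W\<close> is as small as possible. If \<open>a v\<close> were outside \<open>W\<close> for some \<open>a\<close> in the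
  radical, minimality would give \<open>rad a v + W = rad v + W\<close>, so \<open>a v = b a v\<close> modulo \<open>W\<close> for some \<open>b\<close> in the radical; since \<open>b\<close> is
  nilpotent, iteration gives \<open>a v \<in> W\<close>.\<close>

lemma common_kernel_vector:
  assumes W: "vec.subspace W" "\<And>b v. b \<in> rad \<Longrightarrow> v \<in> W \<Longrightarrow> act b v \<in> W" "W \<noteq> UNIV"
  obtains v where "v \<notin> W" "\<And>b. b \<in> rad \<Longrightarrow> act b v \<in> W"
proof -
  define S where "S v = {act b v + w |b w. b \<in> rad \<and> w \<in> W}" for v
  have subS: "vec.subspace (S v)" for v
  proof (rule vec.subspaceI)
    show "0 \<in> S v" unfolding S_def
      using sqm.subspace_0[OF rad_subspace] vec.subspace_0[OF W(1)] by (force intro: exI[of _ 0])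
    fix x y assume "x \<in> S v" "y \<in> S v"
    then obtain b w b' w' where h: "b \<in> rad" "w \<in> W" "b' \<in> rad" "w' \<in> W" "x = act b v + w" "y = act b' v + w'"
      unfolding S_def by blast
    then have "x + y = act (b + b') v + (w + w')" by simp
    moreover have "b + b' \<in> rad" "w + w' \<in> W"
      using h sqm.subspace_add[OF rad_subspace] vec.subspace_add[OF W(1)] by auto
    ultimately show "x + y \<in> S v" unfolding S_def by blast
  next
    fix c x assume "x \<in> S v"
    then obtain b w where h: "b \<in> rad" "w \<in> W" "x = act b v + w" unfolding S_def by blast
    then have "c *s x = act (scl c b) v + c *s w" by (simp add: vec.scale_right_distrib)
    moreover have "scl c b \<in> rad" "c *s w \<in> W"
      using h sqm.subspace_scale[OF rad_subspace] vec.subspace_scale[OF W(1)] by auto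
    ultimately show "c *s x \<in> S v" unfolding S_def by blast
  qed
  obtain v0 where "v0 \<notin> W" using W(3) by auto
  then obtain v where v: "v \<notin> W" "\<And>u. u \<notin> W \<Longrightarrow> vec.dim (S v) \<le> vec.dim (S u)"
    using ex_has_least_nat[of "\<lambda>v. v \<notin> W" v0 "\<lambda>v. vec.dim (S v)"] by blast
  have "act a v \<in> W" if a: "a \<in> rad" for a
  proof (rule ccontr)
    assume n: "act a v \<notin> W"
    have "S (act a v) \<subseteq> S v"
    proof
      fix x assume "x \<in> S (act a v)"
      then obtain b w where h: "b \<in> rad" "w \<in> W" "x = act b (act a v) + w" unfolding S_def by blast
      then have "x = act (b * a) v + w" by simp
      moreover have "b * a \<in> rad" using h a by (intro rad_left rad_alg)
      ultimately show "x \<in> S v" using h(2) unfolding S_def by blast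
    qed
    then have "S (act a v) = S v"
      using v(2)[OF n] subS by (intro vec.subspace_dim_equal)
    moreover have "act a v \<in> S v"
      using a vec.subspace_0[OF W(1)] unfolding S_def by force
    ultimately obtain b w where bw: "b \<in> rad" "w \<in> W" "act a v = act b (act a v) + w"
      unfolding S_def by blast
    define u where "u = act a v"
    have u: "u = act b u + w" using bw(3) by (simp add: u_def)
    have "\<exists>w\<in>W. u = act (b ^ k) u + w" for k
    proof (induction k)
      case 0
      show ?case by (rule bexI[of _ 0]) (auto simp: vec.subspace_0[OF W(1)])
    next
      case (Suc k)
      then obtain w' where w': "w' \<in> W" "u = act (b ^ k) u + w'" by blast
      have "act b u = act b (act (b ^ k) u + w')" using w'(2) by simp
      then have "u = act (b ^ Suc k) u + (act b w' + w)" using u by (simp add: add.assoc)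
      moreover have "act b w' + w \<in> W" using W(2)[OF bw(1) w'(1)] bw(2) vec.subspace_add[OF W(1)] by blast
      ultimately show ?case by blast
    qed
    moreover obtain k where "b ^ k = 0" using rad_nil[OF bw(1)] by blast
    ultimately obtain w' where "w' \<in> W" "u = act 0 u + w'" by metis
    then show False using n by (simp add: u_def)
  qed
  then show ?thesis using v(1) that by blast
qed

primrec flag :: "nat \<Rightarrow> ('a^'n) set" where
  "flag 0 = {0}"
| "flag (Suc k) = {v. \<forall>b\<in>rad. act b v \<in> flag k}"

lemma flag_subspace: "vec.subspace (flag k)"
  by (induction k) (auto simp: vec.subspace_def)

lemma flag_Suc: "flag k \<subseteq> flag (Suc k)"
  by (induction k) auto

lemma flag_mono: "i \<le> k \<Longrightarrow> flag i \<subseteq> flag k"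
  using flag_Suc by (rule lift_Suc_mono_le)

lemma flag_full: "\<exists>c. flag c = UNIV"
proof -
  have "flag k = UNIV \<or> k \<le> vec.dim (flag k)" for k
  proof (induction k)
    case (Suc k)
    show ?case
    proof (cases "flag k = UNIV")
      case True
      then show ?thesis using flag_Suc[of k] by blast
    next
      case False
      have "act b v \<in> flag k" if "b \<in> rad" "v \<in> flag k" for b v
        using flag_Suc[of k] that by auto
      from common_kernel_vector[OF flag_subspace this False] obtain v where
        "v \<notin> flag k" "\<And>b. b \<in> rad \<Longrightarrow> act b v \<in> flag k" by blast
      then have "flag k \<subset> flag (Suc k)" using flag_Suc[of k] by auto
      then have "vec.dim (flag k) < vec.dim (flag (Suc k))"
        using vec.dim_psubset[of "flag k" "flag (Suc k)"] flag_subspace by (metis vec.span_eq_iff)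
      then show ?thesis using Suc False by simp
    qed
  qed simp
  then have "flag (Suc (vec.dim (UNIV :: ('a^'n) set))) = UNIV"
    using vec.dim_subset[OF subset_UNIV] by (metis Suc_n_not_le_n le_trans)
  then show ?thesis by blast
qed

text \<open>The ideal \<open>J i\<close> consists of the matrices that lower the flag by \<open>i\<close> steps. Truncated subtraction of indices is harmless because
  \<open>flag 0\<close> is zero.\<close>

lemma kolchin_filtration:
  "\<exists>J c. (\<forall>i. sqm.subspace (J i)) \<and> (\<forall>i j. \<forall>a\<in>J i. \<forall>b\<in>J j. a * b \<in> J (i + j)) \<and>
      (\<forall>i. J (Suc i) \<subseteq> J i) \<and> J c = {0} \<and> 1 \<in> J 0 \<and> (\<forall>x\<in>V. x - 1 \<in> J (Suc 0))"
proof -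
  obtain c where c: "flag c = UNIV" using flag_full by blast
  define J where "J i = {A :: ('a, 'n) sqmat. \<forall>k. \<forall>v\<in>flag k. act A v \<in> flag (k - i)}" for i
  have J1: "sqm.subspace (J i)" for i
    unfolding sqm.subspace_def J_def
    using vec.subspace_0[OF flag_subspace] vec.subspace_add[OF flag_subspace] vec.subspace_scale[OF flag_subspace] by auto
  have J2: "a * b \<in> J (i + j)" if ab: "a \<in> J i" "b \<in> J j" for a b i j
  proof -
    have "act (a * b) v \<in> flag (k - (i + j))" if v: "v \<in> flag k" for k v
    proof -
      have "act b v \<in> flag (k - j)" using v ab(2) unfolding J_def by blast
      then have "act a (act b v) \<in> flag (k - j - i)" using ab(1) unfolding J_def by blast
      then show ?thesis by (simp add: add.commute)
    qed
    then show ?thesis by (simp add: J_def)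
  qed
  have J3: "J (Suc i) \<subseteq> J i" for i
  proof
    fix A assume A: "A \<in> J (Suc i)"
    have "act A v \<in> flag (k - i)" if v: "v \<in> flag k" for k v
    proof -
      have "act A v \<in> flag (k - Suc i)" using A v unfolding J_def by blast
      moreover have "k - Suc i \<le> k - i" by simp
      ultimately show ?thesis using flag_mono by blast
    qed
    then show "A \<in> J i" by (simp add: J_def)
  qed
  have J4: "J c = {0}"
  proof -
    have "A = 0" if A: "A \<in> J c" for A
    proof (rule act_eqI)
      fix v :: "'a^'n"
      have "act A v \<in> flag (c - c)" using A c unfolding J_def by blast
      then show "act A v = act 0 v" by simp
    qed
    moreover have "0 \<in> J c" using vec.subspace_0[OF flag_subspace] by (auto simp: J_def)
    ultimately show ?thesis by blast
  qed
  have J5: "1 \<in> J 0" by (simp add: J_def)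
  have J6: "x - 1 \<in> J (Suc 0)" if x: "x \<in> V" for x
  proof -
    have "act (x - 1) v \<in> flag (k - Suc 0)" if "v \<in> flag k" for k v
      using that rad_V[OF x] by (cases k) (auto simp del: act_simps(5))
    then show ?thesis by (simp add: J_def del: act_simps(5))
  qed
  show ?thesis
    by (intro exI[of _ J] exI[of _ c] conjI allI ballI J1 J2 J3 J4 J5 J6)
qed

end

section \<open>Polynomial families in groups closed under powers\<close>

text \<open>If \<open>P n\<close> denotes the sum, then \<open>P (2 n) - 2\<^sup>d P n\<close> lies in \<open>S\<close> as well, and here the leading coefficient is gone while the \<open>k\<close>-th
  one is multiplied by the nonzero number \<open>2\<^sup>k - 2\<^sup>d\<close>.\<close>

lemma coefficients_in_subspace:
  fixes S :: "('a::field, 'n::finite) sqmat set"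
  assumes c0: "CHAR('a) = 0" and L: "sub_field L"
    and S: "\<And>x y. x \<in> S \<Longrightarrow> y \<in> S \<Longrightarrow> x + y \<in> S" "\<And>c x. c \<in> L \<Longrightarrow> x \<in> S \<Longrightarrow> scl c x \<in> S"
    and vals: "\<And>n. (\<Sum>k\<le>d. scl (of_nat n ^ k) (C k)) \<in> S" and k: "k \<le> d"
  shows "C k \<in> S"
  using vals k
proof (induction d arbitrary: C k)
  case 0
  then show ?case using 0(1)[of 0] by simp
next
  case (Suc d)
  note LD = sub_fieldD[OF L]
  have diff: "x - y \<in> S" if "x \<in> S" "y \<in> S" for x y
    using S(1)[OF that(1) S(2)[OF LD(6)[OF LD(2)] that(2)]] by simp
  have low: "C k \<in> S" if k: "k \<le> d" for k
  proof -
    define C' where "C' k = scl (of_nat (2 ^ k) - of_nat (2 ^ Suc d)) (C k)" for k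
    have "(\<Sum>k\<le>d. scl (of_nat n ^ k) (C' k)) \<in> S" for n
    proof -
      have "(\<Sum>k\<le>Suc d. scl (of_nat (2 * n) ^ k) (C k)) - scl (of_nat (2 ^ Suc d)) (\<Sum>k\<le>Suc d. scl (of_nat n ^ k) (C k))
        = (\<Sum>k\<le>Suc d. scl (of_nat n ^ k) (C' k))"
        unfolding C'_def sqm.scale_sum_right sum_subtractf[symmetric] sqm.scale_scale sqm.scale_left_diff_distrib[symmetric]
        by (intro sum.cong refl arg_cong2[where f = scl]) (simp add: power_mult_distrib algebra_simps)
      also have "\<dots> = (\<Sum>k\<le>d. scl (of_nat n ^ k) (C' k))" by (simp add: C'_def)
      finally have e: "(\<Sum>k\<le>d. scl (of_nat n ^ k) (C' k)) = (\<Sum>k\<le>Suc d. scl (of_nat (2 * n) ^ k) (C k))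
          - scl (of_nat (2 ^ Suc d)) (\<Sum>k\<le>Suc d. scl (of_nat n ^ k) (C k))" ..
      show ?thesis unfolding e by (intro diff S(2)[OF LD(10)] Suc(2))
    qed
    then have "C' k \<in> S" using Suc.IH k by blast
    moreover have "(of_nat (2 ^ k) - of_nat (2 ^ Suc d) :: 'a) \<noteq> 0"
      using of_nat_inject_CHAR_0[OF c0, of "2 ^ k" "2 ^ Suc d"] k
      by (metis Suc_n_not_le_n eq_iff_diff_eq_0 one_less_numeral_iff power_inject_exp semiring_norm(76))
    ultimately have "C k = scl (inverse (of_nat (2 ^ k) - of_nat (2 ^ Suc d))) (C' k)"
      by (simp add: C'_def)
    moreover have "inverse (of_nat (2 ^ k) - of_nat (2 ^ Suc d)) \<in> L"
      by (intro LD(5,3,10))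
    ultimately show ?thesis using S(2) \<open>C' k \<in> S\<close> by metis
  qed
  show ?case
  proof (cases "k \<le> d")
    case True
    then show ?thesis by (rule low)
  next
    case False
    have sumS: "(\<Sum>k\<le>i. C k) \<in> S" if "i \<le> d" for i
      using that by (induction i) (auto intro: low S(1))
    have "(\<Sum>k\<le>Suc d. C k) \<in> S" using Suc(2)[of 1] by simp
    then have "C (Suc d) \<in> S" using diff[OF _ sumS[of d]] by force
    then show ?thesis using False Suc(3) by (metis le_SucE)
  qed
qed

text \<open>The filtration of \<open>V\<close> is described by the subspaces \<open>J i\<close>. The bound \<open>N\<close> serves at the same time as the length of
  the filtration and as the cut-off for powers.\<close>

locale unipotent_filtration =
  fixes V :: "('l::field, 'm::finite) sqmat set" and L :: "'l set" and J :: "nat \<Rightarrow> ('l, 'm) sqmat set" and N :: nat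
  assumes c0: "CHAR('l) = 0" and L: "sub_field L"
    and V1: "1 \<in> V" and Vm: "\<And>x y. x \<in> V \<Longrightarrow> y \<in> V \<Longrightarrow> x * y \<in> V"
    and Vpw: "\<And>x t. x \<in> V \<Longrightarrow> t \<in> L \<Longrightarrow> pw N x t \<in> V"
    and Jsub: "\<And>i. sqm.subspace (J i)" and Jmult: "\<And>i j a b. a \<in> J i \<Longrightarrow> b \<in> J j \<Longrightarrow> a * b \<in> J (i + j)"
    and Jdec: "\<And>i. J (Suc i) \<subseteq> J i" and JN: "J N = {0}" and J0: "1 \<in> J 0"
    and VJ: "\<And>x. x \<in> V \<Longrightarrow> x - 1 \<in> J 1"
begin

lemmas LD = sub_fieldD[OF L]
lemmas Jadd = sqm.subspace_add[OF Jsub] and Jdiff = sqm.subspace_diff[OF Jsub]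
  and Jscl = sqm.subspace_scale[OF Jsub] and J_0 = sqm.subspace_0[OF Jsub] and Jsum = sqm.subspace_sum[OF Jsub]

lemma Jmono: "i \<le> j \<Longrightarrow> J j \<subseteq> J i"
  by (induction j rule: dec_induct) (use Jdec in auto)

lemma Jpower: "a \<in> J i \<Longrightarrow> a ^ k \<in> J (k * i)"
  by (induction k) (use J0 Jmult in auto)

lemma VJ0: "x \<in> V \<Longrightarrow> x \<in> J 0"
  using Jadd[OF subsetD[OF Jmono VJ] J0, of x] by simp

lemma uni: assumes "x \<in> V" shows "(x - 1) ^ N = 0"
  using Jpower[OF VJ[OF assms], of N] JN by auto

lemmas pnat = pw_of_nat[OF c0 uni] and padd = pw_add[OF c0 uni] and pone = pw_1[OF c0 uni]

lemma ppw: "x \<in> V \<Longrightarrow> s \<in> L \<Longrightarrow> pw N (pw N x s) t = pw N x (s * t)"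
  by (rule pw_pw[OF c0 uni uni[OF Vpw]])

definition vinv :: "('l, 'm) sqmat \<Rightarrow> ('l, 'm) sqmat" where "vinv x = pw N x (- 1)"

lemma vinv_V: "x \<in> V \<Longrightarrow> vinv x \<in> V" unfolding vinv_def by (intro Vpw LD(6,2))

lemma vinv_mult: assumes x: "x \<in> V" shows "vinv x * x = 1" "x * vinv x = 1"
  using pw_inverse[OF c0 uni[OF x], of 1] pone[OF x] by (simp_all add: vinv_def)

lemma vinv_assoc: assumes x: "x \<in> V" shows "vinv x * (x * y) = y" "x * (vinv x * y) = y"
  using vinv_mult[OF x] by (simp_all flip: mult.assoc)

definition Vr :: "nat \<Rightarrow> ('l, 'm) sqmat set" where "Vr r = {x \<in> V. x - 1 \<in> J r}"

lemma Vr_V: "x \<in> Vr r \<Longrightarrow> x \<in> V" by (simp add: Vr_def)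
lemma Vr_1: "Vr 1 = V" using VJ by (auto simp: Vr_def)
lemma one_Vr: "1 \<in> Vr r" using V1 J_0 by (simp add: Vr_def)
lemma Vr_mono: "i \<le> j \<Longrightarrow> Vr j \<subseteq> Vr i" using Jmono by (auto simp: Vr_def)
lemma Vr_N: assumes "r \<ge> N" "x \<in> Vr r" shows "x = 1"
  using subsetD[OF Vr_mono[OF assms(1)] assms(2)] JN by (auto simp: Vr_def)

text \<open>Modulo the next step of the filtration multiplication becomes addition of \<open>x - 1\<close> and \<open>y - 1\<close>.\<close>

lemma prod_lead:
  assumes r: "r \<ge> 1" and xy: "x \<in> Vr r" "y \<in> Vr r"
  shows "(x * y - 1) - ((x - 1) + (y - 1)) \<in> J (Suc r)"
proof -
  have "(x - 1) * (y - 1) \<in> J (r + r)" using xy by (intro Jmult) (auto simp: Vr_def)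
  then have "(x - 1) * (y - 1) \<in> J (Suc r)" using Jmono[of "Suc r" "r + r"] r by auto
  moreover have "(x * y - 1) - ((x - 1) + (y - 1)) = (x - 1) * (y - 1)" by (simp add: algebra_simps)
  ultimately show ?thesis by simp
qed

lemma Vr_mult: assumes r: "r \<ge> 1" and xy: "x \<in> Vr r" "y \<in> Vr r" shows "x * y \<in> Vr r"
proof -
  have "(x * y - 1) - ((x - 1) + (y - 1)) \<in> J r" using prod_lead[OF assms] Jdec by blast
  from Jadd[OF this Jadd[of "x - 1" r "y - 1"]] show ?thesis
    using xy by (simp add: Vr_def Vm)
qed

lemma pw_lead:
  assumes r: "r \<ge> 1" and x: "x \<in> Vr r"
  shows "(pw N x t - 1) - scl t (x - 1) \<in> J (Suc r)"
proof -
  have z: "(x - 1) ^ k = 0" if "k \<ge> N" for k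
    using uni[OF Vr_V[OF x]] that by (metis le_add_diff_inverse mult_zero_left power_add)
  have "pw N x t = (\<Sum>k<Suc (Suc N). scl (binom t k) ((x - 1) ^ k))"
    unfolding pw_def by (intro sum.mono_neutral_left) (auto simp: z)
  also have "\<dots> = 1 + scl t (x - 1) + (\<Sum>k<N. scl (binom t (Suc (Suc k))) ((x - 1) ^ Suc (Suc k)))"
    unfolding sum.lessThan_Suc_shift by (simp add: add.assoc)
  finally have e: "(pw N x t - 1) - scl t (x - 1) = (\<Sum>k<N. scl (binom t (Suc (Suc k))) ((x - 1) ^ Suc (Suc k)))"
    by simp
  have "(x - 1) ^ Suc (Suc k) \<in> J (Suc r)" for k
  proof -
    have "(x - 1) ^ Suc (Suc k) \<in> J (Suc (Suc k) * r)" using x by (intro Jpower) (simp add: Vr_def)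
    moreover have "Suc r \<le> Suc (Suc k) * r" using r by (simp add: trans_le_add1)
    ultimately show ?thesis using Jmono by blast
  qed
  then show ?thesis unfolding e by (intro Jsum Jscl)
qed

lemma Vr_pw: assumes r: "r \<ge> 1" and x: "x \<in> Vr r" and t: "t \<in> L" shows "pw N x t \<in> Vr r"
proof -
  have "(pw N x t - 1) - scl t (x - 1) \<in> J r" using pw_lead[OF r x] Jdec by blast
  from Jadd[OF this Jscl[of "x - 1" r t]] show ?thesis
    using x Vpw[OF _ t] by (simp add: Vr_def)
qed

definition gcomm :: "('l, 'm) sqmat \<Rightarrow> ('l, 'm) sqmat \<Rightarrow> ('l, 'm) sqmat" where
  "gcomm x y = vinv x * vinv y * x * y"

lemma gcomm_V: "x \<in> V \<Longrightarrow> y \<in> V \<Longrightarrow> gcomm x y \<in> V"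
  unfolding gcomm_def by (intro Vm vinv_V)

lemma gcomm_eq: assumes "x \<in> V" "y \<in> V" shows "x * y = y * x * gcomm x y"
  unfolding gcomm_def by (simp add: mult.assoc vinv_assoc assms)

lemma gcomm_Vr: assumes "x \<in> Vr i" "y \<in> Vr j" shows "gcomm x y \<in> Vr (i + j)"
proof -
  have V: "x \<in> V" "y \<in> V" using assms Vr_V by auto
  have "(x - 1) * (y - 1) \<in> J (i + j)" "(y - 1) * (x - 1) \<in> J (j + i)"
    using assms by (auto simp: Vr_def intro: Jmult)
  then have "(x - 1) * (y - 1) - (y - 1) * (x - 1) \<in> J (i + j)"
    by (intro Jdiff) (simp_all add: add.commute)
  then have "vinv x * vinv y * ((x - 1) * (y - 1) - (y - 1) * (x - 1)) \<in> J (0 + 0 + (i + j))"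
    by (intro Jmult VJ0 vinv_V V)
  moreover have "gcomm x y - 1 = vinv x * vinv y * ((x - 1) * (y - 1) - (y - 1) * (x - 1))"
  proof -
    have "vinv x * vinv y * ((x - 1) * (y - 1) - (y - 1) * (x - 1)) = vinv x * vinv y * (x * y) - vinv x * vinv y * (y * x)"
      by (simp add: algebra_simps)
    also have "\<dots> = gcomm x y - 1"
      unfolding gcomm_def by (simp add: mult.assoc vinv_assoc vinv_mult V)
    finally show ?thesis ..
  qed
  ultimately show ?thesis using gcomm_V[OF V] by (simp add: Vr_def)
qed

text \<open>Inverses are included as powers with exponent \<open>-1\<close>.\<close>

definition pow_closed :: "('l, 'm) sqmat set \<Rightarrow> bool" where
  "pow_closed D \<longleftrightarrow> D \<subseteq> V \<and> 1 \<in> D \<and> (\<forall>x\<in>D. \<forall>y\<in>D. x * y \<in> D) \<and> (\<forall>x\<in>D. \<forall>t\<in>L. pw N x t \<in> D)"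

lemma pow_closedD:
  assumes "pow_closed D"
  shows "D \<subseteq> V" "x \<in> D \<Longrightarrow> x \<in> V" "1 \<in> D" "x \<in> D \<Longrightarrow> y \<in> D \<Longrightarrow> x * y \<in> D" "x \<in> D \<Longrightarrow> t \<in> L \<Longrightarrow> pw N x t \<in> D"
    "x \<in> D \<Longrightarrow> vinv x \<in> D"
  using assms LD(6)[OF LD(2)] by (auto simp: pow_closed_def vinv_def)

text \<open>The naturals are dense in \<open>L\<close> as far as membership in \<open>D\<close> is concerned. If the family takes values in \<open>V\<^sub>r\<close>, its leading part \<open>ev t M - 1\<close>
  modulo \<open>J (r + 1)\<close> is a polynomial in \<open>t\<close>. For natural \<open>t\<close> its values lie in the image \<open>S\<close> of \<open>D \<inter> V\<^sub>r\<close>, which is closed under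
  addition and scaling by \<open>L\<close> since \<open>D\<close> is closed under products and powers. Hence the coefficients lie in \<open>S\<close>. So there is a polynomial family \<open>R\<close> in
  \<open>D \<inter> V\<^sub>r\<close>, a product of powers \<open>pw N g (t ^ k)\<close>, with the opposite leading part, and \<open>R M\<close> takes values in \<open>V\<^sub>r\<^sub>+\<^sub>1\<close>.\<close>

lemma polynomial_path_in_closed:
  assumes D: "pow_closed D" and r: "r \<ge> 1"
    and M: "\<And>t. t \<in> L \<Longrightarrow> ev t M \<in> Vr r" "\<And>n. ev (of_nat n) M \<in> D" and t: "t \<in> L"
  shows "ev t M \<in> D"
  using r M t
proof (induction "N - r" arbitrary: r M t rule: less_induct)
  case less
  show ?case
  proof (cases "r \<ge> N")
    case True
    then have "ev t M = 1" using Vr_N less by blast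
    then show ?thesis using pow_closedD(3)[OF D] by simp
  next
    case False
    define S where "S = {z. \<exists>g\<in>D. g \<in> Vr r \<and> (g - 1) - z \<in> J (Suc r)}"
    have Sadd: "x + y \<in> S" if xy: "x \<in> S" "y \<in> S" for x y
    proof -
      obtain g h where gh: "g \<in> D" "g \<in> Vr r" "(g - 1) - x \<in> J (Suc r)" "h \<in> D" "h \<in> Vr r" "(h - 1) - y \<in> J (Suc r)"
        using xy unfolding S_def by blast
      have "(g * h - 1) - (x + y) = ((g * h - 1) - ((g - 1) + (h - 1))) + (((g - 1) - x) + ((h - 1) - y))"
        by simp
      also have "\<dots> \<in> J (Suc r)" using gh less.prems(1) by (intro Jadd prod_lead)
      finally show ?thesis using gh pow_closedD(4)[OF D gh(1,4)] Vr_mult[OF less.prems(1) gh(2,5)] unfolding S_def by blast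
    qed
    have Sscl: "scl c x \<in> S" if cx: "c \<in> L" "x \<in> S" for c x
    proof -
      obtain g where g: "g \<in> D" "g \<in> Vr r" "(g - 1) - x \<in> J (Suc r)" using cx unfolding S_def by blast
      have "(pw N g c - 1) - scl c x = ((pw N g c - 1) - scl c (g - 1)) + scl c ((g - 1) - x)"
        by (simp add: sqm.scale_right_diff_distrib)
      also have "\<dots> \<in> J (Suc r)" using g less.prems(1) by (intro Jadd pw_lead Jscl)
      finally show ?thesis using pow_closedD(5)[OF D g(1) cx(1)] Vr_pw[OF less.prems(1) g(2) cx(1)] unfolding S_def by blast
    qed
    obtain d where d: "\<And>t. ev t M = (\<Sum>k\<le>d. scl (t ^ k) (cf k M))"
      by (rule ev_expand[of M]) blast
    define C where "C k = cf k M - (if k = 0 then 1 else 0)" for k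
    have Csum: "(\<Sum>k\<le>d. scl (t ^ k) (C k)) = ev t M - 1" for t
    proof -
      have "(\<Sum>k\<le>d. scl (t ^ k) (C k)) = ev t M - (\<Sum>k\<le>d. scl (t ^ k) (if k = 0 then 1 else 0))"
        unfolding C_def d by (simp add: sqm.scale_right_diff_distrib sum_subtractf)
      also have "(\<Sum>k\<le>d. scl (t ^ k) (if k = 0 then 1 else 0)) = (\<Sum>k\<in>{0}. scl (t ^ k) (1 :: ('l, 'm) sqmat))"
        by (rule sum.mono_neutral_cong_right) auto
      finally show ?thesis by simp
    qed
    have "(\<Sum>k\<le>d. scl (of_nat n ^ k) (C k)) \<in> S" for n
      unfolding Csum S_def using less.prems(3)[of n] less.prems(2)[OF LD(10)[of n]] J_0 by force
    then have CS: "C k \<in> S" if "k \<le> d" for k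
      using coefficients_in_subspace[OF c0 L Sadd Sscl _ that] by blast
    have "\<exists>R. \<forall>t\<in>L. ev t R \<in> D \<and> ev t R \<in> Vr r \<and> (ev t R - 1) + (\<Sum>k\<le>i. scl (t ^ k) (C k)) \<in> J (Suc r)" if "i \<le> d" for i
      using that
    proof (induction i)
      case 0
      have "scl (-1) (C 0) \<in> S" by (intro Sscl CS LD(6,2)) simp
      then obtain g where g: "g \<in> D" "g \<in> Vr r" "(g - 1) - scl (-1) (C 0) \<in> J (Suc r)" unfolding S_def by blast
      then show ?case by (intro exI[of _ "cst g"]) simp
    next
      case (Suc i)
      then obtain R where R: "\<forall>t\<in>L. ev t R \<in> D \<and> ev t R \<in> Vr r \<and> (ev t R - 1) + (\<Sum>k\<le>i. scl (t ^ k) (C k)) \<in> J (Suc r)" by auto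
      have "scl (-1) (C (Suc i)) \<in> S" using Suc.prems by (intro Sscl CS LD(6,2)) simp
      then obtain g where g: "g \<in> D" "g \<in> Vr r" "(g - 1) - scl (-1) (C (Suc i)) \<in> J (Suc r)" unfolding S_def by blast
      define Q where "Q = R * pc (Pw N g) (Polynomial.monom 1 (Suc i))"
      have evQ: "ev t Q = ev t R * pw N g (t ^ Suc i)" for t
        by (simp add: Q_def poly_monom del: power_Suc)
      have "ev t Q \<in> D \<and> ev t Q \<in> Vr r \<and> (ev t Q - 1) + (\<Sum>k\<le>Suc i. scl (t ^ k) (C k)) \<in> J (Suc r)" if t: "t \<in> L" for t
      proof -
        define a where "a = ev t R"
        define p where "p = t ^ Suc i"
        have p: "p \<in> L" unfolding p_def by (intro LD t)
        have a: "a \<in> D" "a \<in> Vr r" "(a - 1) + (\<Sum>k\<le>i. scl (t ^ k) (C k)) \<in> J (Suc r)"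
          using R t by (auto simp: a_def)
        have b: "pw N g p \<in> D" "pw N g p \<in> Vr r"
          using pow_closedD(5)[OF D g(1) p] Vr_pw[OF less.prems(1) g(2) p] by auto
        have "(a * pw N g p - 1) + (\<Sum>k\<le>Suc i. scl (t ^ k) (C k))
          = ((a * pw N g p - 1) - ((a - 1) + (pw N g p - 1))) + (((a - 1) + (\<Sum>k\<le>i. scl (t ^ k) (C k)))
           + (((pw N g p - 1) - scl p (g - 1)) + scl p ((g - 1) - scl (-1) (C (Suc i)))))"
          by (simp add: p_def sqm.scale_right_diff_distrib algebra_simps del: power_Suc)
        also have "\<dots> \<in> J (Suc r)"
          using b g less.prems(1) by (intro Jadd[OF prod_lead] Jadd[OF a(3)] Jadd[OF pw_lead] Jscl a)
        finally show ?thesis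
          using pow_closedD(4)[OF D a(1) b(1)] Vr_mult[OF less.prems(1) a(2) b(2)] unfolding evQ a_def[symmetric] p_def[symmetric] by blast
      qed
      then show ?case by blast
    qed
    from this[of d] obtain R where R: "\<And>t. t \<in> L \<Longrightarrow> ev t R \<in> D" "\<And>t. t \<in> L \<Longrightarrow> ev t R \<in> Vr r"
       "\<And>t. t \<in> L \<Longrightarrow> (ev t R - 1) + (ev t M - 1) \<in> J (Suc r)" unfolding Csum by auto
    have "ev t (R * M) \<in> D"
    proof (rule less.hyps)
      show "N - Suc r < N - r" using False by simp
      show "1 \<le> Suc r" by simp
      show "ev t (R * M) \<in> Vr (Suc r)" if t: "t \<in> L" for t
      proof -
        have "ev t (R * M) - 1 = ((ev t R * ev t M - 1) - ((ev t R - 1) + (ev t M - 1))) + ((ev t R - 1) + (ev t M - 1))"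
          by simp
        also have "\<dots> \<in> J (Suc r)" using R(2)[OF t] less.prems(1,2) t by (intro Jadd[OF prod_lead] R(3))
        finally show ?thesis using Vm[OF Vr_V[OF R(2)[OF t]] Vr_V[OF less.prems(2)[OF t]]] by (simp add: Vr_def)
      qed
      show "ev (of_nat n) (R * M) \<in> D" for n
        using pow_closedD(4)[OF D R(1)[OF LD(10)] less.prems(3)] by simp
      show "t \<in> L" by fact
    qed
    then have "vinv (ev t R) * ev t (R * M) \<in> D"
      using pow_closedD(4,6)[OF D] R(1) less.prems(4) by blast
    then show ?thesis
      using vinv_assoc(1)[OF Vr_V[OF R(2)[OF less.prems(4)]]] by simp
  qed
qed

definition pow_closed_normal :: "('l, 'm) sqmat set \<Rightarrow> bool" where
  "pow_closed_normal D \<longleftrightarrow> pow_closed D \<and> (\<forall>x\<in>V. \<forall>g\<in>D. vinv x * g * x \<in> D)"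

text \<open>Congruence modulo \<open>D\<close>; for \<open>D\<close> normal in \<open>V\<close> it is compatible with products.\<close>

definition eq_mod :: "('l, 'm) sqmat set \<Rightarrow> ('l, 'm) sqmat \<Rightarrow> ('l, 'm) sqmat \<Rightarrow> bool" where
  "eq_mod D a b \<longleftrightarrow> (\<exists>g\<in>D. a = b * g)"

lemma eq_mod_refl: "pow_closed_normal D \<Longrightarrow> eq_mod D a a"
  unfolding eq_mod_def pow_closed_normal_def by (rule bexI[of _ 1]) (auto simp: pow_closedD)

lemma eq_mod_trans: "pow_closed_normal D \<Longrightarrow> eq_mod D a b \<Longrightarrow> eq_mod D b c \<Longrightarrow> eq_mod D a c"
  unfolding eq_mod_def pow_closed_normal_def by (metis pow_closedD(4) mult.assoc)

lemma eq_mod_mult: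
  assumes D: "pow_closed_normal D" and h: "eq_mod D a b" "eq_mod D a' b'" "b' \<in> V"
  shows "eq_mod D (a * a') (b * b')"
proof -
  obtain g g' where g: "g \<in> D" "a = b * g" "g' \<in> D" "a' = b' * g'" using h unfolding eq_mod_def by blast
  have "a * a' = b * b' * ((vinv b' * g * b') * g')"
    by (simp add: g mult.assoc vinv_assoc[OF h(3)])
  moreover have "(vinv b' * g * b') * g' \<in> D"
    using D g h(3) pow_closedD(4) unfolding pow_closed_normal_def by blast
  ultimately show ?thesis unfolding eq_mod_def by blast
qed

lemma eq_mod_left: "eq_mod D a b \<Longrightarrow> eq_mod D (x * a) (x * b)"
  unfolding eq_mod_def by (auto simp: mult.assoc)

lemma eq_mod_right: "pow_closed_normal D \<Longrightarrow> eq_mod D a b \<Longrightarrow> y \<in> V \<Longrightarrow> eq_mod D (a * y) (b * y)"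
  by (intro eq_mod_mult eq_mod_refl)

lemma eq_mod_inner: "pow_closed_normal D \<Longrightarrow> eq_mod D a b \<Longrightarrow> y \<in> V \<Longrightarrow> eq_mod D (x * a * y) (x * b * y)"
  by (intro eq_mod_right eq_mod_left)

lemma eq_mod_iff: assumes "b \<in> V" shows "eq_mod D a b \<longleftrightarrow> vinv b * a \<in> D"
proof
  assume "eq_mod D a b"
  then show "vinv b * a \<in> D" using vinv_assoc[OF assms] by (auto simp: eq_mod_def)
next
  assume "vinv b * a \<in> D"
  then show "eq_mod D a b" unfolding eq_mod_def using vinv_assoc[OF assms] by metis
qed

lemma Vpower: "x \<in> V \<Longrightarrow> x ^ n \<in> V"
  by (induction n) (auto intro: V1 Vm)

lemma eq_mod_power_commute:
  assumes D: "pow_closed_normal D" and V: "a \<in> V" "c \<in> V" and h: "eq_mod D (c * a) (a * c)"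
  shows "eq_mod D (c * a ^ n) (a ^ n * c)"
proof (induction n)
  case 0
  show ?case using eq_mod_refl[OF D] by simp
next
  case (Suc n)
  note [trans] = eq_mod_trans[OF D]
  have "c * a ^ Suc n = 1 * (c * a) * a ^ n" by (simp add: mult.assoc)
  also have "eq_mod D \<dots> (1 * (a * c) * a ^ n)" by (intro eq_mod_inner[OF D] h Vpower V)
  also have "1 * (a * c) * a ^ n = a * (c * a ^ n)" by (simp add: mult.assoc)
  also have "eq_mod D \<dots> (a * (a ^ n * c))" by (intro eq_mod_left Suc)
  also have "a * (a ^ n * c) = a ^ Suc n * c" by (simp add: mult.assoc)
  finally show ?case .
qed

text \<open>The quotient of the two families is a polynomial family in \<open>V\<close>; the family \<open>A'\<close> witnesses that the inverse of \<open>C\<close> is polynomial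
  in the parameter.\<close>

lemma eq_mod_polynomial_paths:
  assumes D: "pow_closed_normal D" and A: "\<And>t. t \<in> L \<Longrightarrow> ev t A \<in> V" and A': "\<And>t. t \<in> L \<Longrightarrow> ev t A' * ev t C = 1"
     and C: "\<And>t. t \<in> L \<Longrightarrow> ev t C \<in> V"
     and n: "\<And>n. eq_mod D (ev (of_nat n) A) (ev (of_nat n) C)" and t: "t \<in> L"
  shows "eq_mod D (ev t A) (ev t C)"
proof -
  have inv: "ev t A' = vinv (ev t C)" if "t \<in> L" for t
  proof -
    have "ev t A' = ev t A' * (ev t C * vinv (ev t C))" by (simp add: vinv_mult(2)[OF C[OF that]])
    also have "\<dots> = vinv (ev t C)" by (simp only: A'[OF that] mult.assoc[symmetric] mult_1_left)
    finally show ?thesis .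
  qed
  have "ev t (A' * A) \<in> D"
  proof (rule polynomial_path_in_closed[of D 1])
    show "pow_closed D" using D by (simp add: pow_closed_normal_def)
    show "ev t (A' * A) \<in> Vr 1" if "t \<in> L" for t
      unfolding Vr_1 using inv[OF that] A[OF that] C[OF that] by (simp add: Vm vinv_V)
    show "ev (of_nat n) (A' * A) \<in> D" for n
      using n[of n] eq_mod_iff[OF C[OF LD(10)]] inv[OF LD(10)] by simp
  qed (use t in auto)
  then show ?thesis using eq_mod_iff[OF C[OF t]] inv[OF t] by simp
qed

lemma pw_uminus_mult: "x \<in> V \<Longrightarrow> pw N x (- t) * pw N x t = 1"
  by (rule pw_inverse(2)[OF c0 uni])

lemma pw_uminus_mult_assoc: "x \<in> V \<Longrightarrow> pw N x (- t) * (pw N x t * y) = y"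
  using pw_uminus_mult[of x t] by (simp flip: mult.assoc)

lemma pw_mult_mod:
  assumes D: "pow_closed_normal D" and V: "z \<in> V" "w \<in> V" and h: "eq_mod D (w * z) (z * w)" and t: "t \<in> L"
  shows "eq_mod D (pw N (z * w) t) (pw N z t * pw N w t)"
proof -
  have "eq_mod D (ev t (Pw N (z * w))) (ev t (Pw N z * Pw N w))"
  proof (rule eq_mod_polynomial_paths[OF D _ _ _ _ t, where A' = "pc (Pw N w) [:0, -1:] * pc (Pw N z) [:0, -1:]"])
    show "ev t (Pw N (z * w)) \<in> V" "ev t (Pw N z * Pw N w) \<in> V" if "t \<in> L" for t
      using that V by (auto intro: Vpw Vm)
    show "ev t (pc (Pw N w) [:0, -1:] * pc (Pw N z) [:0, -1:]) * ev t (Pw N z * Pw N w) = 1" for t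
      by (simp add: mult.assoc pw_uminus_mult_assoc pw_uminus_mult V)
    fix n
    have "eq_mod D ((z * w) ^ n) (z ^ n * w ^ n)"
    proof (induction n)
      case 0
      show ?case using eq_mod_refl[OF D] by simp
    next
      case (Suc n)
      note [trans] = eq_mod_trans[OF D]
      have "eq_mod D ((z * w) * (z * w) ^ n) ((z * w) * (z ^ n * w ^ n))" by (intro eq_mod_left Suc)
      also have "(z * w) * (z ^ n * w ^ n) = z * (w * z ^ n) * w ^ n" by (simp add: mult.assoc)
      also have "eq_mod D \<dots> (z * (z ^ n * w) * w ^ n)"
        by (intro eq_mod_inner[OF D] eq_mod_power_commute[OF D V h] Vpower V)
      also have "z * (z ^ n * w) * w ^ n = z ^ Suc n * w ^ Suc n" by (simp add: mult.assoc)
      finally show ?case by simp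
    qed
    then show "eq_mod D (ev (of_nat n) (Pw N (z * w))) (ev (of_nat n) (Pw N z * Pw N w))"
      by (simp add: pnat V Vm)
  qed
  then show ?thesis by simp
qed

text \<open>For a natural exponent move the factors \<open>a\<close> past \<open>b\<close> one at a time. Each step produces a factor \<open>c\<close>, which can be moved
  to the right since it commutes with \<open>a\<close> modulo \<open>D\<close>.\<close>

lemma commutator_pw_left:
  assumes D: "pow_closed_normal D" and V: "a \<in> V" "b \<in> V" "c \<in> V"
    and h: "eq_mod D (a * b) (b * a * c)" "eq_mod D (c * a) (a * c)" and t: "t \<in> L"
  shows "eq_mod D (pw N a t * b) (b * pw N a t * pw N c t)"
proof -
  have "eq_mod D (ev t (Pw N a * cst b)) (ev t (cst b * Pw N a * Pw N c))"
  proof (rule eq_mod_polynomial_paths[OF D _ _ _ _ t, where A' = "pc (Pw N c) [:0, -1:] * pc (Pw N a) [:0, -1:] * cst (vinv b)"])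
    show "ev t (Pw N a * cst b) \<in> V" "ev t (cst b * Pw N a * Pw N c) \<in> V" if "t \<in> L" for t
      using that V by (auto intro: Vpw Vm)
    show "ev t (pc (Pw N c) [:0, -1:] * pc (Pw N a) [:0, -1:] * cst (vinv b)) * ev t (cst b * Pw N a * Pw N c) = 1" for t
      by (simp add: mult.assoc pw_uminus_mult_assoc pw_uminus_mult vinv_assoc V)
    fix n
    have "eq_mod D (a ^ n * b) (b * a ^ n * c ^ n)"
    proof (induction n)
      case 0
      show ?case using eq_mod_refl[OF D] by simp
    next
      case (Suc n)
      note [trans] = eq_mod_trans[OF D]
      have "a ^ Suc n * b = a * (a ^ n * b)" by (simp add: mult.assoc)
      also have "eq_mod D \<dots> (a * (b * a ^ n * c ^ n))" by (intro eq_mod_left Suc)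
      also have "a * (b * a ^ n * c ^ n) = 1 * (a * b) * (a ^ n * c ^ n)" by (simp add: mult.assoc)
      also have "eq_mod D \<dots> (1 * (b * a * c) * (a ^ n * c ^ n))" by (intro eq_mod_inner[OF D] h Vm Vpower V)
      also have "1 * (b * a * c) * (a ^ n * c ^ n) = (b * a) * (c * a ^ n) * c ^ n" by (simp add: mult.assoc)
      also have "eq_mod D \<dots> ((b * a) * (a ^ n * c) * c ^ n)"
        by (intro eq_mod_inner[OF D] eq_mod_power_commute[OF D V(1,3) h(2)] Vpower V)
      also have "(b * a) * (a ^ n * c) * c ^ n = b * a ^ Suc n * c ^ Suc n" by (simp add: mult.assoc)
      finally show ?case .
    qed
    then show "eq_mod D (ev (of_nat n) (Pw N a * cst b)) (ev (of_nat n) (cst b * Pw N a * Pw N c))"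
      by (simp add: pnat V)
  qed
  then show ?thesis by simp
qed

lemma commutator_pw_right:
  assumes D: "pow_closed_normal D" and V: "a \<in> V" "b \<in> V" "c \<in> V"
    and h: "eq_mod D (a * b) (b * a * c)" "eq_mod D (c * b) (b * c)" and t: "t \<in> L"
  shows "eq_mod D (a * pw N b t) (pw N b t * a * pw N c t)"
proof -
  have "eq_mod D (ev t (cst a * Pw N b)) (ev t (Pw N b * cst a * Pw N c))"
  proof (rule eq_mod_polynomial_paths[OF D _ _ _ _ t, where A' = "pc (Pw N c) [:0, -1:] * cst (vinv a) * pc (Pw N b) [:0, -1:]"])
    show "ev t (cst a * Pw N b) \<in> V" "ev t (Pw N b * cst a * Pw N c) \<in> V" if "t \<in> L" for t
      using that V by (auto intro: Vpw Vm)
    show "ev t (pc (Pw N c) [:0, -1:] * cst (vinv a) * pc (Pw N b) [:0, -1:]) * ev t (Pw N b * cst a * Pw N c) = 1" for t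
      by (simp add: mult.assoc pw_uminus_mult_assoc pw_uminus_mult vinv_assoc V)
    fix n
    have cn: "eq_mod D (c ^ n * b) (b * c ^ n)" for n
    proof (induction n)
      case 0
      show ?case using eq_mod_refl[OF D] by simp
    next
      case (Suc n)
      note [trans] = eq_mod_trans[OF D]
      have "c ^ Suc n * b = c * (c ^ n * b)" by (simp add: mult.assoc)
      also have "eq_mod D \<dots> (c * (b * c ^ n))" by (intro eq_mod_left Suc)
      also have "c * (b * c ^ n) = 1 * (c * b) * c ^ n" by (simp add: mult.assoc)
      also have "eq_mod D \<dots> (1 * (b * c) * c ^ n)" by (intro eq_mod_inner[OF D] h Vpower V)
      also have "1 * (b * c) * c ^ n = b * c ^ Suc n" by (simp add: mult.assoc)
      finally show ?case .
    qed
    have "eq_mod D (a * b ^ n) (b ^ n * a * c ^ n)"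
    proof (induction n)
      case 0
      show ?case using eq_mod_refl[OF D] by simp
    next
      case (Suc n)
      note [trans] = eq_mod_trans[OF D]
      have "a * b ^ Suc n = a * b ^ n * b" by (simp only: power_Suc2 mult.assoc)
      also have "eq_mod D \<dots> (b ^ n * a * c ^ n * b)" by (intro eq_mod_right[OF D] Suc V)
      also have "b ^ n * a * c ^ n * b = (b ^ n * a) * (c ^ n * b)" by (simp add: mult.assoc)
      also have "eq_mod D \<dots> ((b ^ n * a) * (b * c ^ n))" by (intro eq_mod_left cn)
      also have "(b ^ n * a) * (b * c ^ n) = b ^ n * (a * b) * c ^ n" by (simp add: mult.assoc)
      also have "eq_mod D \<dots> (b ^ n * (b * a * c) * c ^ n)" by (intro eq_mod_inner[OF D] h Vpower V)
      also have "b ^ n * (b * a * c) * c ^ n = b ^ Suc n * a * c ^ Suc n"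
        by (simp only: power_Suc2[of b] power_Suc[of c] mult.assoc)
      finally show ?case .
    qed
    then show "eq_mod D (ev (of_nat n) (cst a * Pw N b)) (ev (of_nat n) (Pw N b * cst a * Pw N c))"
      by (simp add: pnat V)
  qed
  then show ?thesis by simp
qed

end

section \<open>Homomorphic images are commutative\<close>

text \<open>In the induction step the sets \<open>Dk k\<close> and \<open>D = Dk (Suc k)\<close> are the groups \<open>D\<^sub>k\<close> and \<open>D\<^sub>k\<^sub>+\<^sub>1\<close> of the opening text. That
  \<open>Dk k\<close> is closed under products already uses the induction hypothesis: its elements commute modulo \<open>D\<close>, so that \<open>(z w)\<^sup>t\<close> is congruent to \<open>z\<^sup>t w\<^sup>t\<close>.\<close>

theorem (in unipotent_filtration) homomorphic_image_commutative:
  fixes \<phi> :: "('l, 'm) sqmat \<Rightarrow> ('a::alg_closed_field, 'n::finite) sqmat"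
  assumes c0K: "CHAR('a) = 0" and pf: "padic_subfield F B p" and sp: "spanned_by F e K" and K: "sub_field K"
    and roots: "m > 0" "\<And>b. \<exists>Q>b. \<exists>y\<in>L. y ^ Q = of_nat p ^ m"
    and hom: "\<And>x y. x \<in> V \<Longrightarrow> y \<in> V \<Longrightarrow> \<phi> (x * y) = \<phi> x * \<phi> y" and hom1: "\<phi> 1 = 1"
    and ent: "\<And>x. x \<in> V \<Longrightarrow> \<phi> x \<in> entries_in K"
    and uphi: "\<And>x. x \<in> V \<Longrightarrow> (\<phi> x - 1) ^ N' = 0"
    and xy: "x \<in> V" "y \<in> V"
  shows "\<phi> x * \<phi> y = \<phi> y * \<phi> x"
proof -
  define Dk where "Dk k = {z \<in> Vr k. \<forall>t\<in>L. \<phi> (pw N z t) = 1}" for k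
  have phiD: "\<phi> g = 1" if "g \<in> Dk k" for g k
  proof -
    have "\<phi> (pw N g 1) = 1" using that LD(2) unfolding Dk_def by blast
    moreover have "pw N g 1 = g" by (rule pone) (use that Vr_V in \<open>auto simp: Dk_def\<close>)
    ultimately show ?thesis by simp
  qed
  have DkV: "g \<in> Dk k \<Longrightarrow> g \<in> V" for g k using Vr_V by (auto simp: Dk_def)
  have phi_eq_mod: "\<phi> a = \<phi> b" if "eq_mod (Dk k) a b" "b \<in> V" for a b k
  proof -
    obtain g where g: "g \<in> Dk k" "a = b * g" using \<open>eq_mod (Dk k) a b\<close> unfolding eq_mod_def by blast
    then show ?thesis using hom[OF that(2) DkV[OF g(1)]] phiD[OF g(1)] by simp
  qed
  have pw_one: "pw N (1 :: ('l, 'm) sqmat) t = 1" for t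
  proof -
    have "ev t (Pw N (1 :: ('l, 'm) sqmat)) = ev t 1"
      by (rule ev_eqI[OF c0]) (simp add: pnat V1)
    then show ?thesis by simp
  qed
  have main: "pow_closed_normal (Dk k) \<and> (\<forall>i j. i \<ge> 1 \<longrightarrow> j \<ge> 1 \<longrightarrow> i + j \<ge> k \<longrightarrow> (\<forall>x\<in>Vr i. \<forall>y\<in>Vr j. gcomm x y \<in> Dk k))" if k: "k \<ge> 1" for k
    using k
  proof (induction "N - k" arbitrary: k rule: less_induct)
    case less
    have k1: "k \<ge> 1" by fact
    have normal: "vinv x * z * x \<in> Dk k" if x: "x \<in> V" and z: "z \<in> Dk k" for x z
    proof -
      have zV: "z \<in> V" using DkV z .
      have "vinv x * (z - 1) * x \<in> J (0 + k + 0)"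
        using z by (intro Jmult VJ0 vinv_V x) (simp add: Dk_def Vr_def)
      moreover have "vinv x * (z - 1) * x = vinv x * z * x - 1"
        by (simp add: algebra_simps vinv_mult x)
      ultimately have "vinv x * z * x \<in> Vr k" using x zV by (simp add: Vr_def Vm vinv_V)
      moreover have "\<phi> (pw N (vinv x * z * x) t) = 1" if t: "t \<in> L" for t
      proof -
        have "pw N (vinv x * z * x) t = vinv x * pw N z t * x"
          by (rule pw_conj(1)[OF c0 uni[OF zV] vinv_mult[OF x]])
        then have "\<phi> (pw N (vinv x * z * x) t) = \<phi> (vinv x) * \<phi> (pw N z t) * \<phi> x"
          using x zV t by (simp add: hom Vm vinv_V Vpw)
        also have "\<dots> = \<phi> (vinv x) * \<phi> x" using z t by (simp add: Dk_def)
        also have "\<dots> = 1" using x by (simp add: hom[symmetric] vinv_V vinv_mult hom1)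
        finally show ?thesis .
      qed
      ultimately show ?thesis by (simp add: Dk_def)
    qed
    have pwD: "pw N z s \<in> Dk k" if z: "z \<in> Dk k" and s: "s \<in> L" for z s
      using z s Vr_pw[OF k1] ppw[OF DkV[OF z] s] LD(4)[OF s] by (auto simp: Dk_def)
    have oneD: "1 \<in> Dk k" using one_Vr by (simp add: Dk_def pw_one hom1)
    show ?case
    proof (cases "k \<ge> N")
      case True
      have one: "z = 1" if "z \<in> Vr i" "i \<ge> k" for z i using Vr_N[of i z] True that by simp
      then have "Dk k = {1}" using oneD by (auto simp: Dk_def)
      then have "pow_closed_normal (Dk k)" using normal pwD V1 unfolding pow_closed_normal_def pow_closed_def by auto
      moreover have "gcomm x y \<in> Dk k" if "x \<in> Vr i" "y \<in> Vr j" "i + j \<ge> k" for x y i j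
        using one[OF gcomm_Vr[OF that(1,2)] that(3)] oneD by simp
      ultimately show ?thesis by blast
    next
      case False
      define D where "D = Dk (Suc k)"
      have "N - Suc k < N - k" "1 \<le> Suc k" using False by auto
      from less.hyps[OF this] have D: "pow_closed_normal D"
         and cmD: "\<And>i j x y. i \<ge> 1 \<Longrightarrow> j \<ge> 1 \<Longrightarrow> i + j \<ge> Suc k \<Longrightarrow> x \<in> Vr i \<Longrightarrow> y \<in> Vr j \<Longrightarrow> gcomm x y \<in> D"
        by (simp_all add: D_def)
      have DD: "D \<subseteq> Dk k" unfolding D_def Dk_def using Vr_mono[of k "Suc k"] by auto
      have comm: "eq_mod D (x * y) (y * x)" if "i \<ge> 1" "j \<ge> 1" "i + j \<ge> Suc k" "x \<in> Vr i" "y \<in> Vr j" for x y i j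
        using gcomm_eq[OF Vr_V[OF that(4)] Vr_V[OF that(5)]] cmD[OF that] unfolding eq_mod_def by blast
      have multD: "z * w \<in> Dk k" if z: "z \<in> Dk k" and w: "w \<in> Dk k" for z w
      proof -
        have zw: "z \<in> Vr k" "w \<in> Vr k" "z \<in> V" "w \<in> V" using z w DkV by (auto simp: Dk_def)
        have "\<phi> (pw N (z * w) t) = 1" if t: "t \<in> L" for t
        proof -
          have "eq_mod D (w * z) (z * w)" using k1 by (intro comm[of k k] zw) auto
          from pw_mult_mod[OF D zw(3,4) this t] have "\<phi> (pw N (z * w) t) = \<phi> (pw N z t * pw N w t)"
            unfolding D_def by (rule phi_eq_mod) (intro Vm Vpw zw t)
          also have "\<dots> = 1" using z w t by (simp add: hom Vpw zw Dk_def)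
          finally show ?thesis .
        qed
        then show ?thesis using Vr_mult[OF k1 zw(1,2)] by (simp add: Dk_def)
      qed
      have N: "pow_closed_normal (Dk k)" unfolding pow_closed_normal_def pow_closed_def using normal pwD oneD multD DkV by auto
      have "gcomm x y \<in> Dk k" if ij: "i \<ge> 1" "j \<ge> 1" "i + j \<ge> k" and x: "x \<in> Vr i" and y: "y \<in> Vr j" for x y i j
      proof (cases "i + j \<ge> Suc k")
        case True
        then show ?thesis using cmD[OF ij(1,2) _ x y] DD by blast
      next
        case False
        then have ijk: "i + j = k" using ij by simp
        define c where "c = gcomm x y"
        have V: "x \<in> V" "y \<in> V" "c \<in> V" using x y Vr_V gcomm_V by (auto simp: c_def)
        have c: "c \<in> Vr k" using gcomm_Vr[OF x y] by (simp add: c_def ijk)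
        have cx: "eq_mod D (c * z) (z * c)" if "z \<in> V" for z
          by (rule comm[of k 1]) (use c that k1 Vr_1 in auto)
        have xyc: "eq_mod D (x * y) (y * x * c)"
          using gcomm_eq[OF V(1,2)] eq_mod_refl[OF D] by (simp add: c_def)
        have "\<phi> (pw N c s) = 1" if s: "s \<in> L" for s
        proof (rule heisenberg_trivial[where f = "\<lambda>t. \<phi> (pw N x t)" and g = "\<lambda>t. \<phi> (pw N y t)" and h = "\<lambda>t. \<phi> (pw N c t)",
              OF c0K pf sp K L roots])
          show "(\<phi> (pw N x t) - 1) ^ N' = 0" "(\<phi> (pw N y t) - 1) ^ N' = 0" "(\<phi> (pw N c t) - 1) ^ N' = 0"
            "\<phi> (pw N x t) \<in> entries_in K" if "t \<in> L" for t
            using that V by (auto intro: uphi ent Vpw)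
          show "\<phi> (pw N x (s + t)) = \<phi> (pw N x s) * \<phi> (pw N x t)"
            "\<phi> (pw N y (s + t)) = \<phi> (pw N y s) * \<phi> (pw N y t)"
            "\<phi> (pw N c (s + t)) = \<phi> (pw N c s) * \<phi> (pw N c t)" if "s \<in> L" "t \<in> L" for s t
            using that V by (simp_all add: padd hom Vpw)
          show "\<phi> (pw N x t) * \<phi> (pw N y s) = \<phi> (pw N y s) * \<phi> (pw N x t) * \<phi> (pw N c (t * s))" if st: "s \<in> L" "t \<in> L" for s t
          proof -
            have "eq_mod D (pw N x t * y) (y * pw N x t * pw N c t)"
              by (rule commutator_pw_left[OF D V xyc cx[OF V(1)] st(2)])
            moreover have "eq_mod D (pw N c t * y) (y * pw N c t)"
              by (rule comm[of k 1]) (use Vr_pw[OF k1 c st(2)] V(2) k1 Vr_1 in auto)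
            ultimately have "eq_mod D (pw N x t * pw N y s) (pw N y s * pw N x t * pw N (pw N c t) s)"
              by (intro commutator_pw_right[OF D] Vpw V st)
            then have "\<phi> (pw N x t * pw N y s) = \<phi> (pw N y s * pw N x t * pw N (pw N c t) s)"
              unfolding D_def by (rule phi_eq_mod) (intro Vm Vpw V st)
            then show ?thesis using V st by (simp add: hom Vpw Vm ppw LD(4))
          qed
        qed (use s in auto)
        then show ?thesis using c by (simp add: Dk_def c_def)
      qed
      with N show ?thesis by blast
    qed
  qed
  have "gcomm x y \<in> Dk 2"
  proof -
    have "x \<in> Vr 1" "y \<in> Vr 1" using xy Vr_1 by simp_all
    moreover have "(2 :: nat) \<le> 1 + 1" by simp
    ultimately show ?thesis using main[of 2] by (metis one_le_numeral order_refl)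
  qed
  then have "gcomm x y \<in> V" "\<phi> (gcomm x y) = 1" using phiD DkV by blast+
  then show ?thesis
    using gcomm_eq[OF xy] xy by (metis Vm hom mult_1_right)
qed

section \<open>The p-adic absolute value on the rationals\<close>

lemma padic_abs_fraction:
  assumes p: "normalization_semidom_class.prime p" and ab: "a \<noteq> 0" "b \<noteq> 0"
  shows "padic_abs p (of_int a / of_int b) = real p powi (int (multiplicity (int p) b) - int (multiplicity (int p) a))"
proof -
  define x :: rat where "x = of_int a / of_int b"
  obtain a' b' where q: "quotient_of x = (a', b')" by (cases "quotient_of x")
  have b': "b' > 0" using quotient_of_denom_pos[OF q] .
  have x: "x = of_int a' / of_int b'" using quotient_of_div[OF q] .
  have x0: "x \<noteq> 0" using ab by (simp add: x_def)
  then have a': "a' \<noteq> 0" using x by auto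
  have "of_int a' * of_int b = (of_int a * of_int b' :: rat)"
    using x ab b' unfolding x_def by (simp add: field_simps)
  then have e: "a' * b = a * b'" by (metis of_int_mult of_int_eq_iff)
  have pe: "prime_elem (int p)" using p by (simp add: prime_imp_prime_elem)
  have "multiplicity (int p) (a' * b) = multiplicity (int p) (a * b')" by (simp add: e)
  then have "multiplicity (int p) a' + multiplicity (int p) b = multiplicity (int p) a + multiplicity (int p) b'"
    using a' ab b' by (simp add: prime_elem_multiplicity_mult_distrib[OF pe])
  then have "int (multiplicity (int p) b') - int (multiplicity (int p) a') = int (multiplicity (int p) b) - int (multiplicity (int p) a)"
    by linarith
  then show ?thesis using x0 unfolding x_def[symmetric] padic_abs_def q by simp
qed

lemma rat_fraction:
  fixes x :: rat
  obtains a b :: int where "x = of_int a / of_int b" "b > 0" "coprime a b"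
proof (cases "quotient_of x")
  case (Pair a b)
  then show ?thesis
    using that quotient_of_div[OF Pair] quotient_of_denom_pos[OF Pair] quotient_of_coprime[OF Pair] by blast
qed

locale prime_number =
  fixes p :: nat
  assumes prime_p: "normalization_semidom_class.prime p"
begin

abbreviation nrm :: "rat \<Rightarrow> real" where "nrm \<equiv> padic_abs p"

lemma p_gt_1: "real p > 1" using prime_p prime_gt_1_nat by auto

lemma nrm_0 [simp]: "nrm 0 = 0" by (simp add: padic_abs_def)

lemma nrm_fraction: "a \<noteq> 0 \<Longrightarrow> b \<noteq> 0 \<Longrightarrow> nrm (of_int a / of_int b) = real p powi (int (multiplicity (int p) b) - int (multiplicity (int p) a))"
  by (rule padic_abs_fraction[OF prime_p])

lemma pe: "prime_elem (int p)" using prime_p by (simp add: prime_imp_prime_elem)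

lemma nrm_values: "x \<noteq> 0 \<Longrightarrow> \<exists>k. nrm x = real p powi k"
  by (auto simp: padic_abs_def split: prod.split)

lemma nrm_pos: "x \<noteq> 0 \<Longrightarrow> nrm x > 0"
  using nrm_values[of x] p_gt_1 by (auto simp: zero_less_power_int)

lemma nrm_nonneg: "nrm x \<ge> 0"
  using nrm_pos[of x] by (cases "x = 0") auto

lemma nrm_eq_0 [simp]: "nrm x = 0 \<longleftrightarrow> x = 0"
  using nrm_pos[of x] by (cases "x = 0") auto

lemma nrm_mult: "nrm (x * y) = nrm x * nrm y"
proof (cases "x = 0 \<or> y = 0")
  case False
  obtain a b where x: "x = of_int a / of_int b" "b > 0" using rat_fraction[of x] by metis
  obtain c d where y: "y = of_int c / of_int d" "d > 0" using rat_fraction[of y] by metis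
  have nz: "a \<noteq> 0" "c \<noteq> 0" "b \<noteq> 0" "d \<noteq> 0" using False x y by auto
  have xy: "x * y = of_int (a * c) / of_int (b * d)" by (simp add: x y)
  have m: "multiplicity (int p) (u * v) = multiplicity (int p) u + multiplicity (int p) v" if "u \<noteq> 0" "v \<noteq> 0" for u v :: int
    using that by (rule prime_elem_multiplicity_mult_distrib[OF pe])
  have acbd: "a * c \<noteq> 0" "b * d \<noteq> 0" using nz by auto
  show ?thesis
    unfolding xy nrm_fraction[OF acbd] unfolding x y nrm_fraction[OF nz(1,3)] nrm_fraction[OF nz(2,4)]
    using p_gt_1 nz by (simp add: m power_int_add[symmetric] algebra_simps)
qed auto

lemma nrm_uminus: "nrm (- x) = nrm x"
  using nrm_mult[of "-1" x] nrm_mult[of "-1" "-1"] nrm_nonneg[of "-1"]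
  by (auto simp: padic_abs_def)

lemma nrm_1: "nrm 1 = 1"
  using nrm_mult[of 1 1] nrm_pos[of 1] by simp

lemma nrm_inverse: "nrm (inverse x) = inverse (nrm x)"
proof (cases "x = 0")
  case False
  then have "nrm x * nrm (inverse x) = 1" by (simp flip: nrm_mult add: nrm_1)
  then show ?thesis using inverse_unique[of "nrm x" "nrm (inverse x)"] by simp
qed simp

lemma nrm_add: "nrm (x + y) \<le> max (nrm x) (nrm y)"
proof (cases "x = 0 \<or> y = 0 \<or> x + y = 0")
  case True
  then show ?thesis using nrm_nonneg by (auto simp: max_def intro: order_trans)
next
  case False
  obtain a b where x: "x = of_int a / of_int b" "b > 0" using rat_fraction[of x] by metis
  obtain c d where y: "y = of_int c / of_int d" "d > 0" using rat_fraction[of y] by metis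
  have nz: "a * d \<noteq> 0" "c * b \<noteq> 0" "b * d \<noteq> 0" using False x y by auto
  have e: "x = of_int (a * d) / of_int (b * d)" "y = of_int (c * b) / of_int (b * d)"
    "x + y = of_int (a * d + c * b) / of_int (b * d)"
  proof -
    show 1: "x = of_int (a * d) / of_int (b * d)" using nz by (simp add: x)
    show 2: "y = of_int (c * b) / of_int (b * d)" using nz by (simp add: y)
    show "x + y = of_int (a * d + c * b) / of_int (b * d)"
      unfolding of_int_add add_divide_distrib using 1 2 by simp
  qed
  have s: "a * d + c * b \<noteq> 0" 
  proof
    assume h: "a * d + c * b = 0"
    have "x + y = 0" using e(3) by (simp only: h of_int_0 div_0)
    then show False using False by simp
  qed
  have "min (multiplicity (int p) (a * d)) (multiplicity (int p) (c * b)) \<le> multiplicity (int p) (a * d + c * b)"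
  proof (rule multiplicity_geI)
    show "a * d + c * b \<noteq> 0" by fact
    show "\<not> is_unit (int p)" by (rule prime_elem_not_unit[OF pe])
    show "int p ^ min (multiplicity (int p) (a * d)) (multiplicity (int p) (c * b)) dvd a * d + c * b"
      by (intro dvd_add multiplicity_dvd') auto
  qed
  then have "int (multiplicity (int p) (b * d)) - int (multiplicity (int p) (a * d + c * b))
     \<le> max (int (multiplicity (int p) (b * d)) - int (multiplicity (int p) (a * d))) (int (multiplicity (int p) (b * d)) - int (multiplicity (int p) (c * b)))"
    by linarith
  then have "nrm (x + y) \<le> real p powi max (int (multiplicity (int p) (b * d)) - int (multiplicity (int p) (a * d))) (int (multiplicity (int p) (b * d)) - int (multiplicity (int p) (c * b)))"
    unfolding e(3) nrm_fraction[OF s nz(3)] using p_gt_1 by (intro power_int_increasing) auto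
  also have "\<dots> \<le> max (nrm x) (nrm y)"
    unfolding e(1,2) nrm_fraction[OF nz(1,3)] nrm_fraction[OF nz(2,3)] by (auto simp: max_def)
  finally show ?thesis .
qed

lemma nrm_diff: "nrm (x - y) \<le> max (nrm x) (nrm y)"
  using nrm_add[of x "- y"] by (simp add: nrm_uminus)

lemma nrm_diff_commute: "nrm (x - y) = nrm (y - x)"
  using nrm_uminus[of "x - y"] by simp

lemma nrm_eqI: assumes "nrm (x - y) < nrm y" shows "nrm x = nrm y"
proof (rule antisym)
  show "nrm x \<le> nrm y" using nrm_add[of "x - y" y] assms by simp
  show "nrm y \<le> nrm x" using nrm_diff[of x "x - y"] assms by (auto simp: max_def split: if_splits)
qed

lemma nrm_p: "nrm (of_nat p) = 1 / real p"
proof -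
  have "nrm (of_int (int p) / of_int 1) = real p powi (int (multiplicity (int p) 1) - int (multiplicity (int p) (int p)))"
    using prime_p prime_gt_0_nat[OF prime_p] by (intro nrm_fraction) auto
  moreover have "multiplicity (int p) (int p) = 1"
    using pe by (intro multiplicity_self) (auto simp: prime_elem_def)
  ultimately show ?thesis by (simp add: power_int_minus field_simps)
qed

lemma p_nz: "(of_nat p :: rat) \<noteq> 0"
  using p_gt_1 by auto

lemma nrm_div_p: "nrm x \<le> 1 / real p \<Longrightarrow> nrm (x * inverse (of_nat p)) \<le> 1"
proof -
  assume h: "nrm x \<le> 1 / real p"
  have "nrm (x * inverse (of_nat p)) = nrm x * real p"
    by (simp only: nrm_mult nrm_inverse nrm_p) simp
  also have "\<dots> \<le> 1 / real p * real p" using h by (intro mult_right_mono) auto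
  finally show ?thesis using p_gt_1 by simp
qed

lemma mult_div_p: "of_nat p * (x * inverse (of_nat p)) = (x :: rat)"
  using p_nz by (metis mult.left_commute mult.right_neutral right_inverse)

lemma nrm_power: "nrm (x ^ n) = nrm x ^ n"
  by (induction n) (simp_all add: nrm_1 nrm_mult)

lemma nrm_powi: "nrm (x powi k) = nrm x powi k"
  by (simp add: power_int_def nrm_power nrm_inverse)

lemma nrm_of_int: "nrm (of_int a) \<le> 1"
proof (cases "a = 0")
  case False
  have "nrm (of_int a / of_int 1) = real p powi (int (multiplicity (int p) 1) - int (multiplicity (int p) a))"
    using False by (intro nrm_fraction) auto
  also have "\<dots> \<le> real p powi 0" using p_gt_1 by (intro power_int_increasing) auto
  finally show ?thesis by simp
qed simp

lemma nrm_of_int_dvd: assumes "int p ^ k dvd a" shows "nrm (of_int a) \<le> (1 / real p) ^ k"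
proof -
  obtain b where "a = int p ^ k * b" using assms by (auto simp: dvd_def)
  then have "nrm (of_int a) = nrm (of_nat p) ^ k * nrm (of_int b)" by (simp add: nrm_mult nrm_power)
  also have "\<dots> \<le> nrm (of_nat p) ^ k * 1" by (intro mult_left_mono nrm_of_int zero_le_power nrm_nonneg)
  finally show ?thesis by (simp add: nrm_p)
qed

text \<open>The absolute value is discrete.\<close>

lemma nrm_lt_1: assumes "nrm x < 1" shows "nrm x \<le> 1 / real p"
proof (cases "x = 0")
  case False
  then obtain k where k: "nrm x = real p powi k" using nrm_values by blast
  have "k < 0"
  proof (rule ccontr)
    assume "\<not> k < 0"
    then have "real p powi 0 \<le> real p powi k" using p_gt_1 by (intro power_int_increasing) auto
    then show False using assms k by simp
  qed
  then have "real p powi k \<le> real p powi (-1)" using p_gt_1 by (intro power_int_increasing) auto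
  then show ?thesis using k by (simp add: power_int_minus field_simps)
qed (use p_gt_1 in auto)

text \<open>As the denominator is prime to \<open>p\<close>, the numerator times its inverse modulo \<open>p\<close> is a representative.\<close>

lemma nrm_residue: assumes "nrm x \<le> 1" shows "\<exists>n<p. nrm (x - of_nat n) \<le> 1 / real p"
proof -
  obtain a b where x: "x = of_int a / of_int b" "b > 0" "coprime a b" using rat_fraction .
  have nb: "\<not> int p dvd b"
  proof
    assume d: "int p dvd b"
    then have na: "\<not> int p dvd a" using x(3) pe by (meson coprime_common_divisor prime_elem_def)
    then have a0: "a \<noteq> 0" by auto
    have "multiplicity (int p) a = 0" using na by (rule not_dvd_imp_multiplicity_0)
    moreover have mb: "multiplicity (int p) b \<ge> 1"
      using d x(2) pe by (intro multiplicity_geI) (auto simp: prime_elem_def)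
    moreover have "real p ^ 1 \<le> real p ^ multiplicity (int p) b"
      using p_gt_1 mb by (intro power_increasing) auto
    ultimately have "real p ^ 1 \<le> nrm x"
      unfolding x(1) using nrm_fraction[of a b] a0 x(2) by simp
    then show False using assms p_gt_1 by simp
  qed
  then have "coprime (int p) b" using prime_p by (simp add: prime_imp_coprime)
  then obtain c where c: "[b * c = 1] (mod int p)"
    using cong_solve_coprime_int[of b "int p"] by (auto simp: coprime_commute)
  define n where "n = nat ((a * c) mod int p)"
  have p0: "int p > 0" using prime_p prime_gt_0_nat by auto
  have n: "int n = (a * c) mod int p" "n < p" using p0 by (auto simp: n_def nat_less_iff)
  have "[b * int n = a] (mod int p)"
  proof -
    have "[b * int n = b * (a * c)] (mod int p)" unfolding n by (intro cong_mult cong_refl) (simp add: cong_def)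
    also have "b * (a * c) = a * (b * c)" by simp
    also have "[a * (b * c) = a * 1] (mod int p)" by (intro cong_mult cong_refl c)
    finally show ?thesis by simp
  qed
  then have "int p dvd a - b * int n" by (metis cong_iff_dvd_diff cong_sym)
  then have "int p ^ 1 dvd a - b * int n" by simp
  from nrm_of_int_dvd[OF this] have d: "nrm (of_int (a - b * int n)) \<le> 1 / real p"
    by (simp only: power_one_right)
  have "nrm (of_int b) = 1"
  proof -
    have "multiplicity (int p) b = 0" using nb by (rule not_dvd_imp_multiplicity_0)
    then show ?thesis using nrm_fraction[of b 1] x(2) by simp
  qed
  moreover have "x - of_nat n = of_int (a - b * int n) * inverse (of_int b)"
    using x(2) by (simp add: x(1) field_simps)
  ultimately have "nrm (x - of_nat n) = nrm (of_int (a - b * int n))" by (simp add: nrm_mult nrm_inverse)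
  then show ?thesis using d n(2) by auto
qed

lemma nrm_decomp: assumes "x \<noteq> 0" shows "\<exists>j. nrm (x * of_nat p powi (- j)) = 1"
proof -
  obtain k where k: "nrm x = real p powi k" using nrm_values[OF assms] by blast
  have "nrm (x * of_nat p powi (- (- k))) = 1"
    using p_gt_1 by (simp add: nrm_mult nrm_powi nrm_p k power_int_divide_distrib)
  then show ?thesis by blast
qed

end

section \<open>The rationals and the p-adic numbers in a field\<close>

definition rat_hom :: "(rat \<Rightarrow> 'a::field) \<Rightarrow> bool" where
  "rat_hom \<rho> \<longleftrightarrow> \<rho> 1 = 1 \<and> (\<forall>x y. \<rho> (x + y) = \<rho> x + \<rho> y) \<and> (\<forall>x y. \<rho> (x * y) = \<rho> x * \<rho> y)"

lemma rat_homD: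
  assumes "rat_hom \<rho>"
  shows "\<rho> 0 = 0" "\<rho> 1 = 1" "\<rho> (x + y) = \<rho> x + \<rho> y" "\<rho> (x * y) = \<rho> x * \<rho> y" "\<rho> (- x) = - \<rho> x" "\<rho> (x - y) = \<rho> x - \<rho> y"
    "\<rho> (inverse x) = inverse (\<rho> x)" "\<rho> x = 0 \<longleftrightarrow> x = 0" "\<rho> (of_nat n) = of_nat n" "\<rho> (x powi k) = \<rho> x powi k"
proof -
  have b: "\<rho> 1 = 1" "\<And>x y. \<rho> (x + y) = \<rho> x + \<rho> y" "\<And>x y. \<rho> (x * y) = \<rho> x * \<rho> y"
    using assms unfolding rat_hom_def by blast+
  have "\<rho> 0 + \<rho> 0 = \<rho> 0 + 0" using b(2)[of 0 0] by (simp only: add_0_right)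
  then have z: "\<rho> 0 = 0" by (simp only: add_left_cancel)
  have u: "\<rho> (- x) = - \<rho> x" for x using b(2)[of x "- x"] z by (simp add: eq_neg_iff_add_eq_0 add.commute)
  have inv: "\<rho> (inverse x) = inverse (\<rho> x)" for x
  proof (cases "x = 0")
    case False
    then have "\<rho> x * \<rho> (inverse x) = 1" by (simp flip: b(3) add: b(1))
    then show ?thesis using inverse_unique by metis
  qed (simp add: z)
  have pow: "\<rho> (x ^ n) = \<rho> x ^ n" for x n by (induction n) (simp_all add: b)
  show "\<rho> 0 = 0" "\<rho> 1 = 1" "\<rho> (x + y) = \<rho> x + \<rho> y" "\<rho> (x * y) = \<rho> x * \<rho> y" "\<rho> (- x) = - \<rho> x"
    "\<rho> (inverse x) = inverse (\<rho> x)" by (fact z b u inv)+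
  show "\<rho> (x - y) = \<rho> x - \<rho> y" using b(2)[of x "- y"] u by simp
  show "\<rho> x = 0 \<longleftrightarrow> x = 0"
  proof
    assume "\<rho> x = 0"
    show "x = 0"
    proof (rule ccontr)
      assume "x \<noteq> 0"
      then have "\<rho> (x * inverse x) = 1" by (simp add: b(1))
      then show False using \<open>\<rho> x = 0\<close> by (simp add: b(3))
    qed
  qed (simp add: z)
  show "\<rho> (of_nat n) = of_nat n" by (induction n) (simp_all add: z b)
  show "\<rho> (x powi k) = \<rho> x powi k" by (simp add: power_int_def pow inv)
qed

lemma (in prime_number) rat_padic_subfield:
  fixes \<rho> :: "rat \<Rightarrow> 'a::field"
  assumes "rat_hom \<rho>"
  shows "padic_subfield (range \<rho>) (\<rho> ` {x. nrm x \<le> 1}) p"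
proof -
  note rho = rat_homD[OF assms]
  have p0: "(of_nat p :: rat) \<noteq> 0" using p_gt_1 by auto
  show ?thesis
  proof
    show "sub_field (range \<rho>)"
      unfolding sub_field_def
    proof (intro conjI ballI)
      show "0 \<in> range \<rho>" "1 \<in> range \<rho>" unfolding rho(1,2)[symmetric] by auto
      fix x y assume "x \<in> range \<rho>" "y \<in> range \<rho>"
      then show "x - y \<in> range \<rho>" "x * y \<in> range \<rho>" by (auto simp flip: rho(4,6))
    next
      fix x assume "x \<in> range \<rho>"
      then show "inverse x \<in> range \<rho>" by (auto simp flip: rho(7))
    qed
    show "sub_ring (\<rho> ` {x. nrm x \<le> 1})"
      unfolding sub_ring_def
    proof (intro conjI ballI)
      show "1 \<in> \<rho> ` {x. nrm x \<le> 1}" by (rule image_eqI[of _ _ 1]) (auto simp: rho nrm_1)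
      fix x y assume "x \<in> \<rho> ` {x. nrm x \<le> 1}" "y \<in> \<rho> ` {x. nrm x \<le> 1}"
      then obtain a b where ab: "x = \<rho> a" "y = \<rho> b" "nrm a \<le> 1" "nrm b \<le> 1" by auto
      have "nrm (a - b) \<le> 1" using nrm_diff[of a b] ab by auto
      then show "x - y \<in> \<rho> ` {x. nrm x \<le> 1}" unfolding ab(1,2) rho(6)[symmetric] by auto
      have "nrm (a * b) \<le> 1" unfolding nrm_mult using ab nrm_nonneg by (intro mult_le_one)
      then show "x * y \<in> \<rho> ` {x. nrm x \<le> 1}" unfolding ab(1,2) rho(4)[symmetric] by auto
    qed
    show "of_nat p \<noteq> (0 :: 'a)" using p0 rho(8)[of "of_nat p"] by (simp add: rho(9))
    show "inverse (of_nat p) \<notin> \<rho> ` {x. nrm x \<le> 1}"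
    proof
      assume "inverse (of_nat p) \<in> \<rho> ` {x. nrm x \<le> 1}"
      then obtain a where a: "\<rho> a = inverse (of_nat p)" "nrm a \<le> 1" by auto
      then have "\<rho> (a - inverse (of_nat p)) = 0" by (simp add: rho)
      then have "a = inverse (of_nat p)" using rho(8)[of "a - inverse (of_nat p)"] by simp
      then show False using a(2) p_gt_1 by (simp add: nrm_inverse nrm_p)
    qed
    fix x assume "x \<in> range \<rho>" "x \<noteq> 0"
    then obtain a where ax: "x = \<rho> a" by blast
    then have a: "a \<noteq> 0" using \<open>x \<noteq> 0\<close> rho(1) by blast
    obtain j where j: "nrm (a * of_nat p powi (- j)) = 1" using nrm_decomp[OF a] by blast
    define u where "u = a * of_nat p powi (- j)"
    have P: "(of_nat p :: rat) powi j \<noteq> 0" using p0 by simp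
    have u0: "u \<noteq> 0" using a p0 by (simp add: u_def)
    have nu: "nrm u = 1" "nrm (inverse u) = 1" using j by (simp_all add: u_def[symmetric] nrm_inverse)
    have "u * of_nat p powi j = a" using P unfolding u_def power_int_minus by simp
    then have "x = \<rho> u * of_nat p powi j"
      unfolding ax rho(9)[symmetric] rho(10)[symmetric] rho(4)[symmetric] by simp
    moreover have "\<rho> u \<in> \<rho> ` {x. nrm x \<le> 1}" "inverse (\<rho> u) \<in> \<rho> ` {x. nrm x \<le> 1}"
      unfolding rho(7)[symmetric] using nu by auto
    moreover have "\<rho> u \<noteq> 0" using u0 rho(8) by simp
    ultimately show "\<exists>u\<in>\<rho> ` {x. nrm x \<le> 1}. \<exists>j. u \<noteq> 0 \<and> inverse u \<in> \<rho> ` {x. nrm x \<le> 1} \<and> x = u * of_nat p powi j"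
      by blast
  next
    fix x assume "x \<in> \<rho> ` {x. nrm x \<le> 1}"
    then obtain a where a: "x = \<rho> a" "nrm a \<le> 1" by auto
    obtain n where n: "n < p" "nrm (a - of_nat n) \<le> 1 / real p" using nrm_residue[OF a(2)] by blast
    define y where "y = (a - of_nat n) * inverse (of_nat p)"
    have "nrm y \<le> 1" unfolding y_def by (rule nrm_div_p[OF n(2)])
    moreover have "a = of_nat n + of_nat p * y" unfolding y_def mult_div_p by simp
    then have "x = of_nat n + of_nat p * \<rho> y" unfolding a(1) by (simp add: rho)
    ultimately show "\<exists>n<p. \<exists>y\<in>\<rho> ` {x. nrm x \<le> 1}. x = of_nat n + of_nat p * y" using n(1) by blast
  qed
qed

context prime_number
begin

abbreviation Cau :: "(nat \<Rightarrow> rat) set" where "Cau \<equiv> {s. padic_Cauchy p s}"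
abbreviation Nul :: "(nat \<Rightarrow> rat) set" where "Nul \<equiv> padic_null p"

lemma Cau_const: "(\<lambda>n. c) \<in> Cau" by (simp add: padic_Cauchy_def)

lemma Cau_add: assumes "s \<in> Cau" "t \<in> Cau" shows "(\<lambda>n. s n + t n) \<in> Cau"
  unfolding padic_Cauchy_def mem_Collect_eq
proof (intro allI impI)
  fix e :: real assume e: "e > 0"
  obtain N M where N: "\<And>m n. m \<ge> N \<Longrightarrow> n \<ge> N \<Longrightarrow> nrm (s m - s n) < e" and M: "\<And>m n. m \<ge> M \<Longrightarrow> n \<ge> M \<Longrightarrow> nrm (t m - t n) < e"
    using assms e unfolding padic_Cauchy_def mem_Collect_eq by meson
  have "nrm ((s m + t m) - (s n + t n)) < e" if "m \<ge> max N M" "n \<ge> max N M" for m n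
    using nrm_add[of "s m - s n" "t m - t n"] N[of m n] M[of m n] that by (simp add: algebra_simps)
  then show "\<exists>N. \<forall>m\<ge>N. \<forall>n\<ge>N. nrm ((s m + t m) - (s n + t n)) < e" by blast
qed

lemma Cau_bounded: assumes "s \<in> Cau" shows "\<exists>b>0. \<forall>n. nrm (s n) \<le> b"
proof -
  obtain N where N: "\<And>m n. m \<ge> N \<Longrightarrow> n \<ge> N \<Longrightarrow> nrm (s m - s n) < 1"
    using assms unfolding padic_Cauchy_def mem_Collect_eq by (meson zero_less_one)
  define b where "b = Max (insert 1 (nrm ` s ` {..N}))"
  have b: "nrm (s n) \<le> b" if "n \<le> N" for n unfolding b_def using that by (intro Max_ge) auto
  have b1: "1 \<le> b" unfolding b_def by (intro Max_ge) auto
  have "nrm (s n) \<le> b" for n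
  proof (cases "n \<le> N")
    case False
    then have "nrm (s n) \<le> max (nrm (s n - s N)) (nrm (s N))" using nrm_add[of "s n - s N" "s N"] by simp
    also have "\<dots> \<le> b" using N[of n N] False b[of N] b1 by auto
    finally show ?thesis .
  qed (rule b)
  then show ?thesis using b1 by (intro exI[of _ b]) auto
qed

lemma Cau_mult: assumes "s \<in> Cau" "t \<in> Cau" shows "(\<lambda>n. s n * t n) \<in> Cau"
  unfolding padic_Cauchy_def mem_Collect_eq
proof (intro allI impI)
  fix e :: real assume e: "e > 0"
  obtain b c where b: "b > 0" "\<And>n. nrm (s n) \<le> b" and c: "c > 0" "\<And>n. nrm (t n) \<le> c"
    using Cau_bounded assms by meson
  have "e / c > 0" "e / b > 0" using e b c by auto
  then obtain N M where N: "\<And>m n. m \<ge> N \<Longrightarrow> n \<ge> N \<Longrightarrow> nrm (s m - s n) < e / c" and M: "\<And>m n. m \<ge> M \<Longrightarrow> n \<ge> M \<Longrightarrow> nrm (t m - t n) < e / b"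
    using assms unfolding padic_Cauchy_def mem_Collect_eq by meson
  have "nrm (s m * t m - s n * t n) < e" if mn: "m \<ge> max N M" "n \<ge> max N M" for m n
  proof -
    have "s m * t m - s n * t n = (s m - s n) * t m + s n * (t m - t n)" by (simp add: algebra_simps)
    then have "nrm (s m * t m - s n * t n) \<le> max (nrm (s m - s n) * nrm (t m)) (nrm (s n) * nrm (t m - t n))"
      using nrm_add by (metis nrm_mult)
    moreover have "nrm (s m - s n) * nrm (t m) < e"
    proof -
      have "nrm (s m - s n) * nrm (t m) \<le> nrm (s m - s n) * c" using c(2) nrm_nonneg by (intro mult_left_mono)
      also have "\<dots> < e / c * c" using N[of m n] mn c(1) by (intro mult_strict_right_mono) auto
      finally show ?thesis using c(1) by simp
    qed
    moreover have "nrm (s n) * nrm (t m - t n) < e"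
    proof -
      have "nrm (s n) * nrm (t m - t n) \<le> b * nrm (t m - t n)" using b(2) nrm_nonneg by (intro mult_right_mono)
      also have "\<dots> < b * (e / b)" using M[of m n] mn b(1) by (intro mult_strict_left_mono) auto
      finally show ?thesis using b(1) by simp
    qed
    ultimately show ?thesis by linarith
  qed
  then show "\<exists>N. \<forall>m\<ge>N. \<forall>n\<ge>N. nrm (s m * t m - s n * t n) < e" by blast
qed

lemma Cau_uminus: "s \<in> Cau \<Longrightarrow> (\<lambda>n. - s n) \<in> Cau"
  using Cau_mult[OF Cau_const[of "-1"]] by simp

lemma Cau_diff: "s \<in> Cau \<Longrightarrow> t \<in> Cau \<Longrightarrow> (\<lambda>n. s n - t n) \<in> Cau"
  using Cau_add[OF _ Cau_uminus] by simp

lemma Nul_iff: "s \<in> Nul \<longleftrightarrow> s \<in> Cau \<and> (\<forall>e>0. \<exists>N. \<forall>n\<ge>N. nrm (s n) < e)"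
  unfolding padic_null_def LIMSEQ_iff using nrm_nonneg by auto

lemma Nul_eventually_zero: assumes "\<And>n. n \<ge> N \<Longrightarrow> s n = 0" shows "s \<in> Nul"
  unfolding Nul_iff padic_Cauchy_def mem_Collect_eq
proof (intro conjI allI impI)
  fix e :: real assume "e > 0"
  then show "\<exists>N. \<forall>m\<ge>N. \<forall>n\<ge>N. nrm (s m - s n) < e" "\<exists>N. \<forall>n\<ge>N. nrm (s n) < e"
    using assms by (intro exI[of _ N]; simp)+
qed

lemma Nul_add: assumes "s \<in> Nul" "t \<in> Nul" shows "(\<lambda>n. s n + t n) \<in> Nul"
proof -
  have "\<exists>N. \<forall>n\<ge>N. nrm (s n + t n) < e" if e: "e > 0" for e
  proof -
    obtain N M where N: "\<And>n. n \<ge> N \<Longrightarrow> nrm (s n) < e" "\<And>n. n \<ge> M \<Longrightarrow> nrm (t n) < e"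
      using assms e unfolding Nul_iff by meson
    have "nrm (s n + t n) < e" if "n \<ge> max N M" for n
      using nrm_add[of "s n" "t n"] N[of n] that by auto
    then show ?thesis by blast
  qed
  then show ?thesis using assms Cau_add unfolding Nul_iff by blast
qed

lemma Nul_mult: assumes "s \<in> Nul" "t \<in> Cau" shows "(\<lambda>n. s n * t n) \<in> Nul"
proof -
  obtain c where c: "c > 0" "\<And>n. nrm (t n) \<le> c" using Cau_bounded assms(2) by meson
  have "\<exists>N. \<forall>n\<ge>N. nrm (s n * t n) < e" if e: "e > 0" for e
  proof -
    have "e / c > 0" using e c by auto
    then obtain N where N: "\<And>n. n \<ge> N \<Longrightarrow> nrm (s n) < e / c" using assms(1) unfolding Nul_iff by meson
    have "nrm (s n * t n) < e" if "n \<ge> N" for n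
    proof -
      have "nrm (s n) * nrm (t n) \<le> nrm (s n) * c" using c(2) nrm_nonneg by (intro mult_left_mono)
      also have "\<dots> < e / c * c" using N[OF that] c(1) by (intro mult_strict_right_mono) auto
      finally show ?thesis using c(1) by (simp add: nrm_mult)
    qed
    then show ?thesis by blast
  qed
  then show ?thesis using assms Cau_mult unfolding Nul_iff by blast
qed

lemma Nul_uminus: "s \<in> Nul \<Longrightarrow> (\<lambda>n. - s n) \<in> Nul"
  using Nul_mult[OF _ Cau_const[of "-1"]] by simp

abbreviation CR where "CR \<equiv> padic_Cauchy_ring p"

lemma CR_simps: "carrier CR = Cau" "s \<otimes>\<^bsub>CR\<^esub> t = (\<lambda>n. s n * t n)" "\<one>\<^bsub>CR\<^esub> = (\<lambda>n. 1)" "\<zero>\<^bsub>CR\<^esub> = (\<lambda>n. 0)" "s \<oplus>\<^bsub>CR\<^esub> t = (\<lambda>n. s n + t n)"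
  by (simp_all add: padic_Cauchy_ring_def)

lemma CR_ring: "ring CR"
proof (rule ringI)
  show "abelian_group CR"
  proof (rule abelian_groupI)
    show "\<exists>y\<in>carrier CR. y \<oplus>\<^bsub>CR\<^esub> x = \<zero>\<^bsub>CR\<^esub>" if "x \<in> carrier CR" for x
      using that Cau_uminus unfolding CR_simps by (intro bexI[of _ "\<lambda>n. - x n"]) auto
  qed (use Cau_add Cau_const in \<open>auto simp: CR_simps add_ac\<close>)
  show "Group.monoid CR"
    by (rule monoidI) (use Cau_mult Cau_const in \<open>auto simp: CR_simps mult_ac\<close>)
qed (auto simp: CR_simps algebra_simps)

lemma Nul_ideal: "ideal Nul CR"
proof (rule idealI[OF CR_ring])
  show "subgroup Nul (add_monoid CR)"
  proof
    show "Nul \<subseteq> carrier (add_monoid CR)" by (auto simp: CR_simps Nul_iff)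
    show "x \<otimes>\<^bsub>add_monoid CR\<^esub> y \<in> Nul" if "x \<in> Nul" "y \<in> Nul" for x y
      using Nul_add[OF that] by (simp add: CR_simps)
    show "\<one>\<^bsub>add_monoid CR\<^esub> \<in> Nul" using Nul_eventually_zero[of 0 "\<lambda>_. 0"] by (simp add: CR_simps)
    fix x assume x: "x \<in> Nul"
    then have xc: "x \<in> carrier CR" by (simp add: CR_simps Nul_iff)
    interpret R: ring CR by (rule CR_ring)
    have "\<ominus>\<^bsub>CR\<^esub> x = (\<lambda>n. - x n)"
    proof (rule R.minus_equality)
      show "(\<lambda>n. - x n) \<oplus>\<^bsub>CR\<^esub> x = \<zero>\<^bsub>CR\<^esub>" by (simp add: CR_simps)
      show "x \<in> carrier CR" by fact
      show "(\<lambda>n. - x n) \<in> carrier CR" using xc Cau_uminus by (simp add: CR_simps)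
    qed
    then show "inv\<^bsub>add_monoid CR\<^esub> x \<in> Nul" using Nul_uminus[OF x] by (simp add: a_inv_def)
  qed
next
  fix a x assume "a \<in> Nul" "x \<in> carrier CR"
  then show "x \<otimes>\<^bsub>CR\<^esub> a \<in> Nul" "a \<otimes>\<^bsub>CR\<^esub> x \<in> Nul"
    using Nul_mult[of a x] by (simp_all add: CR_simps mult.commute)
qed

text \<open>A Cauchy sequence that does not converge to 0 stays away from 0 infinitely often, and by the ultrametric inequality
  nearby terms have the same absolute value.\<close>

lemma not_null_constant:
  assumes s: "s \<in> Cau" "s \<notin> Nul"
  shows "\<exists>N. s N \<noteq> 0 \<and> (\<forall>n\<ge>N. nrm (s n) = nrm (s N))"
proof -
  obtain e where e: "e > 0" "\<And>N. \<exists>n\<ge>N. nrm (s n) \<ge> e"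
    using s unfolding Nul_iff by (auto simp: not_less)
  obtain N where N: "\<And>m n. m \<ge> N \<Longrightarrow> n \<ge> N \<Longrightarrow> nrm (s m - s n) < e"
    using s(1) e(1) unfolding padic_Cauchy_def mem_Collect_eq by meson
  obtain M where M: "M \<ge> N" "nrm (s M) \<ge> e" using e(2) by blast
  have "nrm (s n) = nrm (s M)" if "n \<ge> M" for n
    by (rule nrm_eqI) (use N[of n M] M that in auto)
  moreover have "s M \<noteq> 0" using M(2) e(1) by auto
  ultimately show ?thesis by blast
qed

end

text \<open>An embedding of the \<open>p\<close>-adic numbers into a field.\<close>

locale padic_hom = prime_number p for p :: nat +
  fixes \<iota> :: "(nat \<Rightarrow> rat) set \<Rightarrow> 'a::field"
  assumes iota: "\<iota> \<in> ring_hom (Q_padic p) (ring_of_type_algebra :: 'a ring)"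
begin

definition \<psi> :: "(nat \<Rightarrow> rat) \<Rightarrow> 'a" where "\<psi> s = \<iota> (Nul +>\<^bsub>CR\<^esub> s)"

lemma psi_ring_hom: "\<psi> \<in> ring_hom CR (ring_of_type_algebra :: 'a ring)"
proof -
  have "(\<lambda>s. Nul +>\<^bsub>CR\<^esub> s) \<in> ring_hom CR (Q_padic p)"
    using ideal.rcos_ring_hom[OF Nul_ideal] by (simp add: Q_padic_def)
  from ring_hom_trans[OF this iota] show ?thesis unfolding \<psi>_def[abs_def] comp_def .
qed

lemma psi_add: "s \<in> Cau \<Longrightarrow> t \<in> Cau \<Longrightarrow> \<psi> (\<lambda>n. s n + t n) = \<psi> s + \<psi> t"
  using ring_hom_add[OF psi_ring_hom, of s t] by (simp add: CR_simps ring_of_type_algebra_def)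

lemma psi_mult: "s \<in> Cau \<Longrightarrow> t \<in> Cau \<Longrightarrow> \<psi> (\<lambda>n. s n * t n) = \<psi> s * \<psi> t"
  using ring_hom_mult[OF psi_ring_hom, of s t] by (simp add: CR_simps ring_of_type_algebra_def)

lemma psi_1: "\<psi> (\<lambda>n. 1) = 1"
  using ring_hom_one[OF psi_ring_hom] by (simp add: CR_simps ring_of_type_algebra_def)

definition \<rho> :: "rat \<Rightarrow> 'a" where "\<rho> c = \<psi> (\<lambda>n. c)"

lemma rat_hom_rho: "rat_hom \<rho>"
  unfolding rat_hom_def \<rho>_def using psi_1 psi_add[OF Cau_const Cau_const] psi_mult[OF Cau_const Cau_const] by simp

lemmas rho = rat_homD[OF rat_hom_rho]

lemma psi_uminus: "s \<in> Cau \<Longrightarrow> \<psi> (\<lambda>n. - s n) = - \<psi> s"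
  using psi_mult[OF Cau_const[of "-1"], of s] rho(5)[of 1] rho(2) by (simp add: \<rho>_def)

lemma psi_diff: "s \<in> Cau \<Longrightarrow> t \<in> Cau \<Longrightarrow> \<psi> (\<lambda>n. s n - t n) = \<psi> s - \<psi> t"
  using psi_add[OF _ Cau_uminus, of s t] psi_uminus[of t] by simp

lemma psi_null: assumes "s \<in> Nul" shows "\<psi> s = 0"
proof -
  have "Nul +>\<^bsub>CR\<^esub> s = Nul +>\<^bsub>CR\<^esub> (\<lambda>n. 0)"
  proof -
    interpret ideal Nul CR by (rule Nul_ideal)
    have "(\<lambda>n. 0) \<in> Nul" using Nul_eventually_zero[of 0 "\<lambda>_. 0"] by simp
    then show ?thesis using a_rcos_const assms by metis
  qed
  then have "\<psi> s = \<rho> 0" by (simp add: \<psi>_def \<rho>_def)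
  then show ?thesis by (simp add: rho)
qed

lemma psi_eqI: assumes "s \<in> Cau" "t \<in> Cau" "(\<lambda>n. s n - t n) \<in> Nul" shows "\<psi> s = \<psi> t"
  using psi_null[OF assms(3)] psi_diff[OF assms(1,2)] by simp

lemma psi_power: "s \<in> Cau \<Longrightarrow> (\<lambda>n. s n ^ k) \<in> Cau \<and> \<psi> (\<lambda>n. s n ^ k) = \<psi> s ^ k"
proof (induction k)
  case 0
  show ?case using psi_1 Cau_const by simp
next
  case (Suc k)
  then have "(\<lambda>n. s n ^ k) \<in> Cau" "\<psi> (\<lambda>n. s n ^ k) = \<psi> s ^ k" by blast+
  with Cau_mult[OF Suc.prems this(1)] psi_mult[OF Suc.prems this(1)] show ?case by simp
qed

definition Zp :: "'a set" where "Zp = \<psi> ` {s \<in> Cau. \<forall>n. nrm (s n) \<le> 1}"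

lemma tail: assumes "s \<in> Cau" shows "(\<lambda>n. s (max n N)) \<in> Cau" "\<psi> (\<lambda>n. s (max n N)) = \<psi> s"
proof -
  have "(\<lambda>n. s (max n N) - s n) \<in> Nul" by (rule Nul_eventually_zero[of N]) (simp add: max_def)
  moreover from this have "(\<lambda>n. (s (max n N) - s n) + s n) \<in> Cau"
    using assms by (intro Cau_add) (auto simp: Nul_iff)
  then show 1: "(\<lambda>n. s (max n N)) \<in> Cau" by simp
  ultimately show "\<psi> (\<lambda>n. s (max n N)) = \<psi> s" using assms by (intro psi_eqI)
qed

lemma termwise_inverse:
  assumes u: "u \<in> Cau" "\<And>n. nrm (u n) = 1"
  shows "(\<lambda>n. inverse (u n)) \<in> Cau" "\<psi> u * \<psi> (\<lambda>n. inverse (u n)) = 1"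
proof -
  have u0: "u n \<noteq> 0" for n using u(2)[of n] by auto
  have "nrm (inverse (u m) - inverse (u n)) = nrm (u m - u n)" for m n
  proof -
    have "inverse (u m) - inverse (u n) = (u n - u m) * (inverse (u m) * inverse (u n))"
      using u0[of m] u0[of n] by (simp add: field_simps)
    then have "nrm (inverse (u m) - inverse (u n)) = nrm (u n - u m)" by (simp add: nrm_mult nrm_inverse u(2))
    then show ?thesis by (simp add: nrm_diff_commute)
  qed
  then show C: "(\<lambda>n. inverse (u n)) \<in> Cau" using u(1) by (simp add: padic_Cauchy_def)
  show "\<psi> u * \<psi> (\<lambda>n. inverse (u n)) = 1"
    unfolding psi_mult[OF u(1) C, symmetric] using u0 psi_1 by simp
qed

text \<open>Replacing finitely many terms, all terms of the sequence have the same absolute value \<open>p\<^sup>-\<^sup>j\<close>. Then dividing by \<open>p\<^sup>j\<close> and taking inverses termwise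
  preserves Cauchy sequences.\<close>

lemma psi_decomp:
  assumes s: "s \<in> Cau" "\<psi> s \<noteq> 0"
  shows "\<exists>u\<in>Cau. \<exists>u'\<in>Cau. \<exists>j. (\<forall>n. nrm (u n) = 1) \<and> (\<forall>n. nrm (u' n) = 1) \<and> \<psi> u * \<psi> u' = 1 \<and> \<psi> s = \<psi> u * of_nat p powi j"
proof -
  have "s \<notin> Nul" using s psi_null by auto
  then obtain N where N: "s N \<noteq> 0" "\<And>n. n \<ge> N \<Longrightarrow> nrm (s n) = nrm (s N)" using not_null_constant[OF s(1)] by blast
  obtain j where j: "nrm (s N * of_nat p powi (- j)) = 1" using nrm_decomp[OF N(1)] by blast
  define u where "u n = s (max n N) * of_nat p powi (- j)" for n
  have uC: "u \<in> Cau" unfolding u_def[abs_def] by (rule Cau_mult[OF tail(1)[OF s(1)] Cau_const])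
  have u1: "nrm (u n) = 1" for n
    using j N(2)[of "max n N"] by (simp add: u_def nrm_mult)
  note u' = termwise_inverse[OF uC u1]
  have u'1: "nrm (inverse (u n)) = 1" for n by (simp add: nrm_inverse u1)
  have "\<psi> u = \<psi> s * \<rho> (of_nat p powi (- j))"
    using psi_mult[OF tail(1)[OF s(1), of N] Cau_const[of "of_nat p powi (- j)"]] tail(2)[OF s(1), of N]
    by (simp add: u_def[abs_def] \<rho>_def)
  moreover have "of_nat p \<noteq> (0 :: 'a)" using rho(8)[of "of_nat p"] p_gt_1 by (auto simp: rho(9))
  ultimately have "\<psi> s = \<psi> u * of_nat p powi j"
    by (simp add: rho power_int_minus)
  then show ?thesis
    by (intro bexI[OF _ uC] bexI[OF _ u'(1)] exI[of _ j] conjI allI u1 u'1 u'(2))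
qed

lemma completion_padic_subfield: "padic_subfield (\<psi> ` Cau) Zp p"
proof -
  have p0: "(of_nat p :: rat) \<noteq> 0" "of_nat p \<noteq> (0 :: 'a)"
    using p_gt_1 rho(8)[of "of_nat p"] by (auto simp: rho(9))
  have ZpI: "\<psi> s \<in> Zp" if "s \<in> Cau" "\<And>n. nrm (s n) \<le> 1" for s using that by (auto simp: Zp_def)
  show ?thesis
  proof
    show "sub_field (\<psi> ` Cau)"
      unfolding sub_field_def
    proof (intro conjI ballI)
      show "0 \<in> \<psi> ` Cau" unfolding rho(1)[symmetric] \<rho>_def by (rule imageI[OF Cau_const])
      show "1 \<in> \<psi> ` Cau" unfolding rho(2)[symmetric] \<rho>_def by (rule imageI[OF Cau_const])
      fix x y assume "x \<in> \<psi> ` Cau" "y \<in> \<psi> ` Cau"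
      then obtain s t where st: "s \<in> Cau" "t \<in> Cau" "x = \<psi> s" "y = \<psi> t" by auto
      show "x - y \<in> \<psi> ` Cau" unfolding st(3,4) psi_diff[OF st(1,2), symmetric] by (rule imageI[OF Cau_diff[OF st(1,2)]])
      show "x * y \<in> \<psi> ` Cau" unfolding st(3,4) psi_mult[OF st(1,2), symmetric] by (rule imageI[OF Cau_mult[OF st(1,2)]])
    next
      fix x assume "x \<in> \<psi> ` Cau"
      then obtain s where s: "s \<in> Cau" "x = \<psi> s" by auto
      show "inverse x \<in> \<psi> ` Cau"
      proof (cases "x = 0")
        case True
        then have "inverse x = \<rho> 0" by (simp add: rho(1))
        then show ?thesis unfolding \<rho>_def using imageI[OF Cau_const] by simp
      next
        case False
        then obtain u u' j where u: "u \<in> Cau" "u' \<in> Cau" "\<psi> u * \<psi> u' = 1" "\<psi> s = \<psi> u * of_nat p powi j"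
          using psi_decomp[OF s(1)] s(2) by blast
        have "inverse x = \<psi> u' * \<rho> (of_nat p powi (- j))"
          using u(3) inverse_unique[OF u(3)] by (simp add: s(2) u(4) rho power_int_minus)
        also have "\<dots> = \<psi> (\<lambda>n. u' n * of_nat p powi (- j))"
          unfolding \<rho>_def using psi_mult[OF u(2) Cau_const] by simp
        finally show ?thesis using imageI[OF Cau_mult[OF u(2) Cau_const], of \<psi>] by simp
      qed
    qed
    show "sub_ring Zp"
      unfolding sub_ring_def
    proof (intro conjI ballI)
      show "1 \<in> Zp" unfolding psi_1[symmetric] by (rule ZpI[OF Cau_const]) (simp add: nrm_1)
      fix x y assume "x \<in> Zp" "y \<in> Zp"
      then obtain s t where st: "s \<in> Cau" "t \<in> Cau" "x = \<psi> s" "y = \<psi> t" "\<And>n. nrm (s n) \<le> 1" "\<And>n. nrm (t n) \<le> 1"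
        by (auto simp: Zp_def)
      have "nrm (s n - t n) \<le> 1" for n using nrm_diff[of "s n" "t n"] st(5,6)[of n] by auto
      then show "x - y \<in> Zp" unfolding st(3,4) psi_diff[OF st(1,2), symmetric] by (rule ZpI[OF Cau_diff[OF st(1,2)]])
      have "nrm (s n * t n) \<le> 1" for n unfolding nrm_mult using st nrm_nonneg by (intro mult_le_one)
      then show "x * y \<in> Zp" unfolding st(3,4) psi_mult[OF st(1,2), symmetric] by (rule ZpI[OF Cau_mult[OF st(1,2)]])
    qed
    show "of_nat p \<noteq> (0 :: 'a)" by (rule p0)
    show "inverse (of_nat p) \<notin> Zp"
    proof
      assume "inverse (of_nat p) \<in> Zp"
      then obtain s where s: "s \<in> Cau" "\<psi> s = inverse (of_nat p)" "\<And>n. nrm (s n) \<le> 1" by (auto simp: Zp_def)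
      define t where "t n = of_nat p * s n - 1" for n
      have tC: "t \<in> Cau" unfolding t_def[abs_def] by (rule Cau_diff[OF Cau_mult[OF Cau_const s(1)] Cau_const])
      have "\<psi> t = \<rho> (of_nat p) * \<psi> s - 1"
        unfolding t_def \<rho>_def using psi_diff[OF Cau_mult[OF Cau_const s(1)] Cau_const] psi_mult[OF Cau_const s(1)] psi_1 by simp
      then have "\<psi> t = 0" using p0 s(2) by (simp add: rho)
      have n1: "nrm (t n) = 1" for n
      proof -
        have "nrm (t n - (-1)) = nrm (of_nat p) * nrm (s n)" by (simp add: t_def nrm_mult)
        also have "\<dots> \<le> (1 / real p) * 1" unfolding nrm_p using s(3) nrm_nonneg by (intro mult_left_mono) auto
        also have "\<dots> < 1" using p_gt_1 by simp
        also have "1 = nrm (-1)" by (simp add: nrm_uminus nrm_1)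
        finally have "nrm (t n) = nrm (-1)" by (rule nrm_eqI)
        then show ?thesis by (simp add: nrm_uminus nrm_1)
      qed
      show False using termwise_inverse(2)[OF tC n1] \<open>\<psi> t = 0\<close> by simp
    qed
    fix x assume "x \<in> \<psi> ` Cau" "x \<noteq> 0"
    then obtain s where s: "s \<in> Cau" "x = \<psi> s" "\<psi> s \<noteq> 0" by auto
    from psi_decomp[OF s(1,3)] obtain u u' j where u: "u \<in> Cau" "u' \<in> Cau" "\<psi> u * \<psi> u' = 1" "\<psi> s = \<psi> u * of_nat p powi j"
       "\<And>n. nrm (u n) = 1" "\<And>n. nrm (u' n) = 1" by blast
    have "inverse (\<psi> u) = \<psi> u'" using inverse_unique[OF u(3)] .
    then show "\<exists>u\<in>Zp. \<exists>j. u \<noteq> 0 \<and> inverse u \<in> Zp \<and> x = u * of_nat p powi j"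
      using u ZpI s(2) by (intro bexI[of _ "\<psi> u"] exI[of _ j]) auto
  next
    fix x assume "x \<in> Zp"
    then obtain s where s: "s \<in> Cau" "x = \<psi> s" "\<And>n. nrm (s n) \<le> 1" by (auto simp: Zp_def)
    obtain N where N: "\<And>m n. m \<ge> N \<Longrightarrow> n \<ge> N \<Longrightarrow> nrm (s m - s n) < 1"
      using s(1) unfolding padic_Cauchy_def mem_Collect_eq by (meson zero_less_one)
    obtain a where a: "a < p" "nrm (s N - of_nat a) \<le> 1 / real p" using nrm_residue[OF s(3)] by blast
    define y where "y n = (s (max n N) - of_nat a) * inverse (of_nat p)" for n
    have yC: "y \<in> Cau" unfolding y_def[abs_def] by (rule Cau_mult[OF Cau_diff[OF tail(1)[OF s(1)] Cau_const] Cau_const])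
    have "nrm (y n) \<le> 1" for n
    proof -
      have "nrm (s (max n N) - s N) \<le> 1 / real p" using N by (intro nrm_lt_1) simp
      then have "nrm (s (max n N) - of_nat a) \<le> 1 / real p"
        using nrm_add[of "s (max n N) - s N" "s N - of_nat a"] a(2) by simp
      then show ?thesis unfolding y_def by (rule nrm_div_p)
    qed
    then have yZ: "\<psi> y \<in> Zp" using yC by (intro ZpI)
    have "of_nat a + of_nat p * \<psi> y = \<psi> (\<lambda>n. of_nat a + of_nat p * y n)"
      using psi_add[OF Cau_const Cau_mult[OF Cau_const yC]] psi_mult[OF Cau_const yC] rho(9) unfolding \<rho>_def by simp
    also have "\<dots> = \<psi> (\<lambda>n. s (max n N))" unfolding y_def mult_div_p by simp
    also have "\<dots> = x" using tail(2)[OF s(1)] s(2) by simp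
    finally show "\<exists>n<p. \<exists>y\<in>Zp. x = of_nat n + of_nat p * y" using a(1) yZ by metis
  qed
qed

lemma char_0: "CHAR('a) = 0"
proof (rule ccontr)
  assume "CHAR('a) \<noteq> 0"
  moreover have "\<rho> (of_nat (CHAR('a))) = 0" by (simp only: rho(9) of_nat_CHAR)
  ultimately show False using rho(8)[of "of_nat (CHAR('a))"] by simp
qed

text \<open>Since \<open>a\<close> is congruent to 1 modulo \<open>p\<close>, its powers modulo \<open>p\<^sup>n\<close> depend only on the exponent modulo \<open>p\<^sup>n\<close>. So \<open>a^(e n)\<close>, where
  \<open>e n\<close> inverts \<open>Q\<close> modulo \<open>p\<^sup>n\<close>, is a Cauchy sequence, and its \<open>Q\<close>-th power converges to \<open>a\<close>.\<close>

lemma root_of_one_unit: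
  assumes a: "[a = 1] (mod p)" and Q: "coprime Q p"
  shows "\<exists>y. y ^ Q = (of_nat a :: 'a)"
proof -
  have "\<exists>e. [Q * e = 1] (mod p ^ n)" for n
    using cong_solve_coprime_nat[of Q "p ^ n"] Q by (cases n) (auto simp: coprime_power_right_iff)
  then obtain e where e: "\<And>n. [Q * e n = 1] (mod p ^ n)" by metis
  have ap: "[a ^ (p ^ n) = 1] (mod p ^ Suc n)" for n
  proof (induction n)
    case 0
    then show ?case using a by simp
  next
    case (Suc n)
    have d: "int p ^ Suc n dvd int a ^ (p ^ n) - 1"
      using Suc by (metis cong_iff_dvd_diff cong_int_iff of_nat_1 of_nat_power)
    define z where "z = int a ^ (p ^ n)"
    have z1: "[z = 1] (mod int p)"
      using d by (metis cong_iff_dvd_diff dvd_trans dvd_power z_def zero_less_Suc)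
    have "int p dvd (\<Sum>i<p. z ^ i)"
    proof -
      have "[(\<Sum>i<p. z ^ i) = (\<Sum>i<p. 1 ^ i)] (mod int p)" by (intro cong_sum cong_pow z1)
      also have "(\<Sum>i<p. 1 ^ i) = int p" by simp
      also have "[int p = 0] (mod int p)" by (simp add: cong_def)
      finally show ?thesis by (simp only: cong_0_iff)
    qed
    then have "int p ^ Suc n * int p dvd (z - 1) * (\<Sum>i<p. z ^ i)" using d by (intro mult_dvd_mono) (simp_all add: z_def)
    also have "(z - 1) * (\<Sum>i<p. z ^ i) = z ^ p - 1" by (simp add: power_diff_1_eq)
    also have "z ^ p = int a ^ (p ^ Suc n)" by (simp add: z_def power_mult[symmetric] mult.commute)
    finally have "[int a ^ (p ^ Suc n) = 1] (mod int p ^ Suc (Suc n))" by (simp add: cong_iff_dvd_diff mult.commute)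
    then show ?case by (metis cong_int_iff of_nat_1 of_nat_power)
  qed
  have periodic: "[a ^ i = a ^ j] (mod p ^ n)" if "[i = j] (mod p ^ n)" for i j n
  proof -
    have *: "[a ^ i = a ^ j] (mod p ^ n)" if ij: "[i = j] (mod p ^ n)" "i \<le> j" for i j
    proof -
      obtain k where "j = k * p ^ n + i"
        using cong_le_nat[OF ij(2)] cong_sym[OF ij(1)] by blast
      then have k: "j = i + p ^ n * k" by simp
      have "[a ^ (p ^ n) = 1] (mod p ^ n)" by (rule cong_dvd_modulus_nat[OF ap[of n]]) (simp add: le_imp_power_dvd)
      then have "[a ^ i * (a ^ (p ^ n)) ^ k = a ^ i * 1 ^ k] (mod p ^ n)" by (intro cong_mult cong_pow cong_refl)
      then show ?thesis by (simp add: k power_add power_mult cong_sym)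
    qed
    show ?thesis using *[of i j] *[of j i] that by (metis cong_sym nat_le_linear)
  qed
  have nrm_cong: "nrm (of_nat x - of_nat y) \<le> (1 / real p) ^ n" if "[x = y] (mod p ^ n)" for x y n
  proof -
    have "int p ^ n dvd int x - int y" using that by (metis cong_iff_dvd_diff cong_int_iff of_nat_power)
    from nrm_of_int_dvd[OF this] show ?thesis by simp
  qed
  define s :: "nat \<Rightarrow> rat" where "s n = of_nat (a ^ e n)" for n
  have small: "\<exists>N. \<forall>n\<ge>N. (1 / real p) ^ n < \<epsilon>" if "\<epsilon> > 0" for \<epsilon>
  proof -
    have "(\<lambda>n. (1 / real p) ^ n) \<longlonglongrightarrow> 0" using p_gt_1 by (intro LIMSEQ_realpow_zero) auto
    then show ?thesis using that unfolding LIMSEQ_iff by fastforce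
  qed
  have ee: "[e m = e n] (mod p ^ k)" if "k \<le> m" "k \<le> n" for k m n
  proof -
    have "[Q * e m = 1] (mod p ^ k)" "[Q * e n = 1] (mod p ^ k)"
      using e[of m] e[of n] that by (metis cong_dvd_modulus_nat le_imp_power_dvd)+
    then have "[Q * e m = Q * e n] (mod p ^ k)" by (metis cong_sym cong_trans)
    moreover have "coprime Q (p ^ k)" using Q by (simp add: coprime_power_right_iff)
    ultimately show ?thesis by (simp add: cong_mult_lcancel_nat)
  qed
  have sC: "s \<in> Cau" unfolding padic_Cauchy_def mem_Collect_eq
  proof (intro allI impI)
    fix \<epsilon> :: real assume "\<epsilon> > 0"
    then obtain N where N: "\<And>n. n \<ge> N \<Longrightarrow> (1 / real p) ^ n < \<epsilon>" using small by blast
    have "nrm (s m - s n) < \<epsilon>" if "m \<ge> N" "n \<ge> N" for m n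
      using nrm_cong[OF periodic[OF ee[OF that]]] N[of N] unfolding s_def by simp
    then show "\<exists>N. \<forall>m\<ge>N. \<forall>n\<ge>N. nrm (s m - s n) < \<epsilon>" by blast
  qed
  have "(\<lambda>n. s n ^ Q - of_nat a) \<in> Nul" unfolding Nul_iff
  proof (intro conjI allI impI)
    show "(\<lambda>n. s n ^ Q - of_nat a) \<in> Cau" using Cau_diff[OF conjunct1[OF psi_power[OF sC]] Cau_const] .
    fix \<epsilon> :: real assume "\<epsilon> > 0"
    then obtain N where N: "\<And>n. n \<ge> N \<Longrightarrow> (1 / real p) ^ n < \<epsilon>" using small by blast
    have "nrm (s n ^ Q - of_nat a) < \<epsilon>" if "n \<ge> N" for n
    proof -
      have "[a ^ (Q * e n) = a ^ 1] (mod p ^ n)" by (rule periodic[OF e])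
      from nrm_cong[OF this] have "nrm (s n ^ Q - of_nat a) \<le> (1 / real p) ^ n"
        by (simp add: s_def power_mult[symmetric] mult.commute)
      then show ?thesis using N[OF that] by simp
    qed
    then show "\<exists>N. \<forall>n\<ge>N. nrm (s n ^ Q - of_nat a) < \<epsilon>" by blast
  qed
  then have "\<psi> (\<lambda>n. s n ^ Q) = \<rho> (of_nat a)"
    unfolding \<rho>_def by (rule psi_eqI[OF conjunct1[OF psi_power[OF sC]] Cau_const])
  then show ?thesis using psi_power[OF sC, of Q] by (metis rho(9))
qed

end

section \<open>The two ground fields\<close>

lemma spanned_by_of_finite_dimension:
  fixes F :: "'a::field set"
  assumes F: "sub_field F" and fd: "ring.finite_dimension (ring_of_type_algebra :: 'a ring) F E"
  shows "\<exists>e. spanned_by F e E"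
proof -
  let ?R = "ring_of_type_algebra :: 'a ring"
  interpret R: ring ?R by (rule ring_from_type_algebra)
  obtain n where "R.dimension n F E" using fd unfolding R.finite_dimension_def by blast
  then have "spanned_by F n E"
    using sub_fieldD(1)[OF F]
  proof (induction n F E rule: R.dimension.induct)
    case (zero_dim F)
    then show ?case by (auto simp: spanned_by_def ring_of_type_algebra_def intro: exI[of _ "\<lambda>_. 0"])
  next
    case (Suc_dim v E n F)
    then obtain b where b: "\<forall>x\<in>E. \<exists>f. (\<forall>l. f l \<in> F) \<and> x = (\<Sum>l<n. f l * b l)" unfolding spanned_by_def by blast
    have "\<exists>f. (\<forall>l. f l \<in> F) \<and> x = (\<Sum>l<Suc n. f l * (b(n := v)) l)" if x: "x \<in> R.line_extension F v E" for x
    proof -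
      obtain k y where ky: "k \<in> F" "y \<in> E" "x = k * v + y"
        using x unfolding R.line_extension_def set_add_def' r_coset_def by (auto simp: ring_of_type_algebra_def)
      obtain f where f: "\<forall>l. f l \<in> F" "y = (\<Sum>l<n. f l * b l)" using b ky(2) by blast
      have "x = (\<Sum>l<Suc n. (f(n := k)) l * (b(n := v)) l)"
        by (simp add: ky(3) f(2))
      then show ?thesis using f(1) ky(1) by (intro exI[of _ "f(n := k)"]) auto
    qed
    then show ?case unfolding spanned_by_def by blast
  qed
  then show ?thesis by blast
qed

lemma sub_field_range_to_ac: "sub_field (range (to_ac :: 'a::field \<Rightarrow> 'a alg_closure))"
  unfolding sub_field_def
proof (intro conjI ballI)
  show "0 \<in> range (to_ac :: 'a \<Rightarrow> _)" "1 \<in> range (to_ac :: 'a \<Rightarrow> _)"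
    by (metis rangeI to_ac_0, metis rangeI to_ac_1)
  fix x y :: "'a alg_closure" assume "x \<in> range to_ac" "y \<in> range to_ac"
  then obtain a b where ab: "x = to_ac a" "y = to_ac b" by auto
  show "x - y \<in> range to_ac" "x * y \<in> range to_ac"
    unfolding ab to_ac_diff[symmetric] to_ac_mult[symmetric] by (rule rangeI)+
next
  fix x :: "'a alg_closure" assume "x \<in> range to_ac"
  then obtain a where "x = to_ac a" by auto
  then show "inverse x \<in> range to_ac" unfolding \<open>x = to_ac a\<close> to_ac_inverse[symmetric] by (intro rangeI)
qed

text \<open>Everything is transported from \<open>K\<close> to its algebraic closure, where the eigenvalues live.\<close>

lemma base_field_data:
  assumes p: "normalization_semidom_class.prime p"
    and k: "number_field TYPE('k::field) \<or> padic_local_field p TYPE('k)"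
  shows "CHAR('k alg_closure) = 0"
    "\<exists>F B e. padic_subfield F B p \<and> spanned_by F e (range (to_ac :: 'k \<Rightarrow> 'k alg_closure))"
proof -
  interpret prime_number p by unfold_locales (rule p)
  have span: "\<exists>e. spanned_by (to_ac ` F) e (range (to_ac :: 'k \<Rightarrow> 'k alg_closure))" if sp: "\<exists>e. spanned_by F e (UNIV :: 'k set)" for F
  proof -
    obtain e :: nat and b where b: "\<forall>x. \<exists>f. (\<forall>l. f l \<in> F) \<and> x = (\<Sum>l<e. f l * (b l :: 'k))" using sp unfolding spanned_by_def by blast
    have "\<exists>f. (\<forall>l. f l \<in> to_ac ` F) \<and> to_ac x = (\<Sum>l<e. f l * to_ac (b l))" for x
    proof -
      obtain f where "\<forall>l. f l \<in> F" "x = (\<Sum>l<e. f l * b l)" using b by blast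
      then show ?thesis by (intro exI[of _ "\<lambda>l. to_ac (f l)"]) (auto simp: to_ac_sum)
    qed
    then show ?thesis unfolding spanned_by_def
      by (intro exI[of _ e] exI[of _ "\<lambda>l. to_ac (b l)"]) auto
  qed
  have "CHAR('k) = 0 \<and> (\<exists>F B e. padic_subfield F B p \<and> spanned_by F e (range (to_ac :: 'k \<Rightarrow> 'k alg_closure)))"
    using k
  proof
    assume "number_field TYPE('k)"
    then obtain \<iota> where i: "\<iota> \<in> ring_hom (ring_of_type_algebra :: rat ring) (ring_of_type_algebra :: 'k ring)"
      "ring.finite_dimension (ring_of_type_algebra :: 'k ring) (\<iota> ` UNIV) UNIV"
      unfolding number_field_def finite_extension_of_def by (auto simp: ring_of_type_algebra_def)
    have h: "rat_hom \<iota>"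
      unfolding rat_hom_def using ring_hom_add[OF i(1)] ring_hom_mult[OF i(1)] ring_hom_one[OF i(1)]
      by (simp add: ring_of_type_algebra_def)
    have h': "rat_hom (\<lambda>x. to_ac (\<iota> x))"
      using h unfolding rat_hom_def by simp
    have c: "CHAR('k) = 0"
    proof (rule ccontr)
      assume "CHAR('k) \<noteq> 0"
      moreover have "\<iota> (of_nat (CHAR('k))) = 0" by (simp only: rat_homD(9)[OF h] of_nat_CHAR)
      ultimately show False using rat_homD(8)[OF h, of "of_nat (CHAR('k))"] by simp
    qed
    have r: "to_ac ` range \<iota> = range (\<lambda>x. to_ac (\<iota> x))" by auto
    have "sub_field (range \<iota>)" using rat_padic_subfield[OF h] by (simp add: padic_subfield_def)
    from span[OF spanned_by_of_finite_dimension[OF this i(2)]] show ?thesis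
      using rat_padic_subfield[OF h'] c unfolding r by blast
  next
    assume "padic_local_field p TYPE('k)"
    then obtain \<iota> where i: "\<iota> \<in> ring_hom (Q_padic p) (ring_of_type_algebra :: 'k ring)"
      "ring.finite_dimension (ring_of_type_algebra :: 'k ring) (\<iota> ` carrier (Q_padic p)) UNIV"
      unfolding padic_local_field_def finite_extension_of_def by auto
    interpret A: padic_hom p \<iota> by unfold_locales (rule i)
    have j: "(\<lambda>x. to_ac (\<iota> x)) \<in> ring_hom (Q_padic p) (ring_of_type_algebra :: 'k alg_closure ring)"
      by (rule ring_hom_memI)
         (use ring_hom_add[OF i(1)] ring_hom_mult[OF i(1)] ring_hom_one[OF i(1)] in \<open>simp_all add: ring_of_type_algebra_def\<close>)
    interpret C: padic_hom p "\<lambda>x. to_ac (\<iota> x)" by unfold_locales (rule j)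
    have r: "\<iota> ` carrier (Q_padic p) = A.\<psi> ` Cau"
      by (auto simp: Q_padic_def FactRing_def A_RCOSETS_def' A.\<psi>_def CR_simps)
    have r': "to_ac ` (A.\<psi> ` Cau) = C.\<psi> ` Cau"
      unfolding A.\<psi>_def C.\<psi>_def by (simp add: image_image)
    have "sub_field (A.\<psi> ` Cau)" using A.completion_padic_subfield by (simp add: padic_subfield_def)
    from span[OF spanned_by_of_finite_dimension[OF this i(2)[unfolded r]]] show ?thesis
      using C.completion_padic_subfield A.char_0 unfolding r' by blast
  qed
  then show "CHAR('k alg_closure) = 0"
    "\<exists>F B e. padic_subfield F B p \<and> spanned_by F e (range (to_ac :: 'k \<Rightarrow> 'k alg_closure))"
    using CHAR_alg_closure by auto
qed

text \<open>Roots of \<open>p\<^sup>m\<close> of arbitrarily high order: with \<open>m = 1\<close> in an algebraically closed field and in the reals. In a finite extension of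
  the \<open>q\<close>-adic numbers with a prime \<open>q \<noteq> p\<close>, take \<open>m = q - 1\<close> and orders congruent to 1 modulo \<open>q\<close>, so that \<open>root_of_one_unit\<close> applies.\<close>

lemma source_field_data:
  assumes p: "normalization_semidom_class.prime p"
    and l: "(algebraically_closed_field TYPE('l::field) \<and> CHAR('l) = 0) \<or> isomorphic_to_reals TYPE('l)
         \<or> (\<exists>l. normalization_semidom_class.prime l \<and> l \<noteq> p \<and> padic_local_field l TYPE('l))"
  shows "CHAR('l alg_closure) = 0" "\<exists>m>0. \<forall>b. \<exists>Q>b. \<exists>y\<in>range (to_ac :: 'l \<Rightarrow> 'l alg_closure). y ^ Q = of_nat p ^ m"
proof -
  have "CHAR('l) = 0 \<and> (\<exists>m>0. \<forall>b. \<exists>Q>b. \<exists>y::'l. y ^ Q = of_nat p ^ m)"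
    using l
  proof (elim disjE conjE exE)
    assume a: "algebraically_closed_field TYPE('l)" "CHAR('l) = 0"
    have "\<exists>y::'l. y ^ Suc b = of_nat p ^ 1" for b
    proof -
      define f :: "'l poly" where "f = Polynomial.monom 1 (Suc b) - [:of_nat p:]"
      have "Polynomial.coeff f (Suc b) = 1" by (simp add: f_def)
      then have "Polynomial.degree f \<ge> Suc b" by (intro le_degree) simp
      then obtain y where "poly f y = 0" using a(1) unfolding algebraically_closed_field_def by (metis Suc_le_lessD gr_zeroI not_less_zero)
      then show ?thesis by (intro exI[of _ y]) (simp add: f_def poly_monom)
    qed
    then show ?thesis using a(2) by (metis lessI zero_less_one)
  next
    assume "isomorphic_to_reals TYPE('l)"
    then obtain h where h: "h \<in> ring_hom (ring_of_type_algebra :: 'l ring) (ring_of_type_algebra :: real ring)" "bij h"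
      unfolding isomorphic_to_reals_def is_ring_iso_def ring_iso_def by (auto simp: ring_of_type_algebra_def)
    have ha: "h (x + y) = h x + h y" and hm: "h (x * y) = h x * h y" and h1: "h 1 = 1" for x y
      using ring_hom_add[OF h(1)] ring_hom_mult[OF h(1)] ring_hom_one[OF h(1)] by (simp_all add: ring_of_type_algebra_def)
    have h0: "h 0 = 0" using ha[of 0 0] by simp
    have hn: "h (of_nat n) = of_nat n" for n by (induction n) (simp_all add: h0 h1 ha)
    have hp: "h (y ^ n) = h y ^ n" for y n by (induction n) (simp_all add: h1 hm)
    have "CHAR('l) = 0"
    proof (rule ccontr)
      assume "CHAR('l) \<noteq> 0"
      moreover have "real (CHAR('l)) = 0" using hn[of "CHAR('l)"] by (simp only: of_nat_CHAR h0)
      ultimately show False by simp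
    qed
    moreover have "\<exists>y::'l. y ^ Suc b = of_nat p ^ 1" for b
    proof -
      obtain y where y: "h y = root (Suc b) (real p)" using h(2) by (metis bij_pointE)
      have "h (y ^ Suc b) = h (of_nat p ^ 1)" unfolding hp y hn by (simp del: power_Suc)
      then show ?thesis using h(2) by (metis bij_is_inj inj_eq)
    qed
    ultimately show ?thesis by (metis lessI zero_less_one)
  next
    fix q assume q: "normalization_semidom_class.prime q" "q \<noteq> p" "padic_local_field q TYPE('l)"
    then obtain \<iota> where i: "\<iota> \<in> ring_hom (Q_padic q) (ring_of_type_algebra :: 'l ring)"
      unfolding padic_local_field_def finite_extension_of_def by auto
    interpret A: padic_hom q \<iota> by unfold_locales (rule q, rule i)
    have q1: "q > 1" using q(1) by (rule prime_gt_1_nat)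
    have cop: "\<not> q dvd p" using p q by (metis primes_dvd_imp_eq)
    define m where "m = q - 1"
    have m0: "m > 0" using q1 by (simp add: m_def)
    have fermat: "[p ^ m = 1] (mod q)" unfolding m_def by (rule fermat_theorem[OF q(1) cop])
    have "\<exists>y::'l. y ^ (q * Suc b + 1) = of_nat p ^ m" for b
    proof -
      have "gcd q (q * Suc b + 1) = gcd q 1"
        using gcd_add_mult[of q "Suc b" 1] by (simp only: mult.commute add.commute)
      then have "coprime (q * Suc b + 1) q"
        by (metis coprime_commute coprime_iff_gcd_eq_1 gcd_1_nat)
      from A.root_of_one_unit[OF fermat this] show ?thesis by simp
    qed
    moreover have "q * Suc b + 1 > b" for b using q1 by (simp add: less_Suc_eq_le trans_le_add2)
    ultimately show ?thesis using A.char_0 m0 by blast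
  qed
  then obtain m where m: "CHAR('l) = 0" "m > 0" "\<And>b. \<exists>Q>b. \<exists>y::'l. y ^ Q = of_nat p ^ m" by blast
  show "CHAR('l alg_closure) = 0" using m(1) by simp
  have "\<exists>Q>b. \<exists>y\<in>range (to_ac :: 'l \<Rightarrow> 'l alg_closure). y ^ Q = of_nat p ^ m" for b
  proof -
    obtain Q and y :: 'l where "Q > b" "y ^ Q = of_nat p ^ m" using m(3) by blast
    then have "to_ac y ^ Q = of_nat p ^ m" by (simp flip: to_ac_power add: to_ac_of_nat)
       (simp only: to_ac_power to_ac_of_nat)
    then show ?thesis using \<open>Q > b\<close> by blast
  qed
  then show "\<exists>m>0. \<forall>b. \<exists>Q>b. \<exists>y\<in>range (to_ac :: 'l \<Rightarrow> 'l alg_closure). y ^ Q = of_nat p ^ m"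
    using m(2) by blast
qed

section \<open>Regular functions and Zariski closures\<close>

text \<open>Polynomial functions of the matrix entries, taken extensionally: sums and products are formed pointwise.\<close>

definition regular :: "('a::field^'n::finite^'n \<Rightarrow> 'a) \<Rightarrow> bool" where
  "regular F \<longleftrightarrow> (\<exists>f. \<forall>A. eval_at f A = F A)"

definition monom_val :: "(('n \<times> 'n) \<Rightarrow>\<^sub>0 nat) \<Rightarrow> 'a::field^'n::finite^'n \<Rightarrow> 'a" where
  "monom_val m A = (\<Prod>v\<in>UNIV. A $ fst v $ snd v ^ Poly_Mapping.lookup m v)"

lemma eval_at_monom_val: "eval_at f A = (\<Sum>m\<in>Poly_Mapping.keys f. Poly_Mapping.lookup f m * monom_val m A)"
  unfolding eval_at_def monom_val_def
  by (intro sum.cong refl arg_cong2[where f = times] prod.mono_neutral_left) (auto simp: in_keys_iff)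

lemma eval_at_superset:
  assumes "finite S" "Poly_Mapping.keys f \<subseteq> S"
  shows "eval_at f A = (\<Sum>m\<in>S. Poly_Mapping.lookup f m * monom_val m A)"
  unfolding eval_at_monom_val using assms by (intro sum.mono_neutral_left) (auto simp: in_keys_iff)

lemma eval_at_add: "eval_at (f + g) A = eval_at f A + eval_at g A"
proof -
  define S where "S = Poly_Mapping.keys f \<union> Poly_Mapping.keys g"
  have S: "finite S" "Poly_Mapping.keys f \<subseteq> S" "Poly_Mapping.keys g \<subseteq> S" "Poly_Mapping.keys (f + g) \<subseteq> S"
    unfolding S_def using Poly_Mapping.keys_add[of f g] by auto
  show ?thesis
    unfolding eval_at_superset[OF S(1,2)] eval_at_superset[OF S(1,3)] eval_at_superset[OF S(1,4)]
    by (simp add: lookup_add distrib_right sum.distrib)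
qed

lemma eval_at_single: "eval_at (Poly_Mapping.single m c) A = c * monom_val m A"
  by (subst eval_at_superset[of "{m}"]) auto

lemma monom_val_add: "monom_val (m + m') A = monom_val m A * monom_val m' A"
  by (simp add: monom_val_def lookup_add power_add prod.distrib)

lemma regular_add: "regular F \<Longrightarrow> regular G \<Longrightarrow> regular (\<lambda>A. F A + G A)"
  unfolding regular_def by (metis eval_at_add)

lemma regular_single: "regular (\<lambda>A. c * monom_val m A)"
  unfolding regular_def by (metis eval_at_single)

lemma regular_0: "regular (\<lambda>A. 0)"
  using regular_single[of 0] by simp

lemma regular_sum: "(\<And>i. i \<in> S \<Longrightarrow> regular (F i)) \<Longrightarrow> regular (\<lambda>A. \<Sum>i\<in>S. F i A)"
  by (induction S rule: infinite_finite_induct) (simp_all add: regular_0 regular_add)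

lemma regular_const: "regular (\<lambda>A. c)"
  using regular_single[of c 0] by (simp add: monom_val_def)

lemma regular_entry: "regular (\<lambda>A :: 'a::field^'n::finite^'n. A $ i $ j)"
proof -
  have "monom_val (Poly_Mapping.single (i, j) 1) A = A $ i $ j" for A :: "'a^'n^'n"
  proof -
    have "monom_val (Poly_Mapping.single (i, j) 1) A = (\<Prod>v\<in>{(i, j)}. A $ fst v $ snd v)"
      unfolding monom_val_def by (rule prod.mono_neutral_cong_right) (auto simp: lookup_single when_def)
    then show ?thesis by simp
  qed
  then have "(\<lambda>A :: 'a^'n^'n. A $ i $ j) = (\<lambda>A. 1 * monom_val (Poly_Mapping.single (i, j) 1) A)"
    by (intro ext) simp
  then show ?thesis using regular_single by metis
qed

text \<open>Expand both factors into monomials; the product is a finite sum of monomial functions.\<close>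

lemma regular_mult:
  assumes "regular F" "regular G"
  shows "regular (\<lambda>A. F A * G A)"
proof -
  obtain f g where fg: "\<And>A. eval_at f A = F A" "\<And>A. eval_at g A = G A" using assms unfolding regular_def by blast
  have "F A * G A = (\<Sum>m\<in>Poly_Mapping.keys f. \<Sum>m'\<in>Poly_Mapping.keys g. (Poly_Mapping.lookup f m * Poly_Mapping.lookup g m') * monom_val (m + m') A)" for A
    unfolding fg[symmetric] eval_at_monom_val by (simp add: sum_product monom_val_add mult_ac)
  then show ?thesis by (auto intro!: regular_sum regular_single)
qed

lemma regular_power: "regular F \<Longrightarrow> regular (\<lambda>A. F A ^ n)"
  by (induction n) (simp_all add: regular_const regular_mult)

lemma regular_prod: "(\<And>i. i \<in> S \<Longrightarrow> regular (F i)) \<Longrightarrow> regular (\<lambda>A. \<Prod>i\<in>S. F i A)"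
  by (induction S rule: infinite_finite_induct) (simp_all add: regular_const regular_mult)

lemma regular_eval_at_compose:
  assumes "\<And>i j. regular (\<lambda>A. \<Psi> A $ i $ j)"
  shows "regular (\<lambda>A. eval_at f (\<Psi> A))"
  unfolding eval_at_def by (intro regular_sum regular_mult regular_const regular_prod regular_power assms)

lemma zariski_closed_regular:
  assumes "\<And>F. F \<in> \<F> \<Longrightarrow> regular F"
  shows "zariski_closed {A \<in> carrier GL. \<forall>F\<in>\<F>. F A = 0}"
proof -
  have "{A \<in> carrier GL. \<forall>F\<in>\<F>. F A = 0} = {A \<in> carrier GL. \<forall>f\<in>{f. \<exists>F\<in>\<F>. eval_at f = F}. eval_at f A = 0}"
  proof (intro Collect_cong conj_cong refl iffI ballI)
    fix A f assume "\<forall>F\<in>\<F>. F A = 0" "f \<in> {f. \<exists>F\<in>\<F>. eval_at f = F}"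
    then show "eval_at f A = 0" by auto
  next
    fix A F assume h: "\<forall>f\<in>{f. \<exists>F\<in>\<F>. eval_at f = F}. eval_at f A = 0" "F \<in> \<F>"
    obtain f where "\<And>A. eval_at f A = F A" using assms[OF h(2)] unfolding regular_def by blast
    then have "eval_at f = F" by auto
    then show "F A = 0" using h by auto
  qed
  then show ?thesis unfolding zariski_closed_def by blast
qed

lemma Zcl_props:
  fixes G W :: "('a::alg_closed_field^'n::finite^'n) set"
  assumes G: "zariski_closed G" and W: "W \<subseteq> G"
  shows "zariski_closed (Zcl G W)" "W \<subseteq> Zcl G W" "Zcl G W \<subseteq> G"
    "\<And>S. zariski_closed S \<Longrightarrow> W \<subseteq> S \<Longrightarrow> Zcl G W \<subseteq> S"
proof -
  have inter: "zariski_closed (\<Inter>T)" if T: "T \<noteq> {}" "\<And>S. S \<in> T \<Longrightarrow> zariski_closed S" for T :: "('a^'n^'n) set set"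
  proof -
    define P where "P S = {f. \<forall>A\<in>S. eval_at f A = 0}" for S :: "('a^'n^'n) set"
    have P: "S = {A \<in> carrier GL. \<forall>f\<in>P S. eval_at f A = 0}" if S: "S \<in> T" for S
    proof -
      obtain Q where Q: "S = {A \<in> carrier GL. \<forall>f\<in>Q. eval_at f A = 0}"
        using T(2)[OF S] unfolding zariski_closed_def by blast
      then have "Q \<subseteq> P S" unfolding P_def by blast
      show ?thesis
      proof
        show "S \<subseteq> {A \<in> carrier GL. \<forall>f\<in>P S. eval_at f A = 0}" using Q unfolding P_def by auto
        show "{A \<in> carrier GL. \<forall>f\<in>P S. eval_at f A = 0} \<subseteq> S"
          using \<open>Q \<subseteq> P S\<close> by (subst (2) Q) auto
      qed
    qed
    have "\<Inter>T = {A \<in> carrier GL. \<forall>f\<in>\<Union>(P ` T). eval_at f A = 0}"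
    proof (rule equalityI; rule subsetI)
      fix A assume A: "A \<in> \<Inter>T"
      have "A \<in> carrier GL \<and> (\<forall>f\<in>P S. eval_at f A = 0)" if "S \<in> T" for S
        using A that P[OF that] by blast
      then show "A \<in> {A \<in> carrier GL. \<forall>f\<in>\<Union>(P ` T). eval_at f A = 0}" using T(1) by blast
    next
      fix A assume A: "A \<in> {A \<in> carrier GL. \<forall>f\<in>\<Union>(P ` T). eval_at f A = 0}"
      show "A \<in> \<Inter>T"
      proof
        fix S assume S: "S \<in> T"
        then have "A \<in> {A \<in> carrier GL. \<forall>f\<in>P S. eval_at f A = 0}" using A by blast
        then show "A \<in> S" using P[OF S] by blast
      qed
    qed
    then show ?thesis unfolding zariski_closed_def by blast
  qed
  have Z: "Zcl G W = \<Inter>{S. (zariski_closed S \<and> S \<subseteq> G) \<and> W \<subseteq> S}"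
    unfolding Zcl_def hull_def by simp
  show "zariski_closed (Zcl G W)" unfolding Z using G W by (intro inter) auto
  show "W \<subseteq> Zcl G W" "Zcl G W \<subseteq> G" unfolding Z using G W by auto
  fix S assume S: "zariski_closed S" "W \<subseteq> S"
  have "zariski_closed (\<Inter>{S, G})" using S G by (intro inter) auto
  then show "Zcl G W \<subseteq> S" unfolding Z using S W by auto
qed

lemma mat_of_simps:
  "mat_of (A * B) = mat_of A ** mat_of (B :: ('a::comm_ring_1, 'n::finite) sqmat)"
  "mat_of (1 :: ('a, 'n) sqmat) = mat 1"
  "mat_of A $ i $ j = ent A i j"
  by (transfer; simp)+

lemma sqm_mat_of [simp]: "mat_of (sqm A) = A" "sqm (mat_of B) = B"
  by (simp_all add: sqm_inverse mat_of_inverse)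

lemma sqm_mult: "sqm (A ** B) = sqm A * sqm (B :: 'a::comm_ring_1^'n::finite^'n)"
  by (metis mat_of_simps(1) sqm_mat_of)

lemma sqm_1: "sqm (mat 1 :: 'a::comm_ring_1^'n::finite^'n) = 1"
  by (metis mat_of_simps(2) sqm_mat_of(2))

lemma unipotent_matrix_iff: "unipotent_matrix A \<longleftrightarrow> (\<exists>k. (sqm A - 1) ^ k = 0)"
proof -
  have "(((**) (A - mat 1)) ^^ k) (mat 1) = mat_of ((sqm A - 1) ^ k)" for k
  proof (induction k)
    case (Suc k)
    have "mat_of (sqm A - 1) = A - mat 1" by (metis sqm_mat_of minus_sqmat.rep_eq mat_of_simps(2))
    then show ?case using Suc by (simp add: mat_of_simps)
  qed (simp add: mat_of_simps)
  moreover have "mat_of Y = 0 \<longleftrightarrow> Y = 0" for Y :: "('a, 'b) sqmat"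
    by (metis zero_sqmat.rep_eq sqm_mat_of(2))
  ultimately show ?thesis unfolding unipotent_matrix_def by simp
qed

lemma invertible_iff: "invertible A \<longleftrightarrow> (\<exists>B. sqm A * B = 1 \<and> B * sqm A = 1)" for A :: "'a::field^'n::finite^'n"
proof
  assume "invertible A"
  then obtain B where "A ** B = mat 1" "B ** A = mat 1" unfolding invertible_def by blast
  then show "\<exists>B. sqm A * B = 1 \<and> B * sqm A = 1" by (metis sqm_mult sqm_1)
next
  assume "\<exists>B. sqm A * B = 1 \<and> B * sqm A = 1"
  then obtain B where "sqm A * B = 1" "B * sqm A = 1" by blast
  then have "A ** mat_of B = mat 1" "mat_of B ** A = mat 1" by (metis sqm_mat_of(1) mat_of_simps)+
  then show "invertible A" unfolding invertible_def by blast
qed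

lemma group_GL: "group (GL :: ('a::field^'n::finite^'n) monoid)"
proof (rule groupI)
  show "\<one>\<^bsub>GL\<^esub> \<in> carrier (GL :: ('a^'n^'n) monoid)"
    unfolding GL_def invertible_def by (simp add: exI[of _ "mat 1"])
  fix A B C :: "'a^'n^'n"
  show "\<one>\<^bsub>GL\<^esub> \<otimes>\<^bsub>GL\<^esub> A = A" "A \<otimes>\<^bsub>GL\<^esub> B \<otimes>\<^bsub>GL\<^esub> C = A \<otimes>\<^bsub>GL\<^esub> (B \<otimes>\<^bsub>GL\<^esub> C)"
    by (simp_all add: GL_def matrix_mul_assoc)
  assume A: "A \<in> carrier GL"
  then show "\<exists>B\<in>carrier GL. B \<otimes>\<^bsub>GL\<^esub> A = \<one>\<^bsub>GL\<^esub>"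
    by (auto simp: GL_def invertible_def)
  assume "B \<in> carrier GL"
  with A show "A \<otimes>\<^bsub>GL\<^esub> B \<in> carrier GL"
    by (simp add: GL_def invertible_mult)
qed

section \<open>Rational points of unipotent groups\<close>

lemma eval_at_polynomial_path: "\<exists>q. \<forall>t. eval_at f (mat_of (ev t M)) = poly q t"
  for M :: "('a::field poly, 'n::finite) sqmat"
proof -
  define q where "q = (\<Sum>m\<in>Poly_Mapping.keys f. [:Poly_Mapping.lookup f m:] *
        (\<Prod>v\<in>Poly_Mapping.keys m. ent M (fst v) (snd v) ^ Poly_Mapping.lookup m v))"
  have "eval_at f (mat_of (ev t M)) = poly q t" for t
    unfolding eval_at_def q_def by (simp add: mat_of_simps ev_def poly_sum poly_prod)
  then show ?thesis by blast
qed

lemma binom_in_subfield: "sub_field L \<Longrightarrow> t \<in> L \<Longrightarrow> binom t k \<in> L"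
  by (induction k) (auto intro!: sub_fieldD(2-4,8,10) simp del: of_nat_Suc)

text \<open>An equation of \<open>U\<close> evaluated at \<open>x\<^sup>t\<close> is a polynomial in \<open>t\<close> that vanishes for all natural numbers \<open>t\<close>, hence for all \<open>t\<close>. Rationality over
  \<open>L\<close> can be read off the binomial series.\<close>

lemma rational_points_pw:
  fixes U :: "('l::field alg_closure^'m::finite^'m) set"
  assumes c0: "CHAR('l alg_closure) = 0" and U: "algebraic_group U" and x: "x \<in> sqm ` rational_points U"
    and u: "(x - 1) ^ N = 0" and t: "t \<in> range to_ac"
  shows "pw N x t \<in> sqm ` rational_points U"
proof -
  let ?L = "range (to_ac :: 'l \<Rightarrow> 'l alg_closure)"
  note L = sub_field_range_to_ac
  have xE: "x \<in> entries_in ?L" using x by (auto simp: rational_points_def entries_in_def ent.abs_eq)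
  have "pw N x t \<in> entries_in ?L"
    unfolding pw_def by (intro entries_in_ops[OF L] binom_in_subfield[OF L] t xE)
  then have e: "mat_of (pw N x t) $ i $ j \<in> ?L" for i j by (simp add: mat_of_simps entries_in_def)
  obtain P where P: "U = {A \<in> carrier GL. \<forall>f\<in>P. eval_at f A = 0}"
    using U unfolding algebraic_group_def zariski_closed_def by blast
  have xU: "mat_of x \<in> U" using x by (auto simp: rational_points_def)
  have pU: "mat_of (x ^ n) \<in> U" for n
  proof (induction n)
    case 0
    show ?case using U subgroup.one_closed[of U GL] by (simp add: algebraic_group_def mat_of_simps GL_def)
  next
    case (Suc n)
    then show ?case using U xU subgroup.m_closed[of U GL "mat_of x" "mat_of (x ^ n)"] by (simp add: algebraic_group_def mat_of_simps GL_def)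
  qed
  have "eval_at f (mat_of (pw N x t)) = 0" if f: "f \<in> P" for f
  proof -
    obtain q where q: "\<And>t. eval_at f (mat_of (ev t (Pw N x))) = poly q t" using eval_at_polynomial_path by blast
    have "poly q (of_nat n) = poly 0 (of_nat n)" for n
      using pU[of n] f unfolding q[symmetric] by (simp add: pw_of_nat[OF c0 u] P)
    from poly_eq_on_nat[OF c0 this] show ?thesis using q[of t] by simp
  qed
  moreover have "mat_of (pw N x t) \<in> carrier GL"
    using pw_inverse[OF c0 u, of t] unfolding GL_def by (auto simp: invertible_iff)
  ultimately have "mat_of (pw N x t) \<in> U" by (simp add: P)
  then have "mat_of (pw N x t) \<in> rational_points U" using e by (simp add: rational_points_def)
  then show ?thesis by (metis image_eqI sqm_mat_of(2))
qed

section \<open>Closures of commutative unipotent groups\<close>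

definition regular_map :: "(('a::field, 'n::finite) sqmat \<Rightarrow> ('a, 'n) sqmat) \<Rightarrow> bool" where
  "regular_map \<Psi> \<longleftrightarrow> (\<forall>i j. regular (\<lambda>A. ent (\<Psi> (sqm A)) i j))"

lemma regular_map_id: "regular_map (\<lambda>Y. Y)"
  unfolding regular_map_def by (simp add: ent.abs_eq regular_entry)

lemma regular_map_const: "regular_map (\<lambda>Y. C)"
  unfolding regular_map_def by (simp add: regular_const)

lemma regular_map_scl: "regular_map \<Psi> \<Longrightarrow> regular_map (\<lambda>Y. scl c (\<Psi> Y))"
  unfolding regular_map_def by (simp add: regular_const regular_mult)

lemma regular_map_mult: "regular_map \<Psi> \<Longrightarrow> regular_map \<Phi> \<Longrightarrow> regular_map (\<lambda>Y. \<Psi> Y * \<Phi> Y)"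
  unfolding regular_map_def ent_mult by (intro allI regular_sum regular_mult) blast+

lemma regular_map_add: "regular_map \<Psi> \<Longrightarrow> regular_map \<Phi> \<Longrightarrow> regular_map (\<lambda>Y. \<Psi> Y + \<Phi> Y)"
  unfolding regular_map_def by (simp add: regular_add)

lemma regular_map_diff: assumes "regular_map \<Psi>" "regular_map \<Phi>" shows "regular_map (\<lambda>Y. \<Psi> Y - \<Phi> Y)"
  using regular_map_add[OF assms(1) regular_map_scl[OF assms(2), of "-1"]] by simp

lemma regular_map_power: "regular_map \<Psi> \<Longrightarrow> regular_map (\<lambda>Y. \<Psi> Y ^ n)"
  by (induction n) (simp_all add: regular_map_const regular_map_mult)

lemma regular_map_sum: "(\<And>i. i \<in> S \<Longrightarrow> regular_map (\<Psi> i)) \<Longrightarrow> regular_map (\<lambda>Y. \<Sum>i\<in>S. \<Psi> i Y)"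
  by (induction S rule: infinite_finite_induct) (simp_all add: regular_map_const regular_map_add)

lemma regular_map_pw: "regular_map (\<lambda>Y. pw N Y t)"
  unfolding pw_def by (intro regular_map_sum regular_map_scl regular_map_power regular_map_diff regular_map_id regular_map_const)

lemma Zcl_equation:
  assumes G: "zariski_closed G" "W \<subseteq> G" and r: "regular_map \<Psi>" and W: "\<And>A. A \<in> W \<Longrightarrow> \<Psi> (sqm A) = 0" and A: "A \<in> Zcl G W"
  shows "\<Psi> (sqm A) = 0"
proof -
  define S where "S = {A \<in> carrier GL. \<forall>F\<in>{F. \<exists>i j. F = (\<lambda>A. ent (\<Psi> (sqm A)) i j)}. F A = 0}"
  have "zariski_closed S"
    unfolding S_def by (rule zariski_closed_regular) (use r in \<open>auto simp: regular_map_def\<close>)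
  moreover have "W \<subseteq> carrier GL" using G unfolding zariski_closed_def by blast
  then have "W \<subseteq> S" unfolding S_def using W by auto
  ultimately have "A \<in> S" using Zcl_props(4)[OF G] A by blast
  then have S: "\<forall>F\<in>{F. \<exists>i j. F = (\<lambda>A. ent (\<Psi> (sqm A)) i j)}. F A = 0" unfolding S_def by simp
  have "ent (\<Psi> (sqm A)) i j = 0" for i j
    using bspec[OF S, of "\<lambda>A. ent (\<Psi> (sqm A)) i j"] by auto
  then show ?thesis by (intro sqmat_eqI) simp
qed

text \<open>The preimage of the closure under a regular map is closed and contains \<open>W\<close>.\<close>

lemma Zcl_map:
  assumes G: "zariski_closed G" "W \<subseteq> G" and r: "regular_map \<Psi>" and W: "\<And>A. A \<in> W \<Longrightarrow> mat_of (\<Psi> (sqm A)) \<in> Zcl G W"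
    and A: "A \<in> Zcl G W" "mat_of (\<Psi> (sqm A)) \<in> carrier GL"
  shows "mat_of (\<Psi> (sqm A)) \<in> Zcl G W"
proof -
  obtain P where P: "Zcl G W = {A \<in> carrier GL. \<forall>f\<in>P. eval_at f A = 0}"
    using Zcl_props(1)[OF G] unfolding zariski_closed_def by blast
  define S where "S = {A \<in> carrier GL. \<forall>F\<in>{F. \<exists>f\<in>P. F = (\<lambda>A. eval_at f (mat_of (\<Psi> (sqm A))))}. F A = 0}"
  have "regular (\<lambda>A. eval_at f (mat_of (\<Psi> (sqm A))))" for f
    using r by (intro regular_eval_at_compose) (simp add: regular_map_def mat_of_simps)
  then have "zariski_closed S"
    unfolding S_def by (intro zariski_closed_regular) auto
  moreover have "W \<subseteq> carrier GL" using G unfolding zariski_closed_def by blast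
  then have "W \<subseteq> S" unfolding S_def using W P by auto
  ultimately have "A \<in> S" using Zcl_props(4)[OF G] A(1) by blast
  then have S: "\<forall>F\<in>{F. \<exists>f\<in>P. F = (\<lambda>A. eval_at f (mat_of (\<Psi> (sqm A))))}. F A = 0" unfolding S_def by simp
  have "eval_at f (mat_of (\<Psi> (sqm A))) = 0" if "f \<in> P" for f
    using bspec[OF S, of "\<lambda>A. eval_at f (mat_of (\<Psi> (sqm A)))"] that by auto
  then show ?thesis using A(2) unfolding P by simp
qed

text \<open>Products and commutators are treated in one variable at a time, first for one factor in the closure and then for both. For
  inverses, \<open>A \<mapsto> A\<^sup>-\<^sup>1\<close> is a regular map on unipotent matrices, namely the power with exponent \<open>-1\<close>.\<close>

lemma Zcl_commutative_unipotent:
  fixes G W :: "('a::alg_closed_field^'n::finite^'n) set"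
  assumes c0: "CHAR('a) = 0" and G: "zariski_closed G" "W \<subseteq> G" and one: "mat 1 \<in> W"
    and mult: "\<And>A B. A \<in> W \<Longrightarrow> B \<in> W \<Longrightarrow> A ** B \<in> W"
    and inv: "\<And>A. A \<in> W \<Longrightarrow> \<exists>B\<in>W. A ** B = mat 1"
    and comm: "\<And>A B. A \<in> W \<Longrightarrow> B \<in> W \<Longrightarrow> A ** B = B ** A"
    and uni: "\<And>A. A \<in> W \<Longrightarrow> (sqm A - 1) ^ N = 0"
  shows "comm_group (GL\<lparr>carrier := Zcl G W\<rparr>) \<and> unipotent_algebraic_group (Zcl G W)"
proof -
  define Z where "Z = Zcl G W"
  note Zp = Zcl_props[OF G, folded Z_def]
  have ZGL: "Z \<subseteq> carrier GL" using Zp(1) unfolding zariski_closed_def by blast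
  have Zuni: "(sqm A - 1) ^ N = 0" if "A \<in> Z" for A
  proof (rule Zcl_equation[OF G, where \<Psi> = "\<lambda>Y. (Y - 1) ^ N"])
    show "A \<in> Zcl G W" using that by (simp add: Z_def)
    show "(sqm C - 1) ^ N = 0" if "C \<in> W" for C using uni[OF that] .
    show "regular_map (\<lambda>Y :: ('a, 'n) sqmat. (Y - 1) ^ N)"
      by (intro regular_map_power regular_map_diff regular_map_id regular_map_const)
  qed
  have GLm: "A ** B \<in> carrier GL" if "A \<in> carrier GL" "B \<in> carrier GL" for A B :: "'a^'n^'n"
    using group.is_monoid[OF group_GL] monoid.m_closed[of GL A B] that by (simp add: GL_def)
  have m1: "A ** B \<in> Z" if A: "A \<in> Z" and B: "B \<in> W" for A B
  proof -
    have "mat_of (sqm A * sqm B) \<in> Z" unfolding Z_def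
    proof (rule Zcl_map[OF G, where \<Psi> = "\<lambda>Y. Y * sqm B"])
      show "regular_map (\<lambda>Y. Y * sqm B)" by (intro regular_map_mult regular_map_id regular_map_const)
      show "mat_of (sqm A * sqm B) \<in> Zcl G W" if "A \<in> W" for A
        using mult[OF that B] Zp(2) by (auto simp: Z_def mat_of_simps)
      show "A \<in> Zcl G W" using A by (simp add: Z_def)
      show "mat_of (sqm A * sqm B) \<in> carrier GL"
        using GLm[of A B] A B ZGL Zp(2) by (auto simp: mat_of_simps)
    qed
    then show ?thesis by (simp add: mat_of_simps)
  qed
  have m2: "A ** B \<in> Z" if A: "A \<in> Z" and B: "B \<in> Z" for A B
  proof -
    have "mat_of (sqm A * sqm B) \<in> Z" unfolding Z_def
    proof (rule Zcl_map[OF G, where \<Psi> = "\<lambda>Y. sqm A * Y"])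
      show "regular_map (\<lambda>Y. sqm A * Y)" by (intro regular_map_mult regular_map_id regular_map_const)
      show "mat_of (sqm A * sqm B) \<in> Zcl G W" if "B \<in> W" for B
        using m1[OF A that] by (simp add: Z_def mat_of_simps)
      show "B \<in> Zcl G W" using B by (simp add: Z_def)
      show "mat_of (sqm A * sqm B) \<in> carrier GL"
        using GLm[of A B] A B ZGL by (auto simp: mat_of_simps)
    qed
    then show ?thesis by (simp add: mat_of_simps)
  qed
  have c1: "sqm A * sqm B = sqm B * sqm A" if A: "A \<in> Z" and B: "B \<in> W" for A B
  proof -
    have "sqm A * sqm B - sqm B * sqm A = 0"
    proof (rule Zcl_equation[OF G, where \<Psi> = "\<lambda>Y. Y * sqm B - sqm B * Y"])
      show "regular_map (\<lambda>Y. Y * sqm B - sqm B * Y)"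
        by (intro regular_map_diff regular_map_mult regular_map_id regular_map_const)
      show "sqm A * sqm B - sqm B * sqm A = 0" if "A \<in> W" for A
        using comm[OF that B] by (simp flip: sqm_mult)
      show "A \<in> Zcl G W" using A by (simp add: Z_def)
    qed
    then show ?thesis by simp
  qed
  have c2: "A ** B = B ** A" if A: "A \<in> Z" and B: "B \<in> Z" for A B
  proof -
    have "sqm A * sqm B - sqm B * sqm A = 0"
    proof (rule Zcl_equation[OF G, where \<Psi> = "\<lambda>Y. sqm A * Y - Y * sqm A"])
      show "regular_map (\<lambda>Y. sqm A * Y - Y * sqm A)"
        by (intro regular_map_diff regular_map_mult regular_map_id regular_map_const)
      show "sqm A * sqm B - sqm B * sqm A = 0" if "B \<in> W" for B
        using c1[OF A that] by simp
      show "B \<in> Zcl G W" using B by (simp add: Z_def)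
    qed
    then show ?thesis by (metis eq_iff_diff_eq_0 sqm_mult sqm_mat_of(1))
  qed
  have pinv: "sqm A * pw N (sqm A) (- 1) = 1" "pw N (sqm A) (- 1) * sqm A = 1" if "A \<in> Z" for A
    using pw_inverse[OF c0 Zuni[OF that], of 1] pw_1[OF c0 Zuni[OF that]] by simp_all
  have i1: "mat_of (pw N (sqm A) (- 1)) \<in> Z" if A: "A \<in> Z" for A
    unfolding Z_def
  proof (rule Zcl_map[OF G, where \<Psi> = "\<lambda>Y. pw N Y (- 1)"])
    show "regular_map (\<lambda>Y :: ('a, 'n) sqmat. pw N Y (- 1))" by (rule regular_map_pw)
    show "mat_of (pw N (sqm A) (- 1)) \<in> Zcl G W" if A: "A \<in> W" for A
    proof -
      obtain B where B: "B \<in> W" "A ** B = mat 1" using inv[OF A] by blast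
      have "A \<in> Z" using A Zp(2) by blast
      have "sqm A * sqm B = 1" using B(2) by (metis sqm_mult sqm_1)
      then have "pw N (sqm A) (- 1) = pw N (sqm A) (- 1) * (sqm A * sqm B)" by simp
      also have "\<dots> = sqm B"
        using pinv(2)[OF \<open>A \<in> Z\<close>] by (simp flip: mult.assoc)
      finally have "pw N (sqm A) (- 1) = sqm B" .
      then show ?thesis using B(1) Zp(2) by (auto simp: Z_def)
    qed
    show "A \<in> Zcl G W" using A by (simp add: Z_def)
    show "mat_of (pw N (sqm A) (- 1)) \<in> carrier GL"
      using pinv[OF A] unfolding GL_def by (auto simp: invertible_iff)
  qed
  have sub: "subgroup Z GL"
  proof
    show "Z \<subseteq> carrier GL" by fact
    show "A \<otimes>\<^bsub>GL\<^esub> B \<in> Z" if "A \<in> Z" "B \<in> Z" for A B using m2[OF that] by (simp add: GL_def)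
    show "\<one>\<^bsub>GL\<^esub> \<in> Z" using one Zp(2) by (auto simp: GL_def)
    show "inv\<^bsub>GL\<^esub> A \<in> Z" if A: "A \<in> Z" for A
    proof -
      have "mat_of (pw N (sqm A) (- 1)) ** A = mat 1"
        using pinv(2)[OF A] by (metis mat_of_simps(1,2) sqm_mat_of(1))
      then have "inv\<^bsub>GL\<^esub> A = mat_of (pw N (sqm A) (- 1))"
        using A i1[OF A] ZGL by (intro group.inv_equality[OF group_GL]) (auto simp: GL_def)
      then show ?thesis using i1[OF A] by simp
    qed
  qed
  have "comm_group (GL\<lparr>carrier := Z\<rparr>)"
  proof (rule group.group_comm_groupI)
    show "group (GL\<lparr>carrier := Z\<rparr>)" by (rule group.subgroup_imp_group[OF group_GL sub])
  qed (use c2 in \<open>simp add: GL_def\<close>)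
  moreover have "unipotent_algebraic_group Z"
    unfolding unipotent_algebraic_group_def algebraic_group_def
    using sub Zp(1) Zuni by (auto simp: unipotent_matrix_iff)
  ultimately show ?thesis by (simp add: Z_def)
qed

section \<open>Images of unipotent groups\<close>

theorem corollary1p2:
  fixes p :: nat
    and G :: "('k::field alg_closure^'n::finite^'n) set"
    and U :: "('l::field alg_closure^'m::finite^'m) set"
    and \<phi> :: "'l alg_closure^'m^'m \<Rightarrow> 'k alg_closure^'n^'n"
  assumes "normalization_semidom_class.prime p"
    and "number_field TYPE('k) \<or> padic_local_field p TYPE('k)"
    and "algebraic_group G" and "defined_over_base G"
    and "(algebraically_closed_field TYPE('l) \<and> CHAR('l) = 0)
         \<or> isomorphic_to_reals TYPE('l)
         \<or> (\<exists>l. normalization_semidom_class.prime l \<and> l \<noteq> p \<and> padic_local_field l TYPE('l))"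
    and "unipotent_algebraic_group U" and "defined_over_base U"
    and "\<phi> \<in> hom (GL\<lparr>carrier := rational_points U\<rparr>) (GL\<lparr>carrier := rational_points G\<rparr>)"
  shows "comm_group (GL\<lparr>carrier := Zcl G (\<phi> ` rational_points U)\<rparr>) \<and>
         unipotent_algebraic_group (Zcl G (\<phi> ` rational_points U))"
proof -
  note kfield = base_field_data[OF assms(1,2)]
  note lfield = source_field_data[OF assms(1,5)]
  let ?K = "range (to_ac :: 'k \<Rightarrow> 'k alg_closure)"
  let ?L = "range (to_ac :: 'l \<Rightarrow> 'l alg_closure)"
  note K = sub_field_range_to_ac[where 'a = 'k] and L = sub_field_range_to_ac[where 'a = 'l]
  obtain F B e where FBe: "padic_subfield F B p" "spanned_by F e ?K" using kfield(2) by blast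
  obtain r where r: "r > 0" "\<And>b. \<exists>Q>b. \<exists>y\<in>?L. y ^ Q = of_nat p ^ r" using lfield(2) by blast
  have algU: "algebraic_group U" and uniU: "\<And>A. A \<in> U \<Longrightarrow> unipotent_matrix A"
    using assms(6) by (auto simp: unipotent_algebraic_group_def)
  have subU: "subgroup U GL" using algU by (simp add: algebraic_group_def)
  define V where "V = sqm ` rational_points U"
  have V1: "1 \<in> V"
  proof -
    have "mat 1 \<in> U" using subgroup.one_closed[OF subU] by (simp add: GL_def)
    then have "mat 1 \<in> rational_points U"
      using sub_fieldD(1,2)[OF L] by (auto simp: rational_points_def mat_def)
    then show ?thesis unfolding V_def by (metis image_eqI sqm_1)
  qed
  have rat_mult: "A ** C \<in> rational_points U" if "A \<in> rational_points U" "C \<in> rational_points U" for A C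
  proof -
    have "A ** C \<in> U" using subgroup.m_closed[OF subU, of A C] that by (simp add: GL_def rational_points_def)
    moreover have "(A ** C) $ i $ j \<in> ?L" for i j
      using that unfolding matrix_matrix_mult_def rational_points_def
      by (auto intro!: sub_fieldD(11,4)[OF L])
    ultimately show ?thesis by (simp add: rational_points_def)
  qed
  have Vm: "x * y \<in> V" if "x \<in> V" "y \<in> V" for x y
    using that rat_mult unfolding V_def by (auto simp flip: sqm_mult)
  have Vu: "\<exists>k. (x - 1) ^ k = 0" if "x \<in> V" for x
    using that uniU unfolding V_def by (auto simp: rational_points_def unipotent_matrix_iff)
  interpret S: unipotent_semigroup V
    by unfold_locales (use lfield(1) V1 Vm Vu in auto)
  obtain J N where J: "\<forall>i. sqm.subspace (J i)" "\<forall>i j. \<forall>a\<in>J i. \<forall>b\<in>J j. a * b \<in> J (i + j)"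
      "\<forall>i. J (Suc i) \<subseteq> J i" "J N = {0}" "1 \<in> J 0" "\<forall>x\<in>V. x - 1 \<in> J (Suc 0)"
    using S.kolchin_filtration by (elim exE conjE) (rule that)
  have uN: "(x - 1) ^ N = 0" if x: "x \<in> V" for x
  proof -
    have "(x - 1) ^ k \<in> J k" for k
    proof (induction k)
      case (Suc k)
      have "(x - 1) * (x - 1) ^ k \<in> J (Suc 0 + k)" using J(2,6) x Suc by blast
      then show ?case by simp
    qed (use J(5) in simp)
    then show ?thesis using J(4) by blast
  qed
  interpret T: unipotent_filtration V ?L J N
  proof
    show "pw N x t \<in> V" if "x \<in> V" "t \<in> ?L" for x t
      using rational_points_pw[OF lfield(1) algU] uN that unfolding V_def by blast
  qed (use lfield(1) L V1 Vm J in auto)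
  define \<phi>' where "\<phi>' Y = sqm (\<phi> (mat_of Y))" for Y
  have phi_in: "\<phi> A \<in> rational_points G" if "A \<in> rational_points U" for A
    using assms(8) that by (auto simp: hom_def)
  have phi_mult: "\<phi> (A ** C) = \<phi> A ** \<phi> C" if "A \<in> rational_points U" "C \<in> rational_points U" for A C
    using assms(8) that by (auto simp: hom_def GL_def)
  have Vrat: "mat_of x \<in> rational_points U" if "x \<in> V" for x using that by (auto simp: V_def)
  have hom: "\<phi>' (x * y) = \<phi>' x * \<phi>' y" if "x \<in> V" "y \<in> V" for x y
    unfolding \<phi>'_def mat_of_simps using phi_mult[OF Vrat[OF that(1)] Vrat[OF that(2)]] by (simp add: sqm_mult)
  have GL_G: "G \<subseteq> carrier GL" using assms(3) unfolding algebraic_group_def zariski_closed_def by blast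
  have hom1: "\<phi>' 1 = 1"
  proof -
    have "\<phi> (mat_of 1) \<in> carrier GL" using phi_in[OF Vrat[OF V1]] GL_G by (auto simp: rational_points_def)
    then obtain C where C: "C * \<phi>' 1 = 1" unfolding GL_def \<phi>'_def by (auto simp: invertible_iff)
    have "C * (\<phi>' 1 * \<phi>' 1) = C * \<phi>' 1" using hom[OF V1 V1] by simp
    then show ?thesis using C by (simp flip: mult.assoc)
  qed
  have ent: "\<phi>' x \<in> entries_in ?K" if "x \<in> V" for x
    using phi_in[OF Vrat[OF that]] by (auto simp: \<phi>'_def entries_in_def rational_points_def ent.abs_eq)
  have hom_power: "\<phi>' (x ^ k) = \<phi>' x ^ k" if "x \<in> V" for x k
    by (induction k) (use hom[OF that T.Vpower[OF that]] hom1 in simp_all)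
  define D where "D = card (UNIV :: ('n \<times> 'n) set) * e"
  have uphi: "(\<phi>' x - 1) ^ D = 0" if x: "x \<in> V" for x
    unfolding D_def
  proof (rule divisible_matrix_unipotent[OF FBe K])
    show "\<phi>' (T.vinv x) * \<phi>' x = 1" using hom[OF T.vinv_V[OF x] x] T.vinv_mult[OF x] hom1 by simp
    fix k :: nat assume k: "k > 0"
    define t :: "'l alg_closure" where "t = inverse (of_nat k)"
    have t: "t \<in> ?L" unfolding t_def by (intro sub_fieldD(5,10)[OF L])
    have kt: "of_nat k * t = 1" unfolding t_def using k of_nat_eq_0_CHAR_0[OF lfield(1), of k] by simp
    have "pw N x t ^ k = x" using pw_mult_of_nat[OF lfield(1) uN[OF x], of k t] T.pone[OF x] kt by simp
    then have "\<phi>' (pw N x t) ^ k = \<phi>' x" using hom_power[OF T.Vpw[OF x t], of k] by simp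
    then show "\<exists>C\<in>entries_in ?K. C ^ k = \<phi>' x" using ent[OF T.Vpw[OF x t]] by blast
  qed
  have comm: "\<phi>' x * \<phi>' y = \<phi>' y * \<phi>' x" if "x \<in> V" "y \<in> V" for x y
    by (rule T.homomorphic_image_commutative[OF kfield(1) FBe K r hom hom1 ent uphi that])
  have Wsq: "\<phi> A = mat_of (\<phi>' (sqm A))" "A \<in> rational_points U \<Longrightarrow> sqm A \<in> V" for A
    by (simp_all add: \<phi>'_def V_def)
  show ?thesis
  proof (rule Zcl_commutative_unipotent[OF kfield(1)])
    show "zariski_closed G" using assms(3) by (simp add: algebraic_group_def)
    show "\<phi> ` rational_points U \<subseteq> G" using phi_in by (auto simp: rational_points_def)
    have "\<phi> (mat_of 1) = mat 1" using hom1 by (metis Wsq(1) sqm_mat_of(2) mat_of_simps(2))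
    then show "mat 1 \<in> \<phi> ` rational_points U" using Vrat[OF V1] by (metis image_eqI)
    fix A assume "A \<in> \<phi> ` rational_points U"
    then obtain a where a: "a \<in> rational_points U" "A = \<phi> a" by blast
    show "(sqm A - 1) ^ D = 0" using uphi[OF Wsq(2)[OF a(1)]] by (simp add: a(2) \<phi>'_def)
    have "sqm A * sqm (\<phi> (mat_of (T.vinv (sqm a)))) = 1"
      using hom[OF Wsq(2)[OF a(1)] T.vinv_V[OF Wsq(2)[OF a(1)]]] T.vinv_mult(2)[OF Wsq(2)[OF a(1)]] hom1
      by (simp add: a(2) \<phi>'_def)
    then have "A ** \<phi> (mat_of (T.vinv (sqm a))) = mat 1" by (metis mat_of_simps(1,2) sqm_mat_of(1))
    then show "\<exists>C\<in>\<phi> ` rational_points U. A ** C = mat 1"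
      using Vrat[OF T.vinv_V[OF Wsq(2)[OF a(1)]]] by blast
    fix C assume "C \<in> \<phi> ` rational_points U"
    then obtain c where c: "c \<in> rational_points U" "C = \<phi> c" by blast
    show "A ** C \<in> \<phi> ` rational_points U"
      using rat_mult[OF a(1) c(1)] phi_mult[OF a(1) c(1)] a(2) c(2) by (metis image_eqI)
    have "sqm A * sqm C = sqm C * sqm A"
      using comm[OF Wsq(2)[OF a(1)] Wsq(2)[OF c(1)]] by (simp add: a(2) c(2) \<phi>'_def)
    then show "A ** C = C ** A" by (metis mat_of_simps(1) sqm_mat_of(1))
  qed
qed

end
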